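(* Let $\pi$ be a unitary representation of $\Gamma$ on a Hilbert space $\mathcal H$ and $\delta$ a unitary operator on $\mathcal H$ with $\delta^{-1}\pi_\gamma\delta=\pi_{\alpha(\gamma)}$ for all $\gamma\in\Gamma$. Suppose $\{V_j\}_{j=-\infty}^{\infty}$ is a collection of closed subspaces of $\mathcal H$ that satisfies all the conditions for a GMRA relative to $\pi$ and $\delta$, except possibly the condition that $\bigcap_j V_j=\{0\}$; that is: $V_j\subseteq V_{j+1}$ for all $j$; $V_{j+1}=\delta(V_j)$ for all $j$; $\bigcup_j V_j$ is dense in $\mathcal H$; and $V_0$ is invariant under $\pi$. Assume that the measure $\mu$ associated to the representation $\pi$ restricted to $V_0$ is Haar measure on $\widehat\Gamma$, and that the associated multiplicity function $m$ is finite on a set of positive measure. Then the following conditions are equivalent: (1) $\bigcap_j V_j\ne\{0\}$. (2) $\delta$ has an eigenvector. (3) The representation $\widetilde\pi$ of $G$ contains a subrepresentation equivalent to the representation $P^\lambda$ for some $\lambda$ with $|\lambda|=1$.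
   Context: Setting. $\Gamma$ is a countable (discrete) abelian group, written additively, with compact dual group $\widehat\Gamma$, written multiplicatively and equipped with Haar measure of total mass 1. $\alpha:\Gamma\to\Gamma$ is an injective homomorphism such that the index of $\alpha(\Gamma)$ in $\Gamma$ is a finite number $N>1$ and $\bigcap_{n\ge 0}\alpha^n(\Gamma)=\{0\}$. Associated measure and multiplicity function. By Stone's Theorem, the restriction of $\pi$ to $V_0$ determines a finite Borel measure $\mu$ on $\widehat\Gamma$ (unique up to equivalence of measures), Borel subsets $\sigma_1\supseteq\sigma_2\supseteq\cdots$ of $\widehat\Gamma$ (unique up to $\mu$-null sets), and a (not necessarily unique) unitary operator $J:V_0\to\bigoplus_i L^2(\sigma_i,\mu)$ with $[J(\pi_\gamma(f))](\omega)=\omega(\gamma)[J(f)](\omega)$ for all $\gamma\in\Gamma$, $f\in V_0$ and $\mu$-almost all $\omega$. The multiplicity function is $m=\sum_i\chi_{\sigma_i}:\widehat\Gamma\to\{0,1,2,\ldots,\infty\}$. The group $D$. $D$ is the direct limit of $\Gamma$ under $\alpha$: the set of equivalence classes $[\gamma,k]$ of pairs $(\gamma,k)$, $\gamma\in\Gamma$, $k\ge0$ an integer, under $(\gamma,k)\equiv(\gamma',k')$ iff $\alpha^{k'}(\gamma)=\alpha^k(\gamma')$, with addition $[\gamma_1,k_1]+[\gamma_2,k_2]=[\alpha^{k_2}(\gamma_1)+\alpha^{k_1}(\gamma_2),k_1+k_2]$. It is an abelian group, and $\widetilde\alpha([\gamma,k])=[\alpha(\gamma),k]$ defines an automorphism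 of $D$ with inverse $\widetilde\alpha^{-1}([\gamma,k])=[\gamma,k+1]$. The group $G$. $G=D\rtimes\mathbb Z$ with multiplication $(d_1,j_1)\times(d_2,j_2)=(d_1+\widetilde\alpha^{j_1}(d_2),j_1+j_2)$. The representation $\widetilde\pi$ of $G$ on $\mathcal H$ is $\widetilde\pi_{([\gamma,k],j)}=\delta^k\pi_\gamma\delta^{-k-j}$. For $|\lambda|=1$, $P^\lambda$ is the unitary representation of $G$ on $l^2(D)$ given by $[P^\lambda_{(d,j)}(f)](d')=\lambda^j f(\widetilde\alpha^{-j}(d'-d))$. Equivalence of representations means unitary equivalence. *)

theory Defs
  imports "HOL-Analysis.Analysis"
begin

section \<open>Complex Hilbert spaces\<close>

text \<open>
  The inner product is linear in its first argument. The metric, topology and real vector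
  space structure are those of the underlying real Banach space.
\<close>

class complex_hilbert = banach +
  fixes scaleC :: "complex \<Rightarrow> 'a \<Rightarrow> 'a" (infixr "*\<^sub>C" 75)
    and cinner :: "'a \<Rightarrow> 'a \<Rightarrow> complex"
  assumes scaleC_add_right: "c *\<^sub>C (x + y) = c *\<^sub>C x + c *\<^sub>C y"
    and scaleC_add_left: "(c + d) *\<^sub>C x = c *\<^sub>C x + d *\<^sub>C x"
    and scaleC_scaleC: "c *\<^sub>C d *\<^sub>C x = (c * d) *\<^sub>C x"
    and scaleC_of_real: "complex_of_real r *\<^sub>C x = r *\<^sub>R x"
    and cinner_add_left: "cinner (x + y) z = cinner x z + cinner y z"
    and cinner_scaleC_left: "cinner (c *\<^sub>C x) y = c * cinner x y"
    and cinner_commute: "cinner y x = cnj (cinner x y)"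
    and cinner_self: "cinner x x = complex_of_real ((norm x)\<^sup>2)"

definition clinear_on :: "'h::complex_hilbert set \<Rightarrow> ('h \<Rightarrow> 'h) \<Rightarrow> bool" where
  "clinear_on S U \<longleftrightarrow>
     (\<forall>x\<in>S. \<forall>y\<in>S. U (x + y) = U x + U y) \<and> (\<forall>c. \<forall>x\<in>S. U (c *\<^sub>C x) = c *\<^sub>C U x)"

definition unitary_op :: "('h::complex_hilbert \<Rightarrow> 'h) \<Rightarrow> bool" where
  "unitary_op U \<longleftrightarrow>
     clinear_on UNIV U \<and> surj U \<and> (\<forall>x y. cinner (U x) (U y) = cinner x y)"

definition closed_csubspace :: "'h::complex_hilbert set \<Rightarrow> bool" where
  "closed_csubspace S \<longleftrightarrow>
     closed S \<and> 0 \<in> S \<and> (\<forall>x\<in>S. \<forall>y\<in>S. x + y \<in> S) \<and> (\<forall>c. \<forall>x\<in>S. c *\<^sub>C x \<in> S)"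

definition is_eigenvector :: "('h::complex_hilbert \<Rightarrow> 'h) \<Rightarrow> 'h \<Rightarrow> bool" where
  "is_eigenvector U f \<longleftrightarrow> f \<noteq> 0 \<and> (\<exists>c. U f = c *\<^sub>C f)"

definition unitary_rep :: "('g::ab_group_add \<Rightarrow> 'h::complex_hilbert \<Rightarrow> 'h) \<Rightarrow> bool" where
  "unitary_rep \<pi> \<longleftrightarrow>
     (\<forall>a. unitary_op (\<pi> a)) \<and> (\<forall>a b. \<pi> (a + b) = \<pi> a \<circ> \<pi> b)"

definition op_power :: "('h \<Rightarrow> 'h) \<Rightarrow> int \<Rightarrow> 'h \<Rightarrow> 'h" where
  "op_power U j = (if 0 \<le> j then U ^^ nat j else inv U ^^ nat (- j))"


section \<open>The endomorphism of the discrete group\<close>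

definition cosets :: "'g::ab_group_add set \<Rightarrow> 'g set set" where
  "cosets H = range (\<lambda>x. (+) x ` H)"

locale dilation_endomorphism =
  fixes \<alpha> :: "'g::{ab_group_add,countable} \<Rightarrow> 'g"
  assumes hom: "\<alpha> (x + y) = \<alpha> x + \<alpha> y"
    and injective: "inj \<alpha>"
    and finite_index: "finite (cosets (range \<alpha>))"
    and index_gt_1: "card (cosets (range \<alpha>)) > 1"
    and Inter_powers: "(\<Inter>n. range (\<alpha> ^^ n)) = {0}"


section \<open>The dual group, Haar measure and multiplicity\<close>

definition dual_group :: "('g::ab_group_add \<Rightarrow> complex) set" where
  "dual_group = {\<omega>. (\<forall>a b. \<omega> (a + b) = \<omega> a * \<omega> b) \<and> (\<forall>a. cmod (\<omega> a) = 1)}"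

text \<open>
  The topology of the dual of a discrete group is that of pointwise convergence, i.e. the
  subspace topology inherited from the product topology on all functions.
\<close>

definition dual_borel :: "('g::ab_group_add \<Rightarrow> complex) measure" where
  "dual_borel = restrict_space borel dual_group"

definition is_haar_measure :: "('g::ab_group_add \<Rightarrow> complex) measure \<Rightarrow> bool" where
  "is_haar_measure \<mu> \<longleftrightarrow>
     sets \<mu> = sets dual_borel \<and> emeasure \<mu> (space \<mu>) = 1 \<and>
     (\<forall>\<eta>\<in>dual_group. \<forall>E\<in>sets \<mu>. emeasure \<mu> ((\<lambda>\<omega> a. \<eta> a * \<omega> a) ` E) = emeasure \<mu> E)"

text \<open>
  Elements of the Hilbert space direct sum of the spaces \<open>L\<^sup>2(\<sigma> i, \<mu>)\<close> are
  given by representatives, extended by zero outside \<open>\<sigma> i\<close>; two representatives are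
  equal as elements iff they agree componentwise almost everywhere. The index set is the
  natural numbers, starting from 0, and \<open>\<sigma> i\<close> may be empty.
\<close>

definition L2_sum :: "'w measure \<Rightarrow> (nat \<Rightarrow> 'w set) \<Rightarrow> (nat \<Rightarrow> 'w \<Rightarrow> complex) set" where
  "L2_sum \<mu> \<sigma> = {h. (\<forall>i. h i \<in> borel_measurable \<mu> \<and> (\<forall>\<omega>. \<omega> \<notin> \<sigma> i \<longrightarrow> h i \<omega> = 0)) \<and>
     (\<Sum>i. \<integral>\<^sup>+\<omega>. ennreal ((cmod (h i \<omega>))\<^sup>2) \<partial>\<mu>) < \<infinity>}"

definition unitary_onto_L2_sum ::
  "'h::complex_hilbert set \<Rightarrow> 'w measure \<Rightarrow> (nat \<Rightarrow> 'w set) \<Rightarrow> ('h \<Rightarrow> nat \<Rightarrow> 'w \<Rightarrow> complex) \<Rightarrow> bool"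
where
  "unitary_onto_L2_sum S \<mu> \<sigma> J \<longleftrightarrow>
     (\<forall>f\<in>S. J f \<in> L2_sum \<mu> \<sigma>) \<and>
     (\<forall>f\<in>S. \<forall>g\<in>S. \<forall>i. AE \<omega> in \<mu>. J (f + g) i \<omega> = J f i \<omega> + J g i \<omega>) \<and>
     (\<forall>c. \<forall>f\<in>S. \<forall>i. AE \<omega> in \<mu>. J (c *\<^sub>C f) i \<omega> = c * J f i \<omega>) \<and>
     (\<forall>f\<in>S. \<forall>g\<in>S. (\<lambda>i. LINT \<omega>|\<mu>. J f i \<omega> * cnj (J g i \<omega>)) sums cinner f g) \<and>
     (\<forall>h\<in>L2_sum \<mu> \<sigma>. \<exists>f\<in>S. \<forall>i. AE \<omega> in \<mu>. J f i \<omega> = h i \<omega>)"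

text \<open>
  \<open>\<mu>\<close>, \<open>\<sigma>\<close> and \<open>J\<close> are data associated by Stone's theorem to the restriction of the
  representation \<open>\<pi>\<close> to the invariant subspace \<open>S\<close>.
\<close>

definition stone_data ::
  "('g::ab_group_add \<Rightarrow> 'h::complex_hilbert \<Rightarrow> 'h) \<Rightarrow> 'h set \<Rightarrow> ('g \<Rightarrow> complex) measure \<Rightarrow>
   (nat \<Rightarrow> ('g \<Rightarrow> complex) set) \<Rightarrow> ('h \<Rightarrow> nat \<Rightarrow> ('g \<Rightarrow> complex) \<Rightarrow> complex) \<Rightarrow> bool"
where
  "stone_data \<pi> S \<mu> \<sigma> J \<longleftrightarrow>
     finite_measure \<mu> \<and> sets \<mu> = sets dual_borel \<and>
     (\<forall>i. \<sigma> i \<in> sets \<mu>) \<and> decseq \<sigma> \<and> unitary_onto_L2_sum S \<mu> \<sigma> J \<and>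
     (\<forall>a. \<forall>f\<in>S. \<forall>i. AE \<omega> in \<mu>. J (\<pi> a f) i \<omega> = \<omega> a * J f i \<omega>)"

definition multiplicity_fun :: "(nat \<Rightarrow> 'w set) \<Rightarrow> 'w \<Rightarrow> ennreal" where
  "multiplicity_fun \<sigma> \<omega> = (\<Sum>i. indicator (\<sigma> i) \<omega>)"


section \<open>Multiresolution structure without the intersection condition\<close>

definition gmra_except_intersection ::
  "('g::ab_group_add \<Rightarrow> 'h::complex_hilbert \<Rightarrow> 'h) \<Rightarrow> ('h \<Rightarrow> 'h) \<Rightarrow> (int \<Rightarrow> 'h set) \<Rightarrow> bool"
where
  "gmra_except_intersection \<pi> \<delta> V \<longleftrightarrow>
     (\<forall>j. closed_csubspace (V j)) \<and>
     (\<forall>j. V j \<subseteq> V (j + 1)) \<and>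
     (\<forall>j. V (j + 1) = \<delta> ` V j) \<and>
     closure (\<Union>j. V j) = UNIV \<and>
     (\<forall>a. \<pi> a ` V 0 \<subseteq> V 0)"


section \<open>The direct limit group and its semidirect product with the integers\<close>

definition dl_rel :: "('g \<Rightarrow> 'g) \<Rightarrow> (('g \<times> nat) \<times> ('g \<times> nat)) set" where
  "dl_rel \<alpha> = {((a, k), (a', k')). (\<alpha> ^^ k') a = (\<alpha> ^^ k) a'}"

definition dl_class :: "('g \<Rightarrow> 'g) \<Rightarrow> 'g \<Rightarrow> nat \<Rightarrow> ('g \<times> nat) set" where
  "dl_class \<alpha> a k = dl_rel \<alpha> `` {(a, k)}"

definition dl_carrier :: "('g \<Rightarrow> 'g) \<Rightarrow> ('g \<times> nat) set set" where
  "dl_carrier \<alpha> = UNIV // dl_rel \<alpha>"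

text \<open>
  Operations on classes are unions over representatives; that they do not depend on the
  representatives is shown below.
\<close>

definition dl_add ::
  "('g::ab_group_add \<Rightarrow> 'g) \<Rightarrow> ('g \<times> nat) set \<Rightarrow> ('g \<times> nat) set \<Rightarrow> ('g \<times> nat) set" where
  "dl_add \<alpha> d d' =
     (\<Union>(a, k)\<in>d. \<Union>(a', k')\<in>d'. dl_class \<alpha> ((\<alpha> ^^ k') a + (\<alpha> ^^ k) a') (k + k'))"

definition dl_uminus :: "('g::ab_group_add \<Rightarrow> 'g) \<Rightarrow> ('g \<times> nat) set \<Rightarrow> ('g \<times> nat) set" where
  "dl_uminus \<alpha> d = (\<Union>(a, k)\<in>d. dl_class \<alpha> (- a) k)"

definition dl_diff ::
  "('g::ab_group_add \<Rightarrow> 'g) \<Rightarrow> ('g \<times> nat) set \<Rightarrow> ('g \<times> nat) set \<Rightarrow> ('g \<times> nat) set" where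
  "dl_diff \<alpha> d d' = dl_add \<alpha> d (dl_uminus \<alpha> d')"

definition dl_alpha :: "('g \<Rightarrow> 'g) \<Rightarrow> ('g \<times> nat) set \<Rightarrow> ('g \<times> nat) set" where
  "dl_alpha \<alpha> d = (\<Union>(a, k)\<in>d. dl_class \<alpha> (\<alpha> a) k)"

definition dl_alpha_inv :: "('g \<Rightarrow> 'g) \<Rightarrow> ('g \<times> nat) set \<Rightarrow> ('g \<times> nat) set" where
  "dl_alpha_inv \<alpha> d = (\<Union>(a, k)\<in>d. dl_class \<alpha> a (k + 1))"

definition dl_alpha_power :: "('g \<Rightarrow> 'g) \<Rightarrow> int \<Rightarrow> ('g \<times> nat) set \<Rightarrow> ('g \<times> nat) set" where
  "dl_alpha_power \<alpha> j =
     (if 0 \<le> j then dl_alpha \<alpha> ^^ nat j else dl_alpha_inv \<alpha> ^^ nat (- j))"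

definition G_carrier :: "('g \<Rightarrow> 'g) \<Rightarrow> (('g \<times> nat) set \<times> int) set" where
  "G_carrier \<alpha> = dl_carrier \<alpha> \<times> UNIV"

definition G_mult :: "('g::ab_group_add \<Rightarrow> 'g) \<Rightarrow> ('g \<times> nat) set \<times> int \<Rightarrow>
    ('g \<times> nat) set \<times> int \<Rightarrow> ('g \<times> nat) set \<times> int" where
  "G_mult \<alpha> x y =
     (dl_add \<alpha> (fst x) (dl_alpha_power \<alpha> (snd x) (fst y)), snd x + snd y)"


section \<open>Representations of the semidirect product\<close>

text \<open>Independence of the chosen representative is \<open>tilde_rep_class\<close> below.\<close>

definition tilde_rep :: "('g \<Rightarrow> 'h \<Rightarrow> 'h) \<Rightarrow> ('h \<Rightarrow> 'h) \<Rightarrow> ('g \<times> nat) set \<times> int \<Rightarrow> 'h \<Rightarrow> 'h" where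
  "tilde_rep \<pi> \<delta> x =
     (let (a, k) = (SOME p. p \<in> fst x)
      in op_power \<delta> (int k) \<circ> \<pi> a \<circ> op_power \<delta> (- int k - snd x))"

definition l2 :: "'d set \<Rightarrow> ('d \<Rightarrow> complex) set" where
  "l2 D = {f. (\<forall>d. d \<notin> D \<longrightarrow> f d = 0) \<and> (\<lambda>d. (cmod (f d))\<^sup>2) summable_on D}"

definition P_rep :: "('g::ab_group_add \<Rightarrow> 'g) \<Rightarrow> complex \<Rightarrow> ('g \<times> nat) set \<times> int \<Rightarrow>
    (('g \<times> nat) set \<Rightarrow> complex) \<Rightarrow> ('g \<times> nat) set \<Rightarrow> complex" where
  "P_rep \<alpha> z x f = (\<lambda>d'. if d' \<in> dl_carrier \<alpha>
     then z powi snd x * f (dl_alpha_power \<alpha> (- snd x) (dl_diff \<alpha> d' (fst x)))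
     else 0)"

definition unitary_onto_l2 ::
  "'h::complex_hilbert set \<Rightarrow> 'd set \<Rightarrow> ('h \<Rightarrow> 'd \<Rightarrow> complex) \<Rightarrow> bool" where
  "unitary_onto_l2 W D U \<longleftrightarrow>
     U ` W = l2 D \<and>
     (\<forall>v\<in>W. \<forall>w\<in>W. \<forall>d. U (v + w) d = U v d + U w d) \<and>
     (\<forall>c. \<forall>v\<in>W. \<forall>d. U (c *\<^sub>C v) d = c * U v d) \<and>
     (\<forall>v\<in>W. \<forall>w\<in>W. (\<Sum>\<^sub>\<infinity>d\<in>D. U v d * cnj (U w d)) = cinner v w)"

text \<open>
  \<open>\<rho>\<close> and \<open>\<tau>\<close> are families of operators indexed by \<open>G\<close>, on a Hilbert space and on
  \<open>l2 D\<close>, respectively.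
\<close>

definition contains_subrep_equivalent_to ::
  "'x set \<Rightarrow> ('x \<Rightarrow> 'h::complex_hilbert \<Rightarrow> 'h) \<Rightarrow>
   'd set \<Rightarrow> ('x \<Rightarrow> ('d \<Rightarrow> complex) \<Rightarrow> 'd \<Rightarrow> complex) \<Rightarrow> bool" where
  "contains_subrep_equivalent_to G \<rho> D \<tau> \<longleftrightarrow>
     (\<exists>W U. closed_csubspace W \<and> (\<forall>x\<in>G. \<rho> x ` W \<subseteq> W) \<and>
        unitary_onto_l2 W D U \<and> (\<forall>x\<in>G. \<forall>w\<in>W. U (\<rho> x w) = \<tau> x (U w)))"


section \<open>Well-definedness\<close>

lemma op_power_add:
  assumes "bij U"
  shows "op_power U (i + j) = op_power U i \<circ> op_power U j"
proof -
  have inv1: "inv U (U x) = x" "U (inv U x) = x" for x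
    using assms by (auto simp: bij_def surj_f_inv_f)
  have up: "op_power U (j + 1) = U \<circ> op_power U j" for j
  proof (cases "0 \<le> j")
    case True
    then show ?thesis by (simp add: op_power_def nat_add_distrib)
  next
    case False
    then have "nat (- j) = Suc (nat (- j - 1))" by linarith
    then show ?thesis using False inv1
      by (cases "j = -1") (auto simp: op_power_def fun_eq_iff minus_diff_commute)
  qed
  have down: "op_power U (j - 1) = inv U \<circ> op_power U j" for j
    using up[of "j - 1"] inv1 by (auto simp: fun_eq_iff)
  show ?thesis
  proof (induction i rule: int_induct[where k = 0])
    case base
    then show ?case by (simp add: op_power_def fun_eq_iff)
  next
    case (step1 i)
    then show ?case using up[of "i + j"] up[of i] by (simp add: fun_eq_iff algebra_simps)
  next
    case (step2 i)
    then show ?case using down[of "i + j"] down[of i] by (simp add: fun_eq_iff algebra_simps)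
  qed
qed

lemma op_power_add_apply:
  assumes "bij U"
  shows "op_power U i (op_power U j f) = op_power U (i + j) f"
  by (simp add: op_power_add[OF assms])

lemma unitary_op_bij:
  assumes "unitary_op U"
  shows "bij U"
proof -
  have lin: "U (x + y) = U x + U y" "U (c *\<^sub>C x) = c *\<^sub>C U x" for x y c
    using assms by (auto simp: unitary_op_def clinear_on_def)
  have nrm: "norm (U x) = norm x" for x
  proof -
    have "complex_of_real ((norm (U x))\<^sup>2) = complex_of_real ((norm x)\<^sup>2)"
      using assms cinner_self[of x] cinner_self[of "U x"] by (simp add: unitary_op_def)
    then show ?thesis
      by (metis norm_ge_zero of_real_eq_iff power2_eq_imp_eq)
  qed
  have "x = y" if "U x = U y" for x y
  proof -
    have "U (x - y) + U y = U x" using lin(1)[of "x - y" y] by simp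
    then have "U (x - y) = 0" using that by simp
    then show ?thesis using nrm[of "x - y"] by simp
  qed
  then show ?thesis using assms by (auto simp: unitary_op_def bij_def inj_def)
qed

context dilation_endomorphism
begin

lemma pow_hom: "(\<alpha> ^^ n) (x + y) = (\<alpha> ^^ n) x + (\<alpha> ^^ n) y"
  by (induction n) (auto simp: hom)

lemma pow_zero: "(\<alpha> ^^ n) 0 = 0"
  using pow_hom[of n 0 0] by simp

lemma pow_uminus: "(\<alpha> ^^ n) (- x) = - (\<alpha> ^^ n) x"
proof -
  have "(\<alpha> ^^ n) x + (\<alpha> ^^ n) (- x) = 0"
    using pow_hom[of n x "- x"] pow_zero[of n] by simp
  then show ?thesis by (rule minus_unique[symmetric])
qed

lemma pow_eq_iff [simp]: "(\<alpha> ^^ n) x = (\<alpha> ^^ n) y \<longleftrightarrow> x = y"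
  using inj_fn[OF injective, of n] by (auto simp: inj_def)

lemma pow_pow: "(\<alpha> ^^ m) ((\<alpha> ^^ n) x) = (\<alpha> ^^ (m + n)) x"
  by (simp add: funpow_add)

lemma pow_commute: "(\<alpha> ^^ m) ((\<alpha> ^^ n) x) = (\<alpha> ^^ n) ((\<alpha> ^^ m) x)"
  by (simp add: pow_pow add.commute)

lemma pow_alpha: "(\<alpha> ^^ n) (\<alpha> x) = \<alpha> ((\<alpha> ^^ n) x)"
  by (rule funpow_swap1[symmetric])

lemma equiv_dl_rel: "equiv UNIV (dl_rel \<alpha>)"
proof (rule equivI)
  show "refl_on UNIV (dl_rel \<alpha>)" by (auto simp: refl_on_def dl_rel_def)
  show "sym (dl_rel \<alpha>)" by (auto simp: sym_def dl_rel_def)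
  show "trans (dl_rel \<alpha>)"
  proof (rule transI)
    fix x y z
    assume "(x, y) \<in> dl_rel \<alpha>" "(y, z) \<in> dl_rel \<alpha>"
    moreover obtain a k b l c m where "x = (a, k)" "y = (b, l)" "z = (c, m)"
      by (metis surj_pair)
    ultimately have *: "(\<alpha> ^^ l) a = (\<alpha> ^^ k) b" "(\<alpha> ^^ m) b = (\<alpha> ^^ l) c"
      and xyz: "x = (a, k)" "z = (c, m)"
      by (auto simp: dl_rel_def)
    have "(\<alpha> ^^ l) ((\<alpha> ^^ m) a) = (\<alpha> ^^ m) ((\<alpha> ^^ k) b)"
      by (simp add: pow_commute[of l m] *(1))
    also have "\<dots> = (\<alpha> ^^ l) ((\<alpha> ^^ k) c)"
      by (simp add: pow_commute[of m k] pow_commute[of l k] *(2))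
    finally show "(x, z) \<in> dl_rel \<alpha>" using xyz by (simp add: dl_rel_def)
  qed
qed auto

lemma dl_class_eq_iff: "dl_class \<alpha> a k = dl_class \<alpha> a' k' \<longleftrightarrow> (\<alpha> ^^ k') a = (\<alpha> ^^ k) a'"
  unfolding dl_class_def using eq_equiv_class_iff[OF equiv_dl_rel, of "(a, k)" "(a', k')"]
  by (simp add: dl_rel_def)

lemma mem_dl_class_iff: "(a', k') \<in> dl_class \<alpha> a k \<longleftrightarrow> dl_class \<alpha> a' k' = dl_class \<alpha> a k"
  unfolding dl_class_eq_iff by (auto simp: dl_class_def dl_rel_def)

lemma dl_class_in_carrier [simp]: "dl_class \<alpha> a k \<in> dl_carrier \<alpha>"
  by (auto simp: dl_class_def dl_carrier_def quotient_def)

lemma dl_carrierE: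
  assumes "d \<in> dl_carrier \<alpha>"
  obtains a k where "d = dl_class \<alpha> a k"
  using assms by (auto simp: dl_class_def dl_carrier_def quotient_def)

lemma UN_dl_class:
  assumes "\<And>a' k'. dl_class \<alpha> a' k' = dl_class \<alpha> a k \<Longrightarrow> F a' k' = F a k"
  shows "(\<Union>(a', k')\<in>dl_class \<alpha> a k. F a' k') = F a k"
proof -
  have *: "F a' k' = F a k" if "(a', k') \<in> dl_class \<alpha> a k" for a' k'
    using that unfolding mem_dl_class_iff by (rule assms)
  have "(a, k) \<in> dl_class \<alpha> a k" unfolding mem_dl_class_iff ..
  then show ?thesis using * by blast
qed

lemma dl_add_class:
  "dl_add \<alpha> (dl_class \<alpha> a k) (dl_class \<alpha> b l) =
     dl_class \<alpha> ((\<alpha> ^^ l) a + (\<alpha> ^^ k) b) (k + l)"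
proof -
  have inner: "(\<Union>(b', l')\<in>dl_class \<alpha> b l. dl_class \<alpha> ((\<alpha> ^^ l') a + (\<alpha> ^^ k) b') (k + l')) =
      dl_class \<alpha> ((\<alpha> ^^ l) a + (\<alpha> ^^ k) b) (k + l)" for a k
  proof (rule UN_dl_class)
    fix b' l'
    assume "dl_class \<alpha> b' l' = dl_class \<alpha> b l"
    then have h: "(\<alpha> ^^ l) b' = (\<alpha> ^^ l') b" by (simp add: dl_class_eq_iff)
    have "(\<alpha> ^^ (k + l + k)) b' = (\<alpha> ^^ (k + k)) ((\<alpha> ^^ l) b')" by (simp add: pow_pow ac_simps)
    also have "\<dots> = (\<alpha> ^^ (k + l' + k)) b" by (simp add: h pow_pow ac_simps)
    finally show "dl_class \<alpha> ((\<alpha> ^^ l') a + (\<alpha> ^^ k) b') (k + l') =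
        dl_class \<alpha> ((\<alpha> ^^ l) a + (\<alpha> ^^ k) b) (k + l)"
      by (simp add: dl_class_eq_iff pow_hom pow_pow ac_simps)
  qed
  have "dl_add \<alpha> (dl_class \<alpha> a k) (dl_class \<alpha> b l) =
      (\<Union>(a', k')\<in>dl_class \<alpha> a k. dl_class \<alpha> ((\<alpha> ^^ l) a' + (\<alpha> ^^ k') b) (k' + l))"
    unfolding dl_add_def inner ..
  also have "\<dots> = dl_class \<alpha> ((\<alpha> ^^ l) a + (\<alpha> ^^ k) b) (k + l)"
  proof (rule UN_dl_class)
    fix a' k'
    assume "dl_class \<alpha> a' k' = dl_class \<alpha> a k"
    then have h: "(\<alpha> ^^ k) a' = (\<alpha> ^^ k') a" by (simp add: dl_class_eq_iff)
    have "(\<alpha> ^^ (k + l + l)) a' = (\<alpha> ^^ (l + l)) ((\<alpha> ^^ k) a')" by (simp add: pow_pow ac_simps)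
    also have "\<dots> = (\<alpha> ^^ (k' + l + l)) a" by (simp add: h pow_pow ac_simps)
    finally show "dl_class \<alpha> ((\<alpha> ^^ l) a' + (\<alpha> ^^ k') b) (k' + l) =
        dl_class \<alpha> ((\<alpha> ^^ l) a + (\<alpha> ^^ k) b) (k + l)"
      by (simp add: dl_class_eq_iff pow_hom pow_pow ac_simps)
  qed
  finally show ?thesis .
qed

lemma dl_uminus_class: "dl_uminus \<alpha> (dl_class \<alpha> a k) = dl_class \<alpha> (- a) k"
  unfolding dl_uminus_def by (rule UN_dl_class) (simp add: dl_class_eq_iff pow_uminus)

lemma dl_alpha_class: "dl_alpha \<alpha> (dl_class \<alpha> a k) = dl_class \<alpha> (\<alpha> a) k"
  unfolding dl_alpha_def by (rule UN_dl_class) (simp add: dl_class_eq_iff pow_alpha)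

lemma dl_alpha_inv_class: "dl_alpha_inv \<alpha> (dl_class \<alpha> a k) = dl_class \<alpha> a (k + 1)"
  unfolding dl_alpha_inv_def by (rule UN_dl_class) (simp add: dl_class_eq_iff)

lemma dl_alpha_inverse:
  assumes "d \<in> dl_carrier \<alpha>"
  shows "dl_alpha \<alpha> (dl_alpha_inv \<alpha> d) = d" "dl_alpha_inv \<alpha> (dl_alpha \<alpha> d) = d"
proof -
  obtain a k where d: "d = dl_class \<alpha> a k" using assms by (rule dl_carrierE)
  have "dl_class \<alpha> (\<alpha> a) (k + 1) = d" unfolding d dl_class_eq_iff by (simp add: pow_alpha)
  then show "dl_alpha \<alpha> (dl_alpha_inv \<alpha> d) = d" "dl_alpha_inv \<alpha> (dl_alpha \<alpha> d) = d"
    unfolding d dl_alpha_class dl_alpha_inv_class by simp_all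
qed

lemma dl_alpha_power_class:
  "dl_alpha_power \<alpha> (int n) (dl_class \<alpha> a k) = dl_class \<alpha> ((\<alpha> ^^ n) a) k"
  "dl_alpha_power \<alpha> (- int n) (dl_class \<alpha> a k) = dl_class \<alpha> a (k + n)"
proof -
  have "(dl_alpha \<alpha> ^^ n) (dl_class \<alpha> a k) = dl_class \<alpha> ((\<alpha> ^^ n) a) k"
    by (induction n) (simp_all add: dl_alpha_class)
  then show "dl_alpha_power \<alpha> (int n) (dl_class \<alpha> a k) = dl_class \<alpha> ((\<alpha> ^^ n) a) k"
    by (simp add: dl_alpha_power_def)
  have "(dl_alpha_inv \<alpha> ^^ n) (dl_class \<alpha> a k) = dl_class \<alpha> a (k + n)"
    by (induction n) (simp_all add: dl_alpha_inv_class)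
  then show "dl_alpha_power \<alpha> (- int n) (dl_class \<alpha> a k) = dl_class \<alpha> a (k + n)"
    by (cases "n = 0") (simp_all add: dl_alpha_power_def)
qed

lemma conjugate_power:
  assumes "bij \<delta>" and comm: "\<And>a f. inv \<delta> (\<pi> a (\<delta> f)) = \<pi> (\<alpha> a) f"
  shows "\<pi> ((\<alpha> ^^ n) a) f = op_power \<delta> (- int n) (\<pi> a (op_power \<delta> (int n) f))"
proof (induction n arbitrary: a f)
  case 0
  then show ?case by (simp add: op_power_def)
next
  case (Suc n)
  have 1: "op_power \<delta> (- 1) g = inv \<delta> g" for g by (simp add: op_power_def)
  have 2: "op_power \<delta> 1 g = \<delta> g" for g by (simp add: op_power_def)
  have "\<pi> ((\<alpha> ^^ Suc n) a) f = op_power \<delta> (- 1) (\<pi> ((\<alpha> ^^ n) a) (op_power \<delta> 1 f))"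
    by (simp add: comm 1 2)
  also have "\<dots> = op_power \<delta> (- int (Suc n)) (\<pi> a (op_power \<delta> (int (Suc n)) f))"
    by (simp add: Suc.IH op_power_add_apply[OF assms(1)] algebra_simps)
  finally show ?case .
qed

lemma tilde_rep_class:
  assumes "bij \<delta>" and comm: "\<And>a f. inv \<delta> (\<pi> a (\<delta> f)) = \<pi> (\<alpha> a) f"
  shows "tilde_rep \<pi> \<delta> (dl_class \<alpha> a k, j) f =
    op_power \<delta> (int k) (\<pi> a (op_power \<delta> (- int k - j) f))"
proof -
  note cp = conjugate_power[of \<delta> \<pi>, OF assms]
  note pa = op_power_add_apply[OF assms(1)]
  obtain b l where bl: "(SOME p. p \<in> dl_class \<alpha> a k) = (b, l)" by (metis surj_pair)
  have "(a, k) \<in> dl_class \<alpha> a k" by (simp add: mem_dl_class_iff)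
  then have "(b, l) \<in> dl_class \<alpha> a k" by (metis bl someI)
  then have eq: "(\<alpha> ^^ k) b = (\<alpha> ^^ l) a" by (simp add: mem_dl_class_iff dl_class_eq_iff)
  have expand: "op_power \<delta> (int k) (\<pi> a (op_power \<delta> (- int k - j) f)) =
      op_power \<delta> (int k + int l) (\<pi> ((\<alpha> ^^ l) a) (op_power \<delta> (- int k - int l - j) f))" for a k l
    by (simp add: cp pa)
  have ar: "int l + int k = int k + int l" "- int l - int k - j = - int k - int l - j"
    by simp_all
  have "tilde_rep \<pi> \<delta> (dl_class \<alpha> a k, j) f = op_power \<delta> (int l) (\<pi> b (op_power \<delta> (- int l - j) f))"
    by (simp add: tilde_rep_def bl)
  also have "\<dots> = op_power \<delta> (int k + int l) (\<pi> ((\<alpha> ^^ l) a) (op_power \<delta> (- int k - int l - j) f))"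
    by (simp only: expand[of l b k] eq ar)
  also have "\<dots> = op_power \<delta> (int k) (\<pi> a (op_power \<delta> (- int k - j) f))"
    by (simp add: expand[of k a l])
  finally show ?thesis .
qed

lemma tilde_rep_mult:
  assumes "bij \<delta>" and comm: "\<And>a f. inv \<delta> (\<pi> a (\<delta> f)) = \<pi> (\<alpha> a) f"
    and hom: "\<And>a b. \<pi> (a + b) = \<pi> a \<circ> \<pi> b"
    and "x \<in> G_carrier \<alpha>" "y \<in> G_carrier \<alpha>"
  shows "tilde_rep \<pi> \<delta> (G_mult \<alpha> x y) f = tilde_rep \<pi> \<delta> x (tilde_rep \<pi> \<delta> y f)"
proof -
  note cp = conjugate_power[of \<delta> \<pi>, OF assms(1,2)]
  note pa = op_power_add_apply[OF assms(1)]
  note tr = tilde_rep_class[of \<delta> \<pi>, OF assms(1,2)]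
  obtain a k i b l j where xy: "x = (dl_class \<alpha> a k, i)" "y = (dl_class \<alpha> b l, j)"
    using assms(4,5) by (auto simp: G_carrier_def elim!: dl_carrierE)
  show ?thesis
  proof (cases "0 \<le> i")
    case True
    then obtain n where i: "i = int n" by (metis nonneg_int_cases)
    show ?thesis
      unfolding xy i G_mult_def fst_conv snd_conv dl_alpha_power_class dl_add_class tr hom
        comp_apply cp pa
      by (simp add: algebra_simps minus_diff_commute)
  next
    case False
    then obtain n where i: "i = - int n" by (metis int_cases2 of_nat_0_le_iff)
    show ?thesis
      unfolding xy i G_mult_def fst_conv snd_conv dl_alpha_power_class dl_add_class tr hom
        comp_apply cp pa
      by (simp add: algebra_simps minus_diff_commute)
  qed
qed

end

end

(* Let K be the intersection of the V_j; it is invariant under delta. For f, g in V_0 the bracket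
   [f,g] = sum_i (Jf)_i cnj ((Jg)_i) lies in L^1 of the dual group and has Fourier coefficients
   <pi_a f, g>. For f, g in K the commutation relation turns the coefficients of
   [delta^n f, delta^n g] into those of [f,g] along alpha^n, so these brackets are the images of [f,g]
   under the iterated transfer operator of the dual endomorphism; as the groups alpha^n(Gamma)
   intersect trivially, they converge in L^1 to the constant <f,g>. Where the multiplicity is at most
   k the Gram matrices of brackets have rank at most k, so K contains no k+1 orthonormal vectors;
   being finite-dimensional it contains an eigenvector of delta if it is nonzero.
   Conversely, the distance of an eigenvector f to V_j does not depend on j, so it is 0 and f is in K.
   Then [f,f] is constant, hence <pi_a f, f> = 0 for a nonzero, and the orbit of f under D is an
   orthonormal family spanning a copy of P^lambda, where lambda is the inverse of the eigenvalue.
   In l^2(D) the unit vector at 0 is an eigenvector of the operator of (0,1), which is the inverse of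
   delta. *)

theory Submission
  imports Defs "HOL-Computational_Algebra.Fundamental_Theorem_Algebra"
begin

section \<open>Complex Hilbert spaces\<close>

text \<open>The brackets have to converge in the L^1 norm, while the commutation relation speaks
  only of Fourier coefficients. The gap is closed by duality: an L^1 norm is the pairing with a
  bounded Borel function \<open>\<phi>\<close> of modulus at most 1 which itself changes with n, so
  every estimate has to be uniform in \<open>\<phi>\<close>. Against trigonometric polynomials this
  uniformity is exact: the frequencies of \<open>\<phi>\<close> composed with the n-th iterate of
  the dual endomorphism lie in the range of \<open>\<alpha> ^^ n\<close>, which eventually misses
  any given nonzero element. Orthogonality of characters under Haar measure rests on characters
  separating points of the group; these are built on finite quotients. Rank is measured by an
  inequality that survives limits: if G = X X* with X having k columns, then |tr G|^2 is at most k
  times the sum of the squared moduli of the entries of G. The identity of size k+1 violates it, as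
  (k+1)^2 > k(k+1).\<close>

lemma cinner_zero_left [simp]: "cinner 0 x = 0"
  using cinner_add_left[of 0 0 x] by simp

lemma cinner_zero_right [simp]: "cinner x 0 = 0"
  using cinner_commute[of x 0] by simp

lemma cinner_add_right: "cinner x (y + z) = cinner x y + cinner x z"
  by (metis cinner_add_left cinner_commute complex_cnj_add)

lemma cinner_scaleC_right: "cinner x (c *\<^sub>C y) = cnj c * cinner x y"
  by (metis cinner_commute cinner_scaleC_left complex_cnj_mult)

lemma scaleC_minus_one: "(-1) *\<^sub>C x = - (x :: 'h::complex_hilbert)"
  using scaleC_of_real[of "-1" x] by simp

lemma scaleC_one [simp]: "1 *\<^sub>C x = (x :: 'h::complex_hilbert)"
  using scaleC_of_real[of 1 x] by simp

lemma scaleC_zero_left [simp]: "0 *\<^sub>C x = (0 :: 'h::complex_hilbert)"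
  using scaleC_of_real[of 0 x] by simp

lemma scaleC_zero_right [simp]: "c *\<^sub>C 0 = (0 :: 'h::complex_hilbert)"
  using scaleC_add_right[of c "0::'h" 0] by simp

lemma cinner_minus_left: "cinner (- x) y = - cinner x y"
  using cinner_scaleC_left[of "-1" x y] by (simp add: scaleC_minus_one)

lemma cinner_minus_right: "cinner x (- y) = - cinner x y"
  using cinner_scaleC_right[of x "-1" y] by (simp add: scaleC_minus_one)

lemma cinner_diff_left: "cinner (x - y) z = cinner x z - cinner y z"
  using cinner_add_left[of x "- y" z] by (simp add: cinner_minus_left)

lemma cinner_diff_right: "cinner x (y - z) = cinner x y - cinner x z"
  using cinner_add_right[of x y "- z"] by (simp add: cinner_minus_right)

lemma cinner_sum_left: "cinner (\<Sum>i\<in>I. f i) x = (\<Sum>i\<in>I. cinner (f i) x)"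
  by (induction I rule: infinite_finite_induct) (auto simp: cinner_add_left)

lemma cinner_sum_right: "cinner x (\<Sum>i\<in>I. f i) = (\<Sum>i\<in>I. cinner x (f i))"
  by (induction I rule: infinite_finite_induct) (auto simp: cinner_add_right)

lemma cinner_eq_zero_iff [simp]: "cinner x x = 0 \<longleftrightarrow> x = 0"
  by (simp add: cinner_self)

lemma norm_scaleC: "norm (c *\<^sub>C x) = cmod c * norm (x :: 'h::complex_hilbert)"
proof -
  have "complex_of_real ((norm (c *\<^sub>C x))\<^sup>2) = c * cnj c * complex_of_real ((norm x)\<^sup>2)"
    unfolding cinner_self[symmetric] by (simp add: cinner_scaleC_left cinner_scaleC_right)
  also have "\<dots> = complex_of_real ((cmod c * norm x)\<^sup>2)"
    by (simp only: complex_norm_square[symmetric] power_mult_distrib of_real_mult of_real_power)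
  finally show ?thesis
    by (metis norm_ge_zero of_real_eq_iff power2_eq_imp_eq mult_nonneg_nonneg)
qed

text \<open>The triangle inequality, already part of the Banach space structure, bounds the real
  part after expanding the square of \<open>norm (x + y)\<close>. Rotating \<open>x\<close> by the
  conjugate phase turns the real part into the modulus.\<close>

lemma cmod_cinner_le: "cmod (cinner x y) \<le> norm x * norm y"
proof -
  have re: "Re (cinner x y) \<le> norm x * norm y" for x y :: 'a
  proof -
    have "complex_of_real ((norm (x + y))\<^sup>2) = cinner x x + cinner y y + (cinner x y + cnj (cinner x y))"
      unfolding cinner_self[symmetric] cinner_commute[of y x, symmetric]
      by (simp add: cinner_add_left cinner_add_right)
    then have "complex_of_real ((norm (x + y))\<^sup>2) =
        complex_of_real ((norm x)\<^sup>2 + (norm y)\<^sup>2 + 2 * Re (cinner x y))"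
      by (simp add: cinner_self complex_add_cnj)
    then have "(norm (x + y))\<^sup>2 = (norm x)\<^sup>2 + (norm y)\<^sup>2 + 2 * Re (cinner x y)"
      unfolding of_real_eq_iff .
    moreover have "(norm (x + y))\<^sup>2 \<le> (norm x + norm y)\<^sup>2"
      by (intro power_mono norm_triangle_ineq) auto
    ultimately show ?thesis by (simp add: power2_sum)
  qed
  show ?thesis
  proof (cases "cinner x y = 0")
    case False
    let ?c = "cnj (sgn (cinner x y))"
    have "cinner (?c *\<^sub>C x) y = cmod (cinner x y)"
      using False by (simp add: cinner_scaleC_left sgn_div_norm scaleR_conv_of_real
          complex_norm_square[symmetric] mult.commute power2_eq_square field_simps)
    then have "cmod (cinner x y) \<le> norm (?c *\<^sub>C x) * norm y"
      using re[of "?c *\<^sub>C x" y] by simp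
    also have "norm (?c *\<^sub>C x) = norm x"
      using False by (simp add: norm_scaleC norm_sgn)
    finally show ?thesis .
  qed auto
qed

lemma bounded_linear_cinner_left: "bounded_linear (\<lambda>x. cinner x y)"
  by (rule bounded_linear_intro[of _ "norm y"])
    (auto simp: cinner_add_left cmod_cinner_le cinner_scaleC_left scaleR_conv_of_real
      simp flip: scaleC_of_real)

lemma closed_csubspace_diff:
  assumes "closed_csubspace S" "x \<in> S" "y \<in> S"
  shows "x - y \<in> S"
  using assms scaleC_minus_one[of y] unfolding closed_csubspace_def
  by (metis add_uminus_conv_diff)

lemma closed_csubspace_scaleC:
  assumes "closed_csubspace S" "x \<in> S"
  shows "c *\<^sub>C x \<in> S"
  using assms by (auto simp: closed_csubspace_def)

section \<open>Unitary operators and their integer powers\<close>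

lemma unitary_opD:
  assumes "unitary_op U"
  shows "U (x + y) = U x + U y" "U (c *\<^sub>C x) = c *\<^sub>C U x" "cinner (U x) (U y) = cinner x y"
    "inv U (U x) = x" "U (inv U x) = x"
  using assms unitary_op_bij[OF assms]
  by (auto simp: unitary_op_def clinear_on_def bij_def surj_f_inv_f)

lemma unitary_op_zero:
  assumes "unitary_op U"
  shows "U 0 = 0"
  using unitary_opD(1)[OF assms, of 0 0] by simp

lemma unitary_op_diff:
  assumes "unitary_op U"
  shows "U (x - y) = U x - U y"
  using unitary_opD(1)[OF assms, of "x - y" y] by (simp add: algebra_simps)

lemma norm_unitary_op:
  assumes "unitary_op U"
  shows "norm (U x) = norm x"
proof -
  have "complex_of_real ((norm (U x))\<^sup>2) = complex_of_real ((norm x)\<^sup>2)"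
    unfolding cinner_self[symmetric] by (rule unitary_opD(3)[OF assms])
  then show ?thesis
    by (metis norm_ge_zero of_real_eq_iff power2_eq_imp_eq)
qed

lemma eigenvalue_norm:
  assumes "unitary_op U" "U f = c *\<^sub>C f" "f \<noteq> 0"
  shows "cmod c = 1"
  using norm_unitary_op[OF assms(1), of f] assms(2,3) by (simp add: norm_scaleC)

lemma unitary_op_id: "unitary_op id"
  by (simp add: unitary_op_def clinear_on_def)

lemma unitary_op_comp:
  assumes "unitary_op U" "unitary_op W"
  shows "unitary_op (U \<circ> W)"
  using assms comp_surj[of W U] by (auto simp: unitary_op_def clinear_on_def)

lemma unitary_op_inv:
  assumes "unitary_op U"
  shows "unitary_op (inv U)"
proof -
  note U = unitary_opD[OF assms]
  have "surj (inv U)" using U(4) by (metis surjI)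
  moreover have "inv U (x + y) = inv U x + inv U y" for x y using U by metis
  moreover have "inv U (c *\<^sub>C x) = c *\<^sub>C inv U x" for c x using U by metis
  moreover have "cinner (inv U x) (inv U y) = cinner x y" for x y using U by metis
  ultimately show ?thesis by (auto simp: unitary_op_def clinear_on_def)
qed

lemma unitary_op_funpow: "unitary_op U \<Longrightarrow> unitary_op (U ^^ n)"
  by (induction n) (auto simp: unitary_op_comp unitary_op_id)

lemma unitary_op_op_power: "unitary_op U \<Longrightarrow> unitary_op (op_power U j)"
  by (auto simp: op_power_def unitary_op_funpow unitary_op_inv)

section \<open>Orthonormal families\<close>

definition ccomplement :: "'h::complex_hilbert set \<Rightarrow> 'h set" where
  "ccomplement S = {x. \<forall>y\<in>S. cinner x y = 0}"

lemma closed_csubspace_ccomplement: "closed_csubspace (ccomplement S)"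
proof -
  have "closed {x. cinner x y = 0}" for y :: 'a
    by (intro closed_Collect_eq linear_continuous_on bounded_linear_cinner_left
        continuous_on_const)
  moreover have "ccomplement S = (\<Inter>y\<in>S. {x. cinner x y = 0})"
    by (auto simp: ccomplement_def)
  ultimately have "closed (ccomplement S)" by auto
  then show ?thesis
    by (auto simp: closed_csubspace_def ccomplement_def cinner_add_left cinner_scaleC_left)
qed

locale orthonormal_family =
  fixes e :: "'d \<Rightarrow> 'h::complex_hilbert" and D :: "'d set"
  assumes orthonormal:
    "x \<in> D \<Longrightarrow> y \<in> D \<Longrightarrow> cinner (e x) (e y) = (if x = y then 1 else 0)"
begin

text \<open>The double orthogonal complement stands for the closed linear span: closedness is then
  immediate, and invariance under operators can be checked by moving them to the other side of the
  inner product.\<close>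

definition closed_span :: "'h set" where
  "closed_span = ccomplement (ccomplement (e ` D))"

definition coefficients :: "'h \<Rightarrow> 'd \<Rightarrow> complex" where
  "coefficients w d = (if d \<in> D then cinner w (e d) else 0)"

lemma closed_csubspace_closed_span: "closed_csubspace closed_span"
  unfolding closed_span_def by (rule closed_csubspace_ccomplement)

lemma cinner_finite_sum:
  assumes "finite F" "F \<subseteq> D"
  shows "cinner (\<Sum>d\<in>F. a d *\<^sub>C e d) (\<Sum>d\<in>F. b d *\<^sub>C e d) = (\<Sum>d\<in>F. a d * cnj (b d))"
proof -
  have "cinner (\<Sum>d\<in>F. a d *\<^sub>C e d) (\<Sum>d\<in>F. b d *\<^sub>C e d) =
      (\<Sum>d\<in>F. \<Sum>d'\<in>F. a d * cnj (b d') * (if d = d' then 1 else 0))"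
    unfolding cinner_sum_left
    using assms(2) by (intro sum.cong refl) (simp add: cinner_sum_right cinner_scaleC_left
        cinner_scaleC_right orthonormal subset_eq sum_distrib_left mult_ac)
  also have "\<dots> = (\<Sum>d\<in>F. a d * cnj (b d))"
    using assms(1) by (simp add: sum.delta' mult_if_delta if_distrib cong: if_cong)
  finally show ?thesis .
qed

lemma norm_finite_sum:
  assumes "finite F" "F \<subseteq> D"
  shows "(norm (\<Sum>d\<in>F. a d *\<^sub>C e d))\<^sup>2 = (\<Sum>d\<in>F. (cmod (a d))\<^sup>2)"
proof -
  have "complex_of_real ((norm (\<Sum>d\<in>F. a d *\<^sub>C e d))\<^sup>2) =
      complex_of_real (\<Sum>d\<in>F. (cmod (a d))\<^sup>2)"
    unfolding cinner_self[symmetric] cinner_finite_sum[OF assms] of_real_sum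
      complex_norm_square ..
  then show ?thesis unfolding of_real_eq_iff .
qed

lemma bessel:
  assumes "finite F" "F \<subseteq> D"
  shows "(\<Sum>d\<in>F. (cmod (cinner x (e d)))\<^sup>2) \<le> (norm x)\<^sup>2"
proof -
  let ?p = "\<Sum>d\<in>F. cinner x (e d) *\<^sub>C e d"
  have p: "cinner ?p ?p = (\<Sum>d\<in>F. (cmod (cinner x (e d)))\<^sup>2)"
    unfolding cinner_finite_sum[OF assms] of_real_sum complex_norm_square ..
  have xp: "cinner x ?p = (\<Sum>d\<in>F. (cmod (cinner x (e d)))\<^sup>2)"
    by (simp only: cinner_sum_right cinner_scaleC_right of_real_sum complex_norm_square mult.commute)
  then have px: "cinner ?p x = (\<Sum>d\<in>F. (cmod (cinner x (e d)))\<^sup>2)"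
    using cinner_commute[where x = x and y = ?p] by (simp only: complex_cnj_complex_of_real)
  have "complex_of_real ((norm (x - ?p))\<^sup>2) =
      complex_of_real ((norm x)\<^sup>2 - (\<Sum>d\<in>F. (cmod (cinner x (e d)))\<^sup>2))"
    unfolding cinner_self[symmetric] cinner_diff_left cinner_diff_right p xp px
    by (simp add: cinner_self)
  then have "(norm (x - ?p))\<^sup>2 = (norm x)\<^sup>2 - (\<Sum>d\<in>F. (cmod (cinner x (e d)))\<^sup>2)"
    unfolding of_real_eq_iff .
  then show ?thesis using zero_le_power2[of "norm (x - ?p)"] by linarith
qed

lemma coefficients_l2: "coefficients w \<in> l2 D"
proof -
  have "(\<lambda>d. (cmod (coefficients w d))\<^sup>2) summable_on D"
  proof (rule nonneg_bdd_above_summable_on)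
    show "bdd_above (sum (\<lambda>d. (cmod (coefficients w d))\<^sup>2) ` {F. F \<subseteq> D \<and> finite F})"
    proof (rule bdd_aboveI2)
      fix F assume F: "F \<in> {F. F \<subseteq> D \<and> finite F}"
      then have "(\<Sum>d\<in>F. (cmod (coefficients w d))\<^sup>2) = (\<Sum>d\<in>F. (cmod (cinner w (e d)))\<^sup>2)"
        by (intro sum.cong) (auto simp: coefficients_def)
      then show "(\<Sum>d\<in>F. (cmod (coefficients w d))\<^sup>2) \<le> (norm w)\<^sup>2"
        using bessel[of F w] F by auto
    qed
  qed auto
  then show ?thesis by (auto simp: l2_def coefficients_def)
qed

text \<open>For nested finite index sets, the squared norm of the difference of two partial sums is
  the difference of the partial sums of squared moduli, so convergence of the latter makes the
  former Cauchy.\<close>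

lemma riesz_fischer:
  assumes "f \<in> l2 D"
  shows "(\<lambda>d. f d *\<^sub>C e d) summable_on D"
proof -
  let ?q = "\<lambda>d. (cmod (f d))\<^sup>2" and ?T = "finite_subsets_at_top D"
  obtain s where s: "(sum ?q \<longlongrightarrow> s) ?T"
    using assms by (auto simp: l2_def summable_on_def has_sum_def)
  have close: "\<exists>P. finite P \<and> P \<subseteq> D \<and> (\<forall>F. finite F \<and> P \<subseteq> F \<and> F \<subseteq> D \<longrightarrow>
      norm ((\<Sum>d\<in>F. f d *\<^sub>C e d) - (\<Sum>d\<in>P. f d *\<^sub>C e d)) < r)" if "r > 0" for r
  proof -
    \<comment> \<open>The tolerance \<open>r\<^sup>2 / 2\<close> is spent twice, once for
      \<open>F\<close> and once for \<open>P\<close>, and bounds the sum over \<open>F - P\<close>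
      by \<open>r\<^sup>2\<close>.\<close>
    have "eventually (\<lambda>F. dist (sum ?q F) s < r\<^sup>2 / 2) ?T"
      using s that by (intro tendstoD) auto
    then obtain P where P: "finite P" "P \<subseteq> D"
      and *: "\<And>F. finite F \<Longrightarrow> P \<subseteq> F \<Longrightarrow> F \<subseteq> D \<Longrightarrow> dist (sum ?q F) s < r\<^sup>2 / 2"
      unfolding eventually_finite_subsets_at_top by metis
    have "norm ((\<Sum>d\<in>F. f d *\<^sub>C e d) - (\<Sum>d\<in>P. f d *\<^sub>C e d)) < r"
      if F: "finite F" "P \<subseteq> F" "F \<subseteq> D" for F
    proof -
      have "(\<Sum>d\<in>F. f d *\<^sub>C e d) - (\<Sum>d\<in>P. f d *\<^sub>C e d) = (\<Sum>d\<in>F - P. f d *\<^sub>C e d)"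
        using F by (simp add: sum_diff)
      then have "(norm ((\<Sum>d\<in>F. f d *\<^sub>C e d) - (\<Sum>d\<in>P. f d *\<^sub>C e d)))\<^sup>2 = sum ?q (F - P)"
        using norm_finite_sum[of "F - P" f] F by auto
      also have "\<dots> = sum ?q F - sum ?q P" using F by (simp add: sum_diff)
      also have "\<dots> < r\<^sup>2"
        using *[OF F] *[OF P(1) order_refl P(2)] unfolding dist_real_def by linarith
      finally show ?thesis using \<open>r > 0\<close> using power_less_imp_less_base[of _ 2 r] by simp
    qed
    then show ?thesis using P by blast
  qed
  \<comment> \<open>The Cauchy condition is checked for the net of finite partial sums. Two index
    sets \<open>F\<close> and \<open>G\<close> need not be nested, so each is compared with the
    common subset \<open>P\<close> within \<open>r / 2\<close>.\<close>
  have "cauchy_filter (filtermap (sum (\<lambda>d. f d *\<^sub>C e d)) ?T)"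
    unfolding cauchy_filter_metric_filtermap
  proof (intro allI impI)
    fix r :: real assume "r > 0"
    then obtain P where P: "finite P" "P \<subseteq> D"
      and *: "\<And>F. finite F \<Longrightarrow> P \<subseteq> F \<Longrightarrow> F \<subseteq> D \<Longrightarrow>
        norm ((\<Sum>d\<in>F. f d *\<^sub>C e d) - (\<Sum>d\<in>P. f d *\<^sub>C e d)) < r / 2"
      using close[of "r / 2"] by auto
    show "\<exists>Q. eventually Q ?T \<and> (\<forall>F G. Q F \<and> Q G \<longrightarrow>
        dist (\<Sum>d\<in>F. f d *\<^sub>C e d) (\<Sum>d\<in>G. f d *\<^sub>C e d) < r)"
    proof (intro exI[of _ "\<lambda>F. finite F \<and> P \<subseteq> F \<and> F \<subseteq> D"] conjI allI impI)
      show "eventually (\<lambda>F. finite F \<and> P \<subseteq> F \<and> F \<subseteq> D) ?T"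
        unfolding eventually_finite_subsets_at_top using P by blast
      fix F G
      assume "(finite F \<and> P \<subseteq> F \<and> F \<subseteq> D) \<and> finite G \<and> P \<subseteq> G \<and> G \<subseteq> D"
      then have "norm ((\<Sum>d\<in>F. f d *\<^sub>C e d) - (\<Sum>d\<in>P. f d *\<^sub>C e d)) < r / 2"
        "norm ((\<Sum>d\<in>G. f d *\<^sub>C e d) - (\<Sum>d\<in>P. f d *\<^sub>C e d)) < r / 2"
        by (blast intro: *)+
      then show "dist (\<Sum>d\<in>F. f d *\<^sub>C e d) (\<Sum>d\<in>G. f d *\<^sub>C e d) < r"
        unfolding dist_norm[symmetric] by (rule dist_triangle_half_l)
    qed
  qed
  moreover have "filtermap (sum (\<lambda>d. f d *\<^sub>C e d)) ?T \<le> principal UNIV"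
    by simp
  moreover have "complete (UNIV :: 'h set)" by (rule complete_UNIV)
  moreover have "filtermap (sum (\<lambda>d. f d *\<^sub>C e d)) ?T \<noteq> bot"
    by (simp add: filtermap_bot_iff)
  ultimately obtain x where "filtermap (sum (\<lambda>d. f d *\<^sub>C e d)) ?T \<le> nhds x"
    using cauchy_filter_complete_converges by blast
  then have "filterlim (sum (\<lambda>d. f d *\<^sub>C e d)) (nhds x) ?T"
    by (simp add: filterlim_def)
  then show ?thesis by (auto simp: summable_on_def has_sum_def)
qed

text \<open>Pairing with a fixed vector is bounded linear and so passes through the sum; both claims
  are read off from the resulting series of numbers.\<close>

lemma has_sum_closed_span:
  assumes "((\<lambda>d. f d *\<^sub>C e d) has_sum w) D"
  shows "w \<in> closed_span" and "d \<in> D \<Longrightarrow> cinner w (e d) = f d"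
proof -
  have sum: "((\<lambda>d. f d * cinner (e d) y) has_sum cinner w y) D" for y
    using has_sum_bounded_linear[OF bounded_linear_cinner_left assms, of y]
    by (simp add: o_def cinner_scaleC_left)
  show "w \<in> closed_span"
    unfolding closed_span_def ccomplement_def
  proof safe
    fix y assume y: "\<forall>z\<in>e ` D. cinner y z = 0"
    have "((\<lambda>d. f d * cinner (e d) y) has_sum 0) D"
    proof (intro has_sum_0)
      fix d assume "d \<in> D"
      then show "f d * cinner (e d) y = 0"
        using y cinner_commute[where x = y and y = "e d"] by simp
    qed
    then show "cinner w y = 0" using has_sum_unique[OF sum] by blast
  qed
  assume d: "d \<in> D"
  have "((\<lambda>d'. f d' * cinner (e d') (e d)) has_sum (\<Sum>d'\<in>{d}. f d' * cinner (e d') (e d))) D"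
    using d by (intro has_sum_finite_neutralI[where B = "{d}"]) (auto simp: orthonormal)
  then have "cinner w (e d) = (\<Sum>d'\<in>{d}. f d' * cinner (e d') (e d))"
    using has_sum_unique[OF sum] by blast
  then show "cinner w (e d) = f d" using d by (simp add: orthonormal)
qed

text \<open>The difference of \<open>w\<close> and its Fourier sum lies in the complement of the
  family and also in the double complement, hence is orthogonal to itself.\<close>

lemma has_sum_coefficients:
  assumes "w \<in> closed_span"
  shows "((\<lambda>d. coefficients w d *\<^sub>C e d) has_sum w) D"
proof -
  obtain s where s: "((\<lambda>d. coefficients w d *\<^sub>C e d) has_sum s) D"
    using riesz_fischer[OF coefficients_l2[of w]] by (auto simp: summable_on_def)
  have "w - s \<in> ccomplement (e ` D)"
    using has_sum_closed_span(2)[OF s]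
    by (auto simp: ccomplement_def cinner_diff_left coefficients_def)
  moreover have "w - s \<in> closed_span"
    using closed_csubspace_diff[OF closed_csubspace_closed_span assms has_sum_closed_span(1)[OF s]] .
  ultimately have "cinner (w - s) (w - s) = 0"
    unfolding closed_span_def by (simp add: ccomplement_def[of "ccomplement _"])
  then show ?thesis using s by simp
qed

lemma unitary_coefficients: "unitary_onto_l2 closed_span D coefficients"
  unfolding unitary_onto_l2_def
proof (intro conjI ballI allI)
  show "coefficients ` closed_span = l2 D"
  proof safe
    fix f assume f: "f \<in> l2 D"
    obtain w where w: "((\<lambda>d. f d *\<^sub>C e d) has_sum w) D"
      using riesz_fischer[OF f] by (auto simp: summable_on_def)
    have "f = coefficients w"
      using f has_sum_closed_span(2)[OF w] by (auto simp: coefficients_def l2_def)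
    then show "f \<in> coefficients ` closed_span" using has_sum_closed_span(1)[OF w] by blast
  qed (rule coefficients_l2)
next
  fix v w assume v: "v \<in> closed_span"
  have "((\<lambda>d. coefficients v d * cinner (e d) w) has_sum cinner v w) D"
    using has_sum_bounded_linear[OF bounded_linear_cinner_left has_sum_coefficients[OF v], of w]
    by (simp add: o_def cinner_scaleC_left)
  moreover have "coefficients v d * cinner (e d) w = coefficients v d * cnj (coefficients w d)" for d
    using cinner_commute[of w "e d"] by (simp add: coefficients_def)
  ultimately show "(\<Sum>\<^sub>\<infinity>d\<in>D. coefficients v d * cnj (coefficients w d)) = cinner v w"
    by (simp add: infsumI)
qed (auto simp: coefficients_def cinner_add_left cinner_scaleC_left)

text \<open>By duality: the inverse of \<open>U\<close> preserves the orthogonal complement of the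
  family, since \<open>U\<close> sends each member to a multiple of a member. Pairing once more
  carries this over to the double complement.\<close>

lemma unitary_maps_closed_span:
  assumes "unitary_op U"
    and "\<And>d. d \<in> D \<Longrightarrow> \<exists>c d'. d' \<in> D \<and> U (e d) = c *\<^sub>C e d'"
  shows "U ` closed_span \<subseteq> closed_span"
proof (clarsimp simp: closed_span_def)
  fix w assume w: "w \<in> ccomplement (ccomplement (e ` D))"
  show "U w \<in> ccomplement (ccomplement (e ` D))"
    unfolding ccomplement_def[of "ccomplement _"]
  proof safe
    fix y assume y: "y \<in> ccomplement (e ` D)"
    have "cinner (inv U y) (e d) = 0" if d: "d \<in> D" for d
    proof -
      obtain c d' where d': "d' \<in> D" "U (e d) = c *\<^sub>C e d'" using assms(2)[OF d] by blast
      have "cinner (inv U y) (e d) = cinner y (U (e d))"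
        by (metis unitary_opD(3,5)[OF assms(1)])
      then show ?thesis using d' y by (simp add: cinner_scaleC_right ccomplement_def)
    qed
    then have "cinner w (inv U y) = 0" using w by (auto simp: ccomplement_def)
    then show "cinner (U w) y = 0" by (metis unitary_opD(3,5)[OF assms(1)])
  qed
qed

end

section \<open>Separation of points by characters\<close>

definition nmult :: "nat \<Rightarrow> 'g::ab_group_add \<Rightarrow> 'g" where
  "nmult n x = (\<Sum>i<n. x)"

lemma nmult_0 [simp]: "nmult 0 x = 0" and nmult_Suc: "nmult (Suc n) x = nmult n x + x"
  by (simp_all add: nmult_def)

lemma nmult_1 [simp]: "nmult (Suc 0) x = x"
  by (simp add: nmult_Suc)

lemma nmult_add: "nmult (m + n) x = nmult m x + nmult n x"
  by (induction n) (simp_all add: nmult_Suc add.assoc)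

lemma nmult_mult: "nmult (m * n) x = nmult m (nmult n x)"
  by (induction m) (simp_all add: nmult_Suc nmult_add add.commute)

lemma nmult_diff: "n \<le> m \<Longrightarrow> nmult (m - n) x = nmult m x - nmult n x"
  using nmult_add[of "m - n" n x] by simp

text \<open>A character of the subgroup \<open>H\<close> is encoded by a function on the whole group
  whose values outside \<open>H\<close> are unconstrained, so extensions are compared with it on
  \<open>H\<close> only.\<close>

definition subgroup_character :: "'g::ab_group_add set \<Rightarrow> ('g \<Rightarrow> complex) \<Rightarrow> bool" where
  "subgroup_character H \<psi> \<longleftrightarrow> 0 \<in> H \<and> (\<forall>x\<in>H. \<forall>y\<in>H. x - y \<in> H) \<and>
     (\<forall>x\<in>H. \<forall>y\<in>H. \<psi> (x + y) = \<psi> x * \<psi> y) \<and> (\<forall>x\<in>H. cmod (\<psi> x) = 1)"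

lemma subgroup_characterD:
  assumes "subgroup_character H \<psi>"
  shows "0 \<in> H" "x \<in> H \<Longrightarrow> y \<in> H \<Longrightarrow> x - y \<in> H" "x \<in> H \<Longrightarrow> y \<in> H \<Longrightarrow> x + y \<in> H"
    "x \<in> H \<Longrightarrow> - x \<in> H" "x \<in> H \<Longrightarrow> y \<in> H \<Longrightarrow> \<psi> (x + y) = \<psi> x * \<psi> y"
    "x \<in> H \<Longrightarrow> cmod (\<psi> x) = 1" "\<psi> 0 = 1" "x \<in> H \<Longrightarrow> nmult n x \<in> H"
    "x \<in> H \<Longrightarrow> \<psi> (nmult n x) = \<psi> x ^ n"
proof -
  show 0: "0 \<in> H" and d: "x \<in> H \<Longrightarrow> y \<in> H \<Longrightarrow> x - y \<in> H" for x y
    using assms by (auto simp: subgroup_character_def)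
  show n: "x \<in> H \<Longrightarrow> - x \<in> H" for x using d[of 0 x] 0 by simp
  show a: "x \<in> H \<Longrightarrow> y \<in> H \<Longrightarrow> x + y \<in> H" for x y using d[of x "- y"] n by simp
  show h: "x \<in> H \<Longrightarrow> y \<in> H \<Longrightarrow> \<psi> (x + y) = \<psi> x * \<psi> y" for x y
    using assms by (auto simp: subgroup_character_def)
  show u: "x \<in> H \<Longrightarrow> cmod (\<psi> x) = 1" for x
    using assms by (auto simp: subgroup_character_def)
  have "\<psi> 0 * \<psi> 0 = \<psi> 0" "\<psi> 0 \<noteq> 0" using h[of 0 0] u[of 0] 0 by auto
  then show one: "\<psi> 0 = 1" by simp
  show m: "x \<in> H \<Longrightarrow> nmult n x \<in> H" for n by (induction n) (auto simp: nmult_Suc 0 a)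
  show "x \<in> H \<Longrightarrow> \<psi> (nmult n x) = \<psi> x ^ n"
    by (induction n) (auto simp: nmult_Suc one h m)
qed

text \<open>Elements of the subgroup generated by \<open>H\<close> and \<open>x\<close> have the
  form \<open>h + nmult k x\<close>, where the value has to be \<open>\<psi> h * z ^ k\<close>. Two
  representations of one element differ in \<open>k\<close> by a multiple of \<open>n\<close>, the
  order of \<open>x\<close> modulo \<open>H\<close>, and the equation for \<open>z ^ n\<close> makes
  the value independent of the representation. The freedom to choose the root \<open>z\<close> is
  what allows nontrivial values at \<open>x\<close>.\<close>

lemma subgroup_character_extend:
  fixes x :: "'g::ab_group_add"
  assumes \<psi>: "subgroup_character H \<psi>" and n: "n > 0" "nmult n x \<in> H"
    and minimal: "\<And>k. 0 < k \<Longrightarrow> k < n \<Longrightarrow> nmult k x \<notin> H"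
    and z: "z ^ n = \<psi> (nmult n x)" "cmod z = 1"
  shows "\<exists>K \<psi>'. subgroup_character K \<psi>' \<and> H \<subseteq> K \<and> x \<in> K \<and> \<psi>' x = z \<and> (\<forall>h\<in>H. \<psi>' h = \<psi> h)"
proof -
  note H = subgroup_characterD[OF \<psi>]
  define K where "K = {h + nmult k x | h k. h \<in> H}"
  \<comment> \<open>The remainder of \<open>k\<close> modulo \<open>n\<close> is again a multiplier
    taking \<open>x\<close> into \<open>H\<close>, so by minimality it vanishes.\<close>
  have dvd: "n dvd k" if "nmult k x \<in> H" for k
  proof -
    have "nmult k x = nmult (k div n) (nmult n x) + nmult (k mod n) x"
      unfolding nmult_mult[symmetric] nmult_add[symmetric] by simp
    then have "nmult (k mod n) x = nmult k x - nmult (k div n) (nmult n x)" by simp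
    also have "\<dots> \<in> H" by (rule H(2)[OF that H(8)[OF n(2)]])
    finally have "nmult (k mod n) x \<in> H" .
    then have "\<not> 0 < k mod n" using minimal[of "k mod n"] n(1) by auto
    then show ?thesis by (simp add: dvd_eq_mod_eq_0)
  qed
  have wd: "\<psi> h * z ^ k = \<psi> h' * z ^ k'"
    if "h \<in> H" "h' \<in> H" "h + nmult k x = h' + nmult k' x" "k \<le> k'" for h h' k k'
  proof -
    have eq: "nmult (k' - k) x = h - h'" using that by (simp add: nmult_diff algebra_simps)
    moreover have "h - h' \<in> H" using that by (intro H(2))
    ultimately obtain q where q: "k' - k = n * q" using dvd[of "k' - k"] by auto
    have "h = nmult q (nmult n x) + h'"
      using eq unfolding q by (simp add: nmult_mult[symmetric] mult.commute)
    then have "\<psi> h = \<psi> (nmult q (nmult n x)) * \<psi> h'"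
      using H(5)[OF H(8)[OF n(2)] that(2), of q] by simp
    then have "\<psi> h = (z ^ n) ^ q * \<psi> h'"
      by (simp add: H(9)[OF n(2)] z(1))
    moreover have "z ^ k' = z ^ k * (z ^ n) ^ q"
      using q that(4) by (metis le_add_diff_inverse power_add power_mult)
    ultimately show ?thesis by simp
  qed
  define \<psi>' where "\<psi>' y = (SOME w. \<exists>h k. h \<in> H \<and> y = h + nmult k x \<and> w = \<psi> h * z ^ k)" for y
  have val: "\<psi>' (h + nmult k x) = \<psi> h * z ^ k" if "h \<in> H" for h k
  proof -
    have "\<exists>h' k'. h' \<in> H \<and> h + nmult k x = h' + nmult k' x \<and> \<psi>' (h + nmult k x) = \<psi> h' * z ^ k'"
      unfolding \<psi>'_def by (rule someI_ex) (use that in blast)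
    then show ?thesis using wd that by (metis nat_le_linear)
  qed
  have valK: "\<exists>h k. h \<in> H \<and> y = h + nmult k x" if "y \<in> K" for y using that by (auto simp: K_def)
  have HK: "h \<in> K" "\<psi>' h = \<psi> h" if h: "h \<in> H" for h
  proof -
    have "h + nmult 0 x \<in> K" unfolding K_def using h by blast
    then show "h \<in> K" "\<psi>' h = \<psi> h" using val[OF h, of 0] by simp_all
  qed
  have "subgroup_character K \<psi>'"
    unfolding subgroup_character_def
  proof (intro conjI ballI)
    show "0 \<in> K" by (rule HK) (rule H)
    fix y assume "y \<in> K"
    then obtain h k where y: "h \<in> H" "y = h + nmult k x" using valK by blast
    show "cmod (\<psi>' y) = 1"
      using y z(2) H(6) by (simp add: val norm_mult norm_power)
    fix y' assume "y' \<in> K"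
    then obtain h' k' where y': "h' \<in> H" "y' = h' + nmult k' x" using valK by blast
    have yy: "y + y' = (h + h') + nmult (k + k') x" using y y' by (simp add: nmult_add ac_simps)
    show "\<psi>' (y + y') = \<psi>' y * \<psi>' y'"
      unfolding yy using y y' H(3)[of h h'] H(5)[of h h'] by (simp add: val power_add)
    \<comment> \<open>Multiples are natural, so subtraction of \<open>nmult k' x\<close> is written
      as addition of \<open>nmult (k' * n - k') x\<close> followed by subtraction of
      \<open>nmult k' (nmult n x)\<close>, which lies in \<open>H\<close>.\<close>
    have "k' \<le> k' * n" using n(1) by simp
    then have "y - y' = (h - h' - nmult k' (nmult n x)) + nmult (k + (k' * n - k')) x"
      unfolding nmult_add nmult_diff[OF \<open>k' \<le> k' * n\<close>] nmult_mult using y y' by simp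
    moreover have "h - h' - nmult k' (nmult n x) \<in> H"
      by (rule H(2)[OF H(2)[OF y(1) y'(1)] H(8)[OF n(2)]])
    ultimately show "y - y' \<in> K" unfolding K_def by blast
  qed
  moreover have "x \<in> K" "\<psi>' x = z"
  proof -
    have "0 + nmult (Suc 0) x \<in> K" unfolding K_def using H(1) by blast
    then show "x \<in> K" "\<psi>' x = z" using val[OF H(1), of "Suc 0"] H(7) by simp_all
  qed
  ultimately show ?thesis using HK by blast
qed

lemma circle_root:
  assumes "cmod w = 1" "n > 0"
  shows "\<exists>z. z ^ n = w \<and> cmod z = 1"
proof -
  have "w = cis (Arg w)" using assms(1) by (metis norm_eq_zero zero_neq_one cis_Arg sgn_eq
      div_by_1 of_real_1)
  moreover have "cis (Arg w / n) ^ n = cis (Arg w)" unfolding Complex.DeMoivre using assms(2) by simp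
  ultimately show ?thesis by (metis norm_cis)
qed

text \<open>The elements of \<open>R\<close> are adjoined one by one. Each has finite order modulo
  \<open>H\<close>, hence modulo the subgroup reached so far, and the circle contains a root of the
  required order.\<close>

lemma subgroup_character_extend_finite:
  assumes "finite R" "subgroup_character H \<psi>" "\<And>x. \<exists>n>0. nmult n x \<in> H"
  shows "\<exists>K \<psi>'. subgroup_character K \<psi>' \<and> H \<union> R \<subseteq> K \<and> (\<forall>h\<in>H. \<psi>' h = \<psi> h)"
  using assms(1)
proof (induction R)
  case empty
  then show ?case using assms(2) by blast
next
  case (insert x R)
  then obtain K \<theta> where K: "subgroup_character K \<theta>" "H \<union> R \<subseteq> K" "\<forall>h\<in>H. \<theta> h = \<psi> h" by blast
  define n where "n = (LEAST n. n > 0 \<and> nmult n x \<in> K)"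
  have ex: "\<exists>n>0. nmult n x \<in> K" using assms(3)[of x] K(2) by blast
  then have n: "n > 0" "nmult n x \<in> K" unfolding n_def by (metis (mono_tags, lifting) LeastI)+
  have minimal: "nmult k x \<notin> K" if "0 < k" "k < n" for k
    using that not_less_Least unfolding n_def by blast
  obtain z where "z ^ n = \<theta> (nmult n x)" "cmod z = 1"
    using circle_root[OF subgroup_characterD(6)[OF K(1) n(2)] n(1)] by blast
  from subgroup_character_extend[OF K(1) n minimal this]
  obtain L \<eta> where L: "subgroup_character L \<eta>" "K \<subseteq> L" "x \<in> L" "\<forall>h\<in>K. \<eta> h = \<theta> h" by blast
  then have "H \<union> insert x R \<subseteq> L" "\<forall>h\<in>H. \<eta> h = \<psi> h" using K(2,3) by auto
  then show ?case using L(1) by blast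
qed

section \<open>Finiteness of the quotients by iterated ranges, and characters that separate
  points\<close>

context dilation_endomorphism
begin

text \<open>If \<open>s\<close> runs through representatives modulo the range of
  \<open>\<alpha>\<close> and \<open>r\<close> through representatives modulo the range of
  \<open>\<alpha> ^^ n\<close>, then the elements \<open>s + \<alpha> r\<close> serve for the next
  power.\<close>

lemma finite_representatives:
  "\<exists>R :: 'g set. finite R \<and> (\<forall>x. \<exists>r\<in>R. \<exists>y. x = r + (\<alpha> ^^ n) y)"
proof (induction n)
  case 0
  show ?case by (rule exI[of _ "{0}"]) auto
next
  case (Suc n)
  then obtain R where R: "finite R" "\<And>x. \<exists>r\<in>R. \<exists>y. x = r + (\<alpha> ^^ n) y" by blast
  define rep where "rep C = (SOME x. x \<in> C)" for C :: "'g set"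
  define S where "S = rep ` cosets (range \<alpha>)"
  have S: "\<exists>s\<in>S. \<exists>y. x = s + \<alpha> y" for x
  proof -
    let ?C = "(+) x ` range \<alpha>"
    have "x + \<alpha> 0 \<in> ?C" by blast
    then have "rep ?C \<in> ?C" unfolding rep_def by (rule someI)
    then obtain y where "rep ?C = x + \<alpha> y" by blast
    moreover have "\<alpha> (- y) = - \<alpha> y" using pow_uminus[of 1 y] by simp
    ultimately have "x = rep ?C + \<alpha> (- y)" by simp
    moreover have "rep ?C \<in> S" by (auto simp: S_def cosets_def)
    ultimately show ?thesis by blast
  qed
  show ?case
  proof (intro exI[of _ "(\<lambda>(s, r). s + \<alpha> r) ` (S \<times> R)"] conjI allI)
    show "finite ((\<lambda>(s, r). s + \<alpha> r) ` (S \<times> R))"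
      using R(1) finite_index by (auto simp: S_def)
    fix x
    obtain s y where s: "s \<in> S" "x = s + \<alpha> y" using S by blast
    obtain r w where r: "r \<in> R" "y = r + (\<alpha> ^^ n) w" using R(2) by blast
    have "x = (s + \<alpha> r) + (\<alpha> ^^ Suc n) w" using s r by (simp add: hom add.assoc)
    then show "\<exists>q\<in>(\<lambda>(s, r). s + \<alpha> r) ` (S \<times> R). \<exists>y. x = q + (\<alpha> ^^ Suc n) y"
      using s(1) r(1) by force
  qed
qed

text \<open>Pigeonhole: infinitely many multiples of \<open>x\<close> share finitely many
  representatives, and the difference of two multiples with the same one lies in the range.\<close>

lemma torsion_quotient: "\<exists>k>0. nmult k x \<in> range (\<alpha> ^^ n)"
proof -
  obtain R where R: "finite R" "\<And>x. \<exists>r\<in>R. \<exists>y. x = r + (\<alpha> ^^ n) y"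
    using finite_representatives[of n] by blast
  have "\<exists>r. r \<in> R \<and> (\<exists>y. nmult k x = r + (\<alpha> ^^ n) y)" for k
    using R(2)[of "nmult k x"] by blast
  then have "\<exists>r. \<forall>k. r k \<in> R \<and> (\<exists>y. nmult k x = r k + (\<alpha> ^^ n) y)"
    by (intro choice allI)
  then obtain r where r: "\<And>k. r k \<in> R" "\<And>k. \<exists>y. nmult k x = r k + (\<alpha> ^^ n) y"
    by blast
  have "\<not> inj r"
  proof
    assume "inj r"
    moreover have "finite (range r)" using R(1) r(1) by (intro finite_subset[of "range r" R]) auto
    ultimately show False using finite_imageD[of r UNIV] by simp
  qed
  then obtain i j where ij: "r i = r j" "i < j" unfolding inj_def by (metis nat_neq_iff)
  obtain y y' where "nmult i x = r i + (\<alpha> ^^ n) y" "nmult j x = r j + (\<alpha> ^^ n) y'"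
    using r(2)[of i] r(2)[of j] by blast
  then have "nmult (j - i) x = (\<alpha> ^^ n) (y' + (- y))"
    unfolding pow_hom pow_uminus using ij(1) nmult_diff[of i j x] ij(2) by simp
  then show ?thesis using ij(2) by (metis rangeI zero_less_diff)
qed

text \<open>Some iterated range misses \<open>a\<close>. The trivial character of this range is
  extended to \<open>a\<close> with a value other than 1, and then over finitely many coset
  representatives, which together with the range generate the whole group.\<close>

lemma separating_character:
  fixes a :: 'g
  assumes "a \<noteq> 0"
  shows "\<exists>\<eta>\<in>dual_group. \<eta> a \<noteq> 1"
proof -
  obtain n where n: "a \<notin> range (\<alpha> ^^ n)" using assms Inter_powers by blast
  let ?H = "range (\<alpha> ^^ n)"
  have diff: "(\<alpha> ^^ n) x - (\<alpha> ^^ n) y = (\<alpha> ^^ n) (x + - y)" for x y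
    unfolding pow_hom pow_uminus by simp
  have H: "subgroup_character ?H (\<lambda>_. 1)"
    unfolding subgroup_character_def
    using pow_zero[of n] by (auto simp: diff intro: range_eqI[of 0 _ 0])
  define k where "k = (LEAST k. k > 0 \<and> nmult k a \<in> ?H)"
  have ex: "\<exists>k>0. nmult k a \<in> ?H" by (rule torsion_quotient)
  then have k: "k > 0" "nmult k a \<in> ?H" unfolding k_def by (metis (mono_tags, lifting) LeastI)+
  have minimal: "nmult l a \<notin> ?H" if "0 < l" "l < k" for l
    using that not_less_Least unfolding k_def by blast
  have "k \<noteq> 1" using n k(2) by auto
  then have k2: "k \<ge> 2" using k(1) by simp
  \<comment> \<open>Since \<open>k\<close> is the order of \<open>a\<close> modulo \<open>?H\<close>
    and at least 2, this root of unity differs from 1, while its \<open>k\<close>-th power is 1, the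
    value of the trivial character at \<open>nmult k a\<close>.\<close>
  let ?z = "cis (2 * pi / k)"
  have "?z ^ k = 1" using k(1) by (simp add: Complex.DeMoivre)
  then obtain K \<psi> where K: "subgroup_character K \<psi>" "?H \<subseteq> K" "a \<in> K" "\<psi> a = ?z"
    using subgroup_character_extend[OF H k minimal, of ?z] by auto
  obtain R where R: "finite R" "\<And>x. \<exists>r\<in>R. \<exists>y. x = r + (\<alpha> ^^ n) y"
    using finite_representatives[of n] by blast
  have "\<exists>k>0. nmult k x \<in> K" for x using torsion_quotient[of x n] K(2) by blast
  then obtain L \<eta> where L: "subgroup_character L \<eta>" "K \<union> R \<subseteq> L" "\<forall>h\<in>K. \<eta> h = \<psi> h"
    using subgroup_character_extend_finite[OF R(1) K(1)] by blast
  have "x \<in> L" for x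
  proof -
    obtain r y where "r \<in> R" "x = r + (\<alpha> ^^ n) y" using R(2) by blast
    then show ?thesis using subgroup_characterD(3)[OF L(1)] L(2) K(2) by blast
  qed
  then have "\<eta> \<in> dual_group" using L(1) by (auto simp: subgroup_character_def dual_group_def)
  moreover have "\<eta> a \<noteq> 1"
  proof
    assume "\<eta> a = 1"
    then have "cos (2 * pi / k) = 1" using L(3) K(3,4) by (metis cis.simps(1) one_complex.simps(1))
    moreover have "cos (2 * pi / k) < cos 0"
      using k2 by (intro cos_monotone_0_pi) (auto simp: field_simps)
    ultimately show False by simp
  qed
  ultimately show ?thesis by blast
qed

end

section \<open>The dual group\<close>

lemma dual_groupD:
  assumes "\<omega> \<in> dual_group"
  shows "\<omega> (a + b) = \<omega> a * \<omega> b" "cmod (\<omega> a) = 1" "\<omega> 0 = 1" "\<omega> (- a) = cnj (\<omega> a)"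
proof -
  show h: "\<omega> (a + b) = \<omega> a * \<omega> b" and u: "cmod (\<omega> a) = 1" for a b
    using assms by (auto simp: dual_group_def)
  have "\<omega> 0 \<noteq> 0" using u[of 0] by auto
  then show z: "\<omega> 0 = 1" using h[of 0 0] by simp
  have "\<omega> a * \<omega> (- a) = 1" using h[of a "- a"] z by simp
  moreover have "cnj (\<omega> a) * \<omega> a = 1"
    using complex_norm_square[of "\<omega> a"] u[of a] by (simp add: mult.commute)
  ultimately show "\<omega> (- a) = cnj (\<omega> a)"
    by (metis mult.assoc mult.left_neutral mult.right_neutral)
qed

text \<open>The dual group is cut out by closed conditions from a product of circles, which is
  compact by Tychonoff's theorem.\<close>

lemma compact_dual_group: "compact (dual_group :: ('g::ab_group_add \<Rightarrow> complex) set)"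
proof -
  have "compactin (product_topology (\<lambda>_. euclidean) UNIV) (PiE UNIV (\<lambda>_::'g. sphere (0::complex) 1))"
    by (subst compactin_PiE) auto
  then have "compact (PiE UNIV (\<lambda>_::'g. sphere (0::complex) 1))"
    by (simp only: euclidean_product_topology compactin_euclidean_iff)
  moreover have "closed {\<omega> :: 'g \<Rightarrow> complex. \<omega> (a + b) = \<omega> a * \<omega> b}" for a b
    by (intro closed_Collect_eq continuous_intros continuous_on_product_coordinates)
  then have "closed (\<Inter>a b. {\<omega> :: 'g \<Rightarrow> complex. \<omega> (a + b) = \<omega> a * \<omega> b})"
    by (intro closed_INT ballI)
  ultimately have "compact (PiE UNIV (\<lambda>_::'g. sphere (0::complex) 1) \<inter>
      (\<Inter>a b. {\<omega> :: 'g \<Rightarrow> complex. \<omega> (a + b) = \<omega> a * \<omega> b}))"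
    by (rule compact_Int_closed)
  also have "PiE UNIV (\<lambda>_::'g. sphere (0::complex) 1) \<inter>
      (\<Inter>a b. {\<omega> :: 'g \<Rightarrow> complex. \<omega> (a + b) = \<omega> a * \<omega> b}) = dual_group"
    by (auto simp: dual_group_def PiE_def Pi_def)
  finally show ?thesis .
qed

lemma space_dual_borel: "space dual_borel = dual_group"
  by (simp add: dual_borel_def space_restrict_space)

lemma borel_measurable_dual_continuous:
  "continuous_on dual_group f \<Longrightarrow> f \<in> borel_measurable dual_borel"
  unfolding dual_borel_def by (rule borel_measurable_continuous_on_restrict)

lemma continuous_on_eval: "continuous_on S (\<lambda>\<omega> :: 'g \<Rightarrow> complex. \<omega> a)"
  by (rule continuous_on_subset[OF continuous_on_product_coordinates]) simp

lemma borel_measurable_eval [measurable]: "(\<lambda>\<omega>. \<omega> a) \<in> borel_measurable dual_borel"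
  by (intro borel_measurable_dual_continuous continuous_on_eval)

text \<open>The rule \<open>cong\<close> makes the notion depend on values on the dual group only;
  there the relations between characters hold, such as the character of 0 being constantly
  1.\<close>

inductive trig_poly :: "(('g::ab_group_add \<Rightarrow> complex) \<Rightarrow> complex) \<Rightarrow> bool" where
  character: "trig_poly (\<lambda>\<omega>. \<omega> a)"
| add: "trig_poly p \<Longrightarrow> trig_poly q \<Longrightarrow> trig_poly (\<lambda>\<omega>. p \<omega> + q \<omega>)"
| scale: "trig_poly p \<Longrightarrow> trig_poly (\<lambda>\<omega>. c * p \<omega>)"
| cong: "trig_poly p \<Longrightarrow> (\<And>\<omega>. \<omega> \<in> dual_group \<Longrightarrow> p \<omega> = q \<omega>) \<Longrightarrow> trig_poly q"

lemma trig_poly_const: "trig_poly (\<lambda>_. c)"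
  by (rule trig_poly.cong[OF trig_poly.scale[OF trig_poly.character[of 0], of c]])
    (simp add: dual_groupD)

lemma trig_poly_mult_character:
  assumes "trig_poly p"
  shows "trig_poly (\<lambda>\<omega>. p \<omega> * \<omega> a)"
  using assms
proof induction
  case (character b)
  show ?case
    by (rule trig_poly.cong[OF trig_poly.character[of "b + a"]]) (simp add: dual_groupD)
next
  case (add p q)
  then show ?case by (simp add: distrib_right trig_poly.add)
next
  case (scale p c)
  then show ?case by (simp add: mult.assoc trig_poly.scale)
next
  case (cong p q)
  show ?case by (rule trig_poly.cong[OF cong.IH]) (simp add: cong.hyps)
qed

lemma trig_poly_mult:
  assumes p: "trig_poly p" and q: "trig_poly q"
  shows "trig_poly (\<lambda>\<omega>. p \<omega> * q \<omega>)"
  using q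
proof induction
  case (character b)
  show ?case by (rule trig_poly_mult_character[OF p])
next
  case (add q q')
  then show ?case by (simp add: distrib_left trig_poly.add)
next
  case (scale q c)
  have "trig_poly (\<lambda>\<omega>. c * (p \<omega> * q \<omega>))" by (rule trig_poly.scale[OF scale.IH])
  then show ?case by (simp add: ac_simps)
next
  case (cong q q')
  show ?case by (rule trig_poly.cong[OF cong.IH]) (simp add: cong.hyps)
qed

lemma trig_poly_cnj:
  assumes "trig_poly p"
  shows "trig_poly (\<lambda>\<omega>. cnj (p \<omega>))"
  using assms
proof induction
  case (character a)
  show ?case by (rule trig_poly.cong[OF trig_poly.character[of "- a"]]) (simp add: dual_groupD)
next
  case (cong p q)
  show ?case by (rule trig_poly.cong[OF cong.IH]) (simp add: cong.hyps)
qed (simp_all add: trig_poly.add trig_poly.scale)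

lemma continuous_trig_poly: "trig_poly p \<Longrightarrow> continuous_on dual_group p"
proof (induction rule: trig_poly.induct)
  case (cong p q)
  then show ?case using continuous_on_cong[of dual_group dual_group p q] by simp
qed (auto intro!: continuous_on_add continuous_on_mult continuous_on_const continuous_on_eval)

text \<open>These are the hypotheses of the real Stone-Weierstrass theorem. Real and imaginary parts
  of characters are real trigonometric polynomials, because conjugation replaces \<open>a\<close> by
  \<open>- a\<close>, and they separate points.\<close>

lemma function_ring_trig_poly:
  "function_ring_on {f. trig_poly (\<lambda>\<omega>. complex_of_real (f \<omega>))} dual_group"
proof
  show "compact dual_group" by (rule compact_dual_group)
  show "continuous_on dual_group f" if "f \<in> {f. trig_poly (\<lambda>\<omega>. complex_of_real (f \<omega>))}" for f
    using continuous_on_Re[OF continuous_trig_poly[of "\<lambda>\<omega>. complex_of_real (f \<omega>)"]] that by simp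
  show "\<exists>f\<in>{f. trig_poly (\<lambda>\<omega>. complex_of_real (f \<omega>))}. f x \<noteq> f y"
    if xy: "x \<in> dual_group" "y \<in> dual_group" "x \<noteq> y" for x y :: "'a \<Rightarrow> complex"
  proof -
    obtain a where "x a \<noteq> y a" using xy(3) by blast
    then consider "Re (x a) \<noteq> Re (y a)" | "Im (x a) \<noteq> Im (y a)" using complex_eqI by blast
    then show ?thesis
    proof cases
      case 1
      have "trig_poly (\<lambda>\<omega>. (1 / 2) * (\<omega> a + cnj (\<omega> a)))"
        by (intro trig_poly.scale trig_poly.add trig_poly.character trig_poly_cnj)
      then have "trig_poly (\<lambda>\<omega>. complex_of_real (Re (\<omega> a)))" by (simp add: complex_add_cnj)
      then show ?thesis using 1 by (intro bexI[of _ "\<lambda>\<omega>. Re (\<omega> a)"]) auto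
    next
      case 2
      have "trig_poly (\<lambda>\<omega>. (- \<i> / 2) * (\<omega> a + (- 1) * cnj (\<omega> a)))"
        by (intro trig_poly.scale trig_poly.add trig_poly.character trig_poly_cnj)
      then have "trig_poly (\<lambda>\<omega>. complex_of_real (Im (\<omega> a)))"
        by (rule trig_poly.cong) (simp add: complex_eq_iff)
      then show ?thesis using 2 by (intro bexI[of _ "\<lambda>\<omega>. Im (\<omega> a)"]) auto
    qed
  qed
next
  fix f g :: "('a \<Rightarrow> complex) \<Rightarrow> real"
  assume "f \<in> {f. trig_poly (\<lambda>\<omega>. complex_of_real (f \<omega>))}"
    "g \<in> {f. trig_poly (\<lambda>\<omega>. complex_of_real (f \<omega>))}"
  then show "(\<lambda>x. f x + g x) \<in> {f. trig_poly (\<lambda>\<omega>. complex_of_real (f \<omega>))}"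
    "(\<lambda>x. f x * g x) \<in> {f. trig_poly (\<lambda>\<omega>. complex_of_real (f \<omega>))}"
    by (simp_all add: trig_poly.add trig_poly_mult)
qed (simp add: trig_poly_const)

section \<open>Bounded Borel functions on the dual group, generated from characters\<close>

definition bounded_borel :: "(('g::ab_group_add \<Rightarrow> complex) \<Rightarrow> complex) \<Rightarrow> bool" where
  "bounded_borel f \<longleftrightarrow> f \<in> borel_measurable dual_borel \<and> (\<exists>C. \<forall>\<omega>\<in>dual_group. cmod (f \<omega>) \<le> C)"

lemma bounded_borel_continuous:
  assumes "continuous_on dual_group f"
  shows "bounded_borel f"
  using compact_imp_bounded[OF compact_continuous_image[OF assms compact_dual_group]]
    borel_measurable_dual_continuous[OF assms]
  by (auto simp: bounded_borel_def bounded_iff)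

lemma bounded_borel_add:
  assumes "bounded_borel f" "bounded_borel g"
  shows "bounded_borel (\<lambda>\<omega>. f \<omega> + g \<omega>)"
proof -
  obtain C C' where "\<And>\<omega>. \<omega> \<in> dual_group \<Longrightarrow> cmod (f \<omega>) \<le> C"
    "\<And>\<omega>. \<omega> \<in> dual_group \<Longrightarrow> cmod (g \<omega>) \<le> C'"
    using assms unfolding bounded_borel_def by blast
  then have "\<forall>\<omega>\<in>dual_group. cmod (f \<omega> + g \<omega>) \<le> C + C'"
    using norm_triangle_mono by blast
  then show ?thesis using assms unfolding bounded_borel_def by (auto intro: borel_measurable_add)
qed

lemma bounded_borel_scale:
  assumes "bounded_borel f"
  shows "bounded_borel (\<lambda>\<omega>. c * f \<omega>)"
proof -
  obtain C where "\<And>\<omega>. \<omega> \<in> dual_group \<Longrightarrow> cmod (f \<omega>) \<le> C"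
    using assms unfolding bounded_borel_def by blast
  then have "\<forall>\<omega>\<in>dual_group. cmod (c * f \<omega>) \<le> cmod c * C"
    by (simp add: norm_mult mult_left_mono)
  then show ?thesis
    using assms unfolding bounded_borel_def by (auto intro: borel_measurable_times)
qed

lemma bounded_borel_limit:
  assumes "\<And>n. bounded_borel (f n)" "\<And>n \<omega>. \<omega> \<in> dual_group \<Longrightarrow> cmod (f n \<omega>) \<le> C"
    "\<And>\<omega>. \<omega> \<in> dual_group \<Longrightarrow> (\<lambda>n. f n \<omega>) \<longlonglongrightarrow> g \<omega>"
  shows "bounded_borel g"
proof -
  have "g \<in> borel_measurable dual_borel"
  proof (rule borel_measurable_LIMSEQ_metric)
    show "f n \<in> borel_measurable dual_borel" for n using assms(1) by (simp add: bounded_borel_def)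
    show "(\<lambda>n. f n \<omega>) \<longlonglongrightarrow> g \<omega>" if "\<omega> \<in> space dual_borel" for \<omega>
      using assms(3) that by (simp add: space_dual_borel)
  qed
  moreover have "cmod (g \<omega>) \<le> C" if "\<omega> \<in> dual_group" for \<omega>
    by (rule LIMSEQ_le_const2[OF tendsto_norm[OF assms(3)[OF that]]]) (use assms(2) that in auto)
  ultimately show ?thesis by (auto simp: bounded_borel_def)
qed

text \<open>This carries identities between integrals from characters to all bounded Borel
  functions. The class for which \<open>P\<close> holds grows from trigonometric polynomials to
  continuous functions by Stone-Weierstrass, to indicators of closed sets, to indicators of Borel
  sets, to bounded nonnegative functions, and finally to complex ones.\<close>

lemma bounded_borel_induct [consumes 1, case_names character add scale limit]:
  fixes f :: "('g::{ab_group_add,countable} \<Rightarrow> complex) \<Rightarrow> complex"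
  assumes f: "bounded_borel f"
    and character: "\<And>a. P (\<lambda>\<omega>. \<omega> a)"
    and add: "\<And>f g. bounded_borel f \<Longrightarrow> bounded_borel g \<Longrightarrow> P f \<Longrightarrow> P g \<Longrightarrow> P (\<lambda>\<omega>. f \<omega> + g \<omega>)"
    and scale: "\<And>f c. bounded_borel f \<Longrightarrow> P f \<Longrightarrow> P (\<lambda>\<omega>. c * f \<omega>)"
    and limit: "\<And>f g C. (\<And>n :: nat. bounded_borel (f n)) \<Longrightarrow> bounded_borel g \<Longrightarrow> (\<And>n. P (f n)) \<Longrightarrow>
      (\<And>n \<omega>. \<omega> \<in> dual_group \<Longrightarrow> cmod (f n \<omega>) \<le> C) \<Longrightarrow>
      (\<And>\<omega>. \<omega> \<in> dual_group \<Longrightarrow> (\<lambda>n. f n \<omega>) \<longlonglongrightarrow> g \<omega>) \<Longrightarrow> P g"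
  shows "P f"
proof -
  define Q where "Q f \<longleftrightarrow> bounded_borel f \<and> P f" for f
  have Q_char: "Q (\<lambda>\<omega>. \<omega> a)" for a
    unfolding Q_def using bounded_borel_continuous[OF continuous_on_eval] character by blast
  have Q_add: "Q (\<lambda>\<omega>. f \<omega> + g \<omega>)" if "Q f" "Q g" for f g
    using that bounded_borel_add add unfolding Q_def by blast
  have Q_scale: "Q (\<lambda>\<omega>. c * f \<omega>)" if "Q f" for f c
    using that bounded_borel_scale scale unfolding Q_def by blast
  have Q_lim: "Q g" if "\<And>n. Q (f n)" "\<And>n \<omega>. \<omega> \<in> dual_group \<Longrightarrow> cmod (f n \<omega>) \<le> C"
    "\<And>\<omega>. \<omega> \<in> dual_group \<Longrightarrow> (\<lambda>n. f n \<omega>) \<longlonglongrightarrow> g \<omega>" for f g C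
  proof -
    have 1: "bounded_borel (f n)" and 2: "P (f n)" for n using that(1)[of n] by (auto simp: Q_def)
    have 3: "bounded_borel g" by (rule bounded_borel_limit[where f = f]) fact+
    show ?thesis unfolding Q_def using 3 limit[OF 1 3 2 that(2,3)] by blast
  qed
  \<comment> \<open>A constant sequence converges on the dual group to any function that agrees with
    it there, so the limit rule also yields congruence.\<close>
  have Q_cong: "Q g" if "Q f" "\<And>\<omega>. \<omega> \<in> dual_group \<Longrightarrow> f \<omega> = g \<omega>" for f g
  proof -
    obtain C where C: "\<And>\<omega>. \<omega> \<in> dual_group \<Longrightarrow> cmod (f \<omega>) \<le> C"
      using \<open>Q f\<close> unfolding Q_def bounded_borel_def by blast
    show ?thesis
    proof (rule Q_lim)
      show "Q f" by fact
      show "cmod (f \<omega>) \<le> C" if "\<omega> \<in> dual_group" for \<omega> by (rule C[OF that])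
      show "(\<lambda>_. f \<omega>) \<longlonglongrightarrow> g \<omega>" if "\<omega> \<in> dual_group" for \<omega>
        using \<open>\<And>\<omega>. \<omega> \<in> dual_group \<Longrightarrow> f \<omega> = g \<omega>\<close>[OF that] by simp
    qed
  qed
  have Q_trig: "Q p" if "trig_poly p" for p
    using that
  proof induction
    case (cong p q)
    from cong.IH cong.hyps(2) show ?case by (rule Q_cong)
  qed (rule Q_char Q_add Q_scale; assumption)+
  have Q_cont: "Q (\<lambda>\<omega>. complex_of_real (g \<omega>))"
    if g: "continuous_on dual_group g" for g :: "('g \<Rightarrow> complex) \<Rightarrow> real"
  proof -
    interpret function_ring_on "{f :: ('g \<Rightarrow> complex) \<Rightarrow> real. trig_poly (\<lambda>\<omega>. complex_of_real (f \<omega>))}" dual_group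
      by (rule function_ring_trig_poly)
    have "\<exists>h. trig_poly (\<lambda>\<omega>. complex_of_real (h \<omega>)) \<and> (\<forall>\<omega>\<in>dual_group. \<bar>g \<omega> - h \<omega>\<bar> < inverse (Suc n))" for n
      using Stone_Weierstrass_basic[OF g, of "inverse (Suc n)"] by auto
    then obtain h where h: "\<And>n. trig_poly (\<lambda>\<omega>. complex_of_real (h n \<omega>))"
      "\<And>n \<omega>. \<omega> \<in> dual_group \<Longrightarrow> \<bar>g \<omega> - h n \<omega>\<bar> < inverse (Suc n)"
      by metis
    obtain C where C: "\<And>\<omega>. \<omega> \<in> dual_group \<Longrightarrow> \<bar>g \<omega>\<bar> \<le> C"
      using compact_imp_bounded[OF compact_continuous_image[OF g compact_dual_group]]
      by (auto simp: bounded_iff)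
    show ?thesis
    proof (rule Q_lim)
      show "Q (\<lambda>\<omega>. complex_of_real (h n \<omega>))" for n by (rule Q_trig[OF h(1)])
      fix \<omega> :: "'g \<Rightarrow> complex" assume \<omega>: "\<omega> \<in> dual_group"
      show "cmod (complex_of_real (h n \<omega>)) \<le> C + 1" for n
      proof -
        have "inverse (real (Suc n)) \<le> 1" by (simp add: field_simps)
        then show ?thesis using h(2)[OF \<omega>, of n] C[OF \<omega>] unfolding norm_of_real by linarith
      qed
      have "(\<lambda>n. h n \<omega> - g \<omega>) \<longlonglongrightarrow> 0"
        by (rule tendsto_rabs_zero_cancel, rule tendsto_sandwich[OF _ _ tendsto_const LIMSEQ_inverse_real_of_nat])
          (simp_all add: abs_minus_commute less_imp_le[OF h(2)[OF \<omega>]] del: of_nat_Suc)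
      then show "(\<lambda>n. complex_of_real (h n \<omega>)) \<longlonglongrightarrow> complex_of_real (g \<omega>)"
        by (intro tendsto_of_real) (simp add: LIM_zero_iff)
    qed
  qed
  have Q_closed: "Q (\<lambda>\<omega>. complex_of_real (indicator A \<omega>))" if A: "closed A" for A
  proof (cases "A = {}")
    case True
    then show ?thesis using Q_scale[OF Q_char[of 0], of 0] by simp
  next
    case False
    show ?thesis
    proof (rule Q_lim)
      \<comment> \<open>These continuous functions decrease to the indicator of \<open>A\<close>.
        The distance is available because the group is countable, so that the functions on it form a
        metric space.\<close>
      show "Q (\<lambda>\<omega>. complex_of_real (max 0 (1 - real n * infdist \<omega> A)))" for n
        by (intro Q_cont continuous_on_max continuous_intros)
      fix \<omega> :: "'g \<Rightarrow> complex"
      show "cmod (complex_of_real (max 0 (1 - real n * infdist \<omega> A))) \<le> 1" for n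
        using infdist_nonneg[of \<omega> A] by (simp add: norm_of_real max_def)
      show "(\<lambda>n. complex_of_real (max 0 (1 - real n * infdist \<omega> A))) \<longlonglongrightarrow>
          complex_of_real (indicator A \<omega>)"
      proof (cases "\<omega> \<in> A")
        case True
        then show ?thesis by simp
      next
        case out: False
        then have pos: "infdist \<omega> A > 0"
          using infdist_pos_not_in_closed[OF A False] by blast
        obtain N where N: "real N * infdist \<omega> A > 1"
          using reals_Archimedean3[OF pos] by blast
        have "max 0 (1 - real n * infdist \<omega> A) = 0" if "n \<ge> N" for n
        proof -
          have "real N * infdist \<omega> A \<le> real n * infdist \<omega> A"
            using that pos by (intro mult_right_mono) auto
          then show ?thesis using N by simp
        qed
        then have "eventually (\<lambda>n. complex_of_real (max 0 (1 - real n * infdist \<omega> A)) =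
            complex_of_real (indicator A \<omega>)) sequentially"
          using out by (intro eventually_sequentiallyI[of N]) simp
        then show ?thesis by (rule tendsto_eventually)
      qed
    qed
  qed
  have Q_borel: "Q (\<lambda>\<omega>. complex_of_real (indicator A \<omega>))" if "A \<in> sets borel" for A
  proof -
    \<comment> \<open>Closed sets form an intersection-stable generator of the Borel sets, so
      complements and disjoint unions are the only remaining cases.\<close>
    have "Int_stable (Collect closed :: ('g \<Rightarrow> complex) set set)"
      by (auto simp: Int_stable_def)
    moreover have "Collect closed \<subseteq> Pow (UNIV :: ('g \<Rightarrow> complex) set)" by simp
    moreover have "A \<in> sigma_sets UNIV (Collect closed)" using that by (simp add: borel_eq_closed)
    ultimately show ?thesis
    proof (induction A rule: sigma_sets_induct_disjoint)
      case (basic A)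
      then show ?case using Q_closed by simp
    next
      case empty
      show ?case by (rule Q_closed) simp
    next
      case (compl A)
      have "Q (\<lambda>\<omega>. \<omega> 0 + (-1) * complex_of_real (indicator A \<omega>))"
        by (rule Q_add[OF Q_char Q_scale[OF compl.IH]])
      then show ?case
        by (rule Q_cong) (auto simp: dual_groupD indicator_def)
    next
      case (union A)
      have partial: "complex_of_real (indicator (\<Union>i<n. A i) \<omega>) =
          (\<Sum>i<n. complex_of_real (indicator (A i) \<omega>))" for n and \<omega> :: "'g \<Rightarrow> complex"
      proof -
        have "indicator (\<Union>i<n. A i) \<omega> = (\<Sum>i<n. indicat_real (A i) \<omega>)"
          by (intro indicator_UN_disjoint disjoint_family_on_mono[OF _ union.hyps(1)]) auto
        then show ?thesis by simp
      qed
      show ?case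
      proof (rule Q_lim)
        have "Q (\<lambda>\<omega>. \<Sum>i<n. complex_of_real (indicator (A i) \<omega>))" for n
        proof (induction n)
          case 0
          then show ?case using Q_scale[OF Q_char[of 0], of 0] by simp
        next
          case (Suc n)
          then show ?case using Q_add[OF Suc union.IH[of n]] by simp
        qed
        then show "Q (\<lambda>\<omega>. complex_of_real (indicator (\<Union>i<n. A i) \<omega>))" for n
          unfolding partial .
        fix \<omega> :: "'g \<Rightarrow> complex"
        show "cmod (complex_of_real (indicator (\<Union>i<n. A i) \<omega>)) \<le> 1" for n
          by (simp add: indicator_def)
        show "(\<lambda>n. complex_of_real (indicator (\<Union>i<n. A i) \<omega>)) \<longlonglongrightarrow>
            complex_of_real (indicator (\<Union>(range A)) \<omega>)"
          by (intro tendsto_of_real LIMSEQ_indicator_UN)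
      qed
    qed
  qed
  have Q_sets: "Q (\<lambda>\<omega>. complex_of_real (indicator A \<omega>))" if A: "A \<in> sets dual_borel" for A
  proof -
    obtain B where B: "B \<in> sets borel" "A = dual_group \<inter> B"
      using A by (auto simp: dual_borel_def sets_restrict_space)
    show ?thesis by (rule Q_cong[OF Q_borel[OF B(1)]]) (simp add: B(2) indicator_def)
  qed
  \<comment> \<open>The bound \<open>C\<close> has to vary in the induction: scaling changes it,
    whereas summands and increasing approximants inherit it by nonnegativity and
    monotonicity.\<close>
  have Q_nonneg: "Q (\<lambda>\<omega>. complex_of_real (u \<omega>))"
    if "u \<in> borel_measurable dual_borel" "\<And>\<omega>. 0 \<le> u \<omega>" "\<And>\<omega>. \<omega> \<in> dual_group \<Longrightarrow> u \<omega> \<le> C" for u C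
    using that
  proof (induction arbitrary: C rule: borel_measurable_induct_real)
    case (set A)
    then show ?case by (intro Q_sets)
  next
    case (mult u c)
    show ?case
    proof (cases "c = 0")
      case True
      then show ?thesis using Q_scale[OF Q_char[of 0], of 0] by simp
    next
      case False
      have "u \<omega> \<le> C / c" if "\<omega> \<in> dual_group" for \<omega>
        using mult.prems[OF that] mult.hyps(1) False by (simp add: field_simps)
      then have "Q (\<lambda>\<omega>. complex_of_real (u \<omega>))" by (rule mult.IH)
      then show ?thesis using Q_scale[of _ "complex_of_real c"] by simp
    qed
  next
    case (add u v)
    have "u \<omega> \<le> C" "v \<omega> \<le> C" if "\<omega> \<in> dual_group" for \<omega>
      using add.prems[OF that] add.hyps(2,4)[of \<omega>] by linarith+
    then have "Q (\<lambda>\<omega>. complex_of_real (u \<omega>))" "Q (\<lambda>\<omega>. complex_of_real (v \<omega>))"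
      by (blast intro: add.IH)+
    then show ?case using Q_add by simp
  next
    case (seq U)
    have le: "U i \<omega> \<le> C" if "\<omega> \<in> dual_group" for i \<omega>
    proof -
      have "U i \<omega> \<le> u \<omega>"
        using seq.hyps(3,4) that
        by (intro incseq_le[of "\<lambda>i. U i \<omega>"]) (auto simp: incseq_def le_fun_def space_dual_borel)
      then show ?thesis using seq.prems[OF that] by linarith
    qed
    show ?case
    proof (rule Q_lim)
      show "Q (\<lambda>\<omega>. complex_of_real (U i \<omega>))" for i by (rule seq.IH[OF le])
      fix \<omega> :: "'g \<Rightarrow> complex" assume \<omega>: "\<omega> \<in> dual_group"
      show "cmod (complex_of_real (U i \<omega>)) \<le> C" for i using le[OF \<omega>, of i] seq.hyps(2)[of i \<omega>] by simp
      show "(\<lambda>i. complex_of_real (U i \<omega>)) \<longlonglongrightarrow> complex_of_real (u \<omega>)"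
        using seq.hyps(4) \<omega> by (intro tendsto_of_real) (simp add: space_dual_borel)
    qed
  qed
  obtain C where fm: "f \<in> borel_measurable dual_borel" and C: "\<And>\<omega>. \<omega> \<in> dual_group \<Longrightarrow> cmod (f \<omega>) \<le> C"
    using f unfolding bounded_borel_def by blast
  have part: "Q (\<lambda>\<omega>. complex_of_real (max 0 (u (f \<omega>))))"
    if u: "u \<in> borel_measurable borel" "\<And>z. \<bar>u z\<bar> \<le> cmod z" for u
  proof (rule Q_nonneg)
    show "(\<lambda>\<omega>. max 0 (u (f \<omega>))) \<in> borel_measurable dual_borel"
      using measurable_compose[OF fm u(1)] by measurable
    show "max 0 (u (f \<omega>)) \<le> max 0 C" if "\<omega> \<in> dual_group" for \<omega>
      using u(2)[of "f \<omega>"] C[OF that] by linarith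
  qed auto
  \<comment> \<open>The positive and negative parts of the real and imaginary parts recombine to
    \<open>f\<close>.\<close>
  have "Q (\<lambda>\<omega>. (complex_of_real (max 0 (Re (f \<omega>))) + (-1) * complex_of_real (max 0 (- Re (f \<omega>)))) +
      (\<i> * complex_of_real (max 0 (Im (f \<omega>))) + (-\<i>) * complex_of_real (max 0 (- Im (f \<omega>)))))"
    by (intro Q_add Q_scale part) (auto simp: abs_Re_le_cmod abs_Im_le_cmod)
  then have "Q f" by (rule Q_cong) (auto simp: complex_eq_iff max_def)
  then show ?thesis by (simp add: Q_def)
qed

section \<open>Haar measure and the endomorphism\<close>

lemma measurable_dual_continuous:
  assumes "continuous_on dual_group T" "T ` dual_group \<subseteq> dual_group"
  shows "T \<in> measurable dual_borel dual_borel"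
proof -
  have "T \<in> measurable dual_borel borel" by (rule borel_measurable_dual_continuous[OF assms(1)])
  then have "T \<in> measurable dual_borel (restrict_space borel dual_group)"
    using assms(2) by (intro measurable_restrict_space2) (auto simp: space_dual_borel)
  then show ?thesis by (simp add: dual_borel_def)
qed

lemma dual_group_mult: "\<eta> \<in> dual_group \<Longrightarrow> \<omega> \<in> dual_group \<Longrightarrow> (\<lambda>a. \<eta> a * \<omega> a) \<in> dual_group"
  by (auto simp: dual_group_def norm_mult)

lemma dual_group_cnj: "\<eta> \<in> dual_group \<Longrightarrow> (\<lambda>a. cnj (\<eta> a)) \<in> dual_group"
  by (auto simp: dual_group_def)

locale haar_measure =
  fixes \<mu> :: "('g::{ab_group_add,countable} \<Rightarrow> complex) measure"
  assumes haar: "is_haar_measure \<mu>"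
begin

lemma sets_haar: "sets \<mu> = sets dual_borel"
  using haar by (simp add: is_haar_measure_def)

lemma space_haar: "space \<mu> = dual_group"
  using sets_eq_imp_space_eq[OF sets_haar] by (simp add: space_dual_borel)

lemma measurable_haar: "measurable \<mu> N = measurable dual_borel N"
  by (rule measurable_cong_sets) (simp_all add: sets_haar)

lemma emeasure_haar_space: "emeasure \<mu> (space \<mu>) = 1"
  using haar by (simp add: is_haar_measure_def)

sublocale finite_measure \<mu>
  by standard (simp add: emeasure_haar_space)

lemma measure_haar_space: "measure \<mu> (space \<mu>) = 1"
  by (simp add: measure_def emeasure_haar_space)

lemma integrable_bounded_mult:
  assumes \<phi>: "bounded_borel \<phi>" and h: "integrable \<mu> h"
  shows "integrable \<mu> (\<lambda>\<omega>. \<phi> \<omega> * h \<omega>)"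
proof -
  obtain C where C: "\<And>\<omega>. \<omega> \<in> dual_group \<Longrightarrow> cmod (\<phi> \<omega>) \<le> C"
    using \<phi> unfolding bounded_borel_def by blast
  have [measurable]: "\<phi> \<in> borel_measurable \<mu>" "h \<in> borel_measurable \<mu>"
    using \<phi> borel_measurable_integrable[OF h] by (simp_all add: bounded_borel_def measurable_haar)
  show ?thesis
  proof (rule Bochner_Integration.integrable_bound)
    show "integrable \<mu> (\<lambda>\<omega>. C * norm (h \<omega>))" using h by simp
    show "AE \<omega> in \<mu>. norm (\<phi> \<omega> * h \<omega>) \<le> norm (C * norm (h \<omega>))"
    proof (rule AE_I2)
      fix \<omega> assume "\<omega> \<in> space \<mu>"
      then have "cmod (\<phi> \<omega>) \<le> C" using C by (simp add: space_haar)
      moreover from this have "0 \<le> C" using norm_ge_zero order_trans by blast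
      ultimately show "norm (\<phi> \<omega> * h \<omega>) \<le> norm (C * norm (h \<omega>))"
        by (simp add: norm_mult mult_right_mono)
    qed
  qed measurable
qed

lemma integrable_bounded_borel: "bounded_borel \<phi> \<Longrightarrow> integrable \<mu> \<phi>"
  using integrable_bounded_mult[of \<phi> "\<lambda>_. 1"] by simp

lemma integral_bounded_mult_le:
  assumes "bounded_borel \<phi>" "\<And>\<omega>. \<omega> \<in> dual_group \<Longrightarrow> cmod (\<phi> \<omega>) \<le> 1" "integrable \<mu> h"
  shows "cmod (LINT \<omega>|\<mu>. \<phi> \<omega> * h \<omega>) \<le> (LINT \<omega>|\<mu>. cmod (h \<omega>))"
proof (rule order_trans[OF integral_norm_bound integral_mono])
  show "integrable \<mu> (\<lambda>\<omega>. cmod (\<phi> \<omega> * h \<omega>))"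
    using integrable_bounded_mult[OF assms(1,3)] by simp
  show "integrable \<mu> (\<lambda>\<omega>. cmod (h \<omega>))" using assms(3) by simp
  show "cmod (\<phi> \<omega> * h \<omega>) \<le> cmod (h \<omega>)" if "\<omega> \<in> space \<mu>" for \<omega>
    using assms(2)[of \<omega>] that by (simp add: space_haar norm_mult mult_left_le_one_le)
qed

lemma bounded_convergence:
  assumes f: "\<And>n. bounded_borel (f n)" and g: "bounded_borel g"
    and bound: "\<And>n \<omega>. \<omega> \<in> dual_group \<Longrightarrow> cmod (f n \<omega>) \<le> C"
    and lim: "\<And>\<omega>. \<omega> \<in> dual_group \<Longrightarrow> (\<lambda>n. f n \<omega>) \<longlonglongrightarrow> g \<omega>"
    and h: "integrable \<mu> h"
  shows "(\<lambda>n. LINT \<omega>|\<mu>. f n \<omega> * h \<omega>) \<longlonglongrightarrow> (LINT \<omega>|\<mu>. g \<omega> * h \<omega>)"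
proof (rule integral_dominated_convergence[where w = "\<lambda>\<omega>. C * norm (h \<omega>)"])
  show "(\<lambda>\<omega>. g \<omega> * h \<omega>) \<in> borel_measurable \<mu>" "\<And>n. (\<lambda>\<omega>. f n \<omega> * h \<omega>) \<in> borel_measurable \<mu>"
    by (intro borel_measurable_integrable integrable_bounded_mult f g h)+
  show "integrable \<mu> (\<lambda>\<omega>. C * norm (h \<omega>))" using h by simp
  show "AE \<omega> in \<mu>. (\<lambda>n. f n \<omega> * h \<omega>) \<longlonglongrightarrow> g \<omega> * h \<omega>"
    using lim by (intro AE_I2 tendsto_mult tendsto_const) (simp add: space_haar)
  show "AE \<omega> in \<mu>. norm (f n \<omega> * h \<omega>) \<le> C * norm (h \<omega>)" for n
    using bound[of _ n] by (intro AE_I2) (simp add: space_haar norm_mult mult_right_mono)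
qed

text \<open>Invariance of Haar measure is stated for images of sets; the preimage under translation
  by \<open>\<eta>\<close> is the image under translation by its conjugate, so \<open>\<mu>\<close>
  equals its image measure.\<close>

lemma integral_translate:
  assumes \<eta>: "\<eta> \<in> dual_group" and f: "f \<in> borel_measurable dual_borel"
  shows "(LINT \<omega>|\<mu>. f (\<lambda>a. \<eta> a * \<omega> a)) = (LINT \<omega>|\<mu>. (f \<omega> :: complex))"
proof -
  let ?T = "\<lambda>\<omega> a. \<eta> a * \<omega> a" and ?S = "\<lambda>\<omega> a. cnj (\<eta> a) * \<omega> a"
  have inv: "cnj (\<eta> a) * \<eta> a = 1" for a
    using dual_groupD(1,3,4)[OF \<eta>] by (metis ab_left_minus)
  have inv': "cnj (\<eta> a) * (\<eta> a * z) = z" "\<eta> a * (cnj (\<eta> a) * z) = z" for a z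
    using inv[of a] by (metis mult.assoc mult.left_commute mult_1)+
  have "?T \<in> measurable dual_borel dual_borel"
  proof (rule measurable_dual_continuous)
    show "continuous_on dual_group ?T"
      by (intro continuous_on_coordinatewise_then_product continuous_on_mult continuous_on_const
          continuous_on_eval)
    show "?T ` dual_group \<subseteq> dual_group" using dual_group_mult[OF \<eta>] by blast
  qed
  then have T: "?T \<in> measurable \<mu> \<mu>"
    using measurable_cong_sets[OF sets_haar sets_haar] by blast
  have "distr \<mu> \<mu> ?T = \<mu>"
  proof (rule measure_eqI)
    fix A assume "A \<in> sets (distr \<mu> \<mu> ?T)"
    then have A: "A \<in> sets \<mu>" by simp
    then have "A \<subseteq> dual_group" using sets.sets_into_space[OF A] by (simp add: space_haar)
    then have "?T -` A \<inter> space \<mu> = ?S ` A"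
      using dual_group_mult[OF dual_group_cnj[OF \<eta>]]
      by (auto simp: space_haar inv' image_iff intro!: bexI[of _ "?T _"])
    then show "emeasure (distr \<mu> \<mu> ?T) A = emeasure \<mu> A"
      using haar dual_group_cnj[OF \<eta>] A by (simp add: emeasure_distr[OF T A] is_haar_measure_def)
  qed simp
  then show ?thesis
    using integral_distr[OF T, of f] f by (simp add: measurable_haar)
qed

end

section \<open>Haar measure and the iterates of the dual endomorphism\<close>

locale haar_dilation = dilation_endomorphism \<alpha> + haar_measure \<mu>
  for \<alpha> :: "'g::{ab_group_add,countable} \<Rightarrow> 'g" and \<mu> :: "('g \<Rightarrow> complex) measure"
begin

text \<open>For nonzero \<open>a\<close>, translation by a character \<open>\<eta>\<close> with
  \<open>\<eta> a \<noteq> 1\<close> multiplies the integral by \<open>\<eta> a\<close> and also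
  leaves it unchanged.\<close>

lemma integral_character: "(LINT \<omega>|\<mu>. \<omega> a) = (if a = 0 then 1 else 0)"
proof (cases "a = 0")
  case True
  have "(LINT \<omega>|\<mu>. \<omega> a) = (LINT \<omega>|\<mu>. 1)"
    by (rule Bochner_Integration.integral_cong) (simp_all add: True space_haar dual_groupD)
  then show ?thesis using True by (simp add: measure_haar_space)
next
  case False
  then obtain \<eta> where \<eta>: "\<eta> \<in> dual_group" "\<eta> a \<noteq> 1" using separating_character by blast
  have "(LINT \<omega>|\<mu>. \<omega> a) = (LINT \<omega>|\<mu>. \<eta> a * \<omega> a)"
    using integral_translate[OF \<eta>(1), of "\<lambda>\<omega>. \<omega> a"] by simp
  then have "(LINT \<omega>|\<mu>. \<omega> a) = \<eta> a * (LINT \<omega>|\<mu>. \<omega> a)" by simp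
  then show ?thesis using \<eta>(2) False by simp
qed

text \<open>The n-th iterate of the endomorphism of the dual group that is adjoint to
  \<open>\<alpha>\<close>.\<close>

definition pull :: "nat \<Rightarrow> ('g \<Rightarrow> complex) \<Rightarrow> 'g \<Rightarrow> complex" where
  "pull n \<omega> = (\<lambda>a. \<omega> ((\<alpha> ^^ n) a))"

lemma pull_dual_group: "\<omega> \<in> dual_group \<Longrightarrow> pull n \<omega> \<in> dual_group"
  by (auto simp: dual_group_def pull_def pow_hom)

lemma bounded_borel_pull:
  assumes "bounded_borel \<phi>"
  shows "bounded_borel (\<lambda>\<omega>. \<phi> (pull n \<omega>))"
proof -
  have "pull n \<in> measurable dual_borel dual_borel"
  proof (rule measurable_dual_continuous)
    show "continuous_on dual_group (pull n)"
      unfolding pull_def by (intro continuous_on_coordinatewise_then_product continuous_on_eval)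
    show "pull n ` dual_group \<subseteq> dual_group" using pull_dual_group by blast
  qed
  then have "(\<lambda>\<omega>. \<phi> (pull n \<omega>)) \<in> borel_measurable dual_borel"
    using assms measurable_compose unfolding bounded_borel_def by blast
  then show ?thesis using assms pull_dual_group unfolding bounded_borel_def by blast
qed

text \<open>Both sides are linear in \<open>\<phi>\<close> and respect bounded pointwise limits, so
  equality on characters suffices. It says that \<open>h'\<close> is the n-fold transfer of
  \<open>h\<close>, in a form that can be tested against arbitrary bounded Borel functions.\<close>

lemma pull_integral_eqI:
  assumes \<phi>: "bounded_borel \<phi>" and h: "integrable \<mu> h" "integrable \<mu> h'"
    and eq: "\<And>a. (LINT \<omega>|\<mu>. \<omega> a * h' \<omega>) = (LINT \<omega>|\<mu>. \<omega> ((\<alpha> ^^ n) a) * h \<omega>)"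
  shows "(LINT \<omega>|\<mu>. \<phi> \<omega> * h' \<omega>) = (LINT \<omega>|\<mu>. \<phi> (pull n \<omega>) * h \<omega>)"
  using \<phi>
proof (induction rule: bounded_borel_induct)
  case (character a)
  show ?case by (simp add: eq pull_def)
next
  case (add f g)
  then show ?case
    by (simp add: distrib_right integrable_bounded_mult bounded_borel_pull h)
next
  case (scale f c)
  then show ?case by (simp add: mult.assoc)
next
  case (limit f g C)
  have "(\<lambda>n. LINT \<omega>|\<mu>. f n \<omega> * h' \<omega>) \<longlonglongrightarrow> (LINT \<omega>|\<mu>. g \<omega> * h' \<omega>)"
    by (rule bounded_convergence[OF limit.hyps h(2)])
  moreover have "(\<lambda>k. LINT \<omega>|\<mu>. f k (pull n \<omega>) * h \<omega>) \<longlonglongrightarrow> (LINT \<omega>|\<mu>. g (pull n \<omega>) * h \<omega>)"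
    by (rule bounded_convergence[OF bounded_borel_pull[OF limit.hyps(1)] bounded_borel_pull[OF limit.hyps(2)]
        limit.hyps(3)[OF pull_dual_group] limit.hyps(4)[OF pull_dual_group] h(1)])
  ultimately show ?case using limit.IH LIMSEQ_unique by simp
qed

text \<open>A nonzero frequency of \<open>p\<close> eventually leaves the range of
  \<open>\<alpha> ^^ n\<close>, and from then on its character is orthogonal to everything composed
  with \<open>pull n\<close>. The threshold depends on \<open>p\<close> alone, which gives
  uniformity in \<open>\<phi>\<close>.\<close>

lemma integral_pull_trig_poly:
  assumes "trig_poly p"
  shows "\<exists>N. \<forall>n\<ge>N. \<forall>\<phi>. bounded_borel \<phi> \<longrightarrow>
    (LINT \<omega>|\<mu>. \<phi> (pull n \<omega>) * p \<omega>) = (LINT \<omega>|\<mu>. \<phi> \<omega>) * (LINT \<omega>|\<mu>. p \<omega>)"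
  using assms
proof induction
  case (character a)
  have char: "integrable \<mu> (\<lambda>\<omega>. \<omega> a)"
    by (intro integrable_bounded_borel bounded_borel_continuous continuous_on_eval)
  have mult: "(LINT \<omega>|\<mu>. \<omega> b * \<omega> a) = (if b + a = 0 then 1 else 0)" for b
  proof -
    have "(LINT \<omega>|\<mu>. \<omega> b * \<omega> a) = (LINT \<omega>|\<mu>. \<omega> (b + a))"
      by (rule Bochner_Integration.integral_cong) (simp_all add: space_haar dual_groupD)
    then show ?thesis by (simp add: integral_character)
  qed
  have one: "integrable \<mu> (\<lambda>_. (LINT \<omega>|\<mu>. \<omega> a))" by simp
  obtain N where N: "\<And>n. n \<ge> N \<Longrightarrow> a = 0 \<or> a \<notin> range (\<alpha> ^^ n)"
  proof (cases "a = 0")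
    case False
    then obtain N where N: "a \<notin> range (\<alpha> ^^ N)" using Inter_powers by blast
    have "a \<notin> range (\<alpha> ^^ n)" if "n \<ge> N" for n
    proof
      assume "a \<in> range (\<alpha> ^^ n)"
      then obtain b where "a = (\<alpha> ^^ n) b" by blast
      also have "\<dots> = (\<alpha> ^^ N) ((\<alpha> ^^ (n - N)) b)" using that by (simp add: pow_pow)
      finally show False using N by blast
    qed
    then show thesis using \<open>\<And>N. (\<And>n. n \<ge> N \<Longrightarrow> a = 0 \<or> a \<notin> range (\<alpha> ^^ n)) \<Longrightarrow> thesis\<close> by blast
  qed auto
  show ?case
  proof (intro exI[of _ N] allI impI)
    fix n \<phi> assume n: "n \<ge> N" and \<phi>: "bounded_borel (\<phi> :: ('g \<Rightarrow> complex) \<Rightarrow> complex)"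
    \<comment> \<open>From \<open>N\<close> on, the constant function on the left has the Fourier
      coefficients of the n-fold transfer of the character of \<open>a\<close>, so it can take the
      role of \<open>h'\<close>.\<close>
    have "(LINT \<omega>|\<mu>. \<phi> \<omega> * (LINT \<omega>|\<mu>. \<omega> a)) = (LINT \<omega>|\<mu>. \<phi> (pull n \<omega>) * \<omega> a)"
    proof (rule pull_integral_eqI[OF \<phi> char one])
      fix b
      have "(\<alpha> ^^ n) b + a = 0 \<longleftrightarrow> b = 0 \<and> a = 0"
      proof
        assume eq: "(\<alpha> ^^ n) b + a = 0"
        then have "a = (\<alpha> ^^ n) (- b)" unfolding pow_uminus by (simp add: eq_neg_iff_add_eq_0 add.commute)
        then have "a = 0" using N[OF n] by blast
        then have "(\<alpha> ^^ n) b = (\<alpha> ^^ n) 0" using eq by (simp add: pow_zero)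
        then show "b = 0 \<and> a = 0" using \<open>a = 0\<close> by simp
      qed (simp add: pow_zero)
      then show "(LINT \<omega>|\<mu>. \<omega> b * (LINT \<omega>|\<mu>. \<omega> a)) = (LINT \<omega>|\<mu>. \<omega> ((\<alpha> ^^ n) b) * \<omega> a)"
        by (simp add: mult integral_character)
    qed
    then show "(LINT \<omega>|\<mu>. \<phi> (pull n \<omega>) * \<omega> a) = (LINT \<omega>|\<mu>. \<phi> \<omega>) * (LINT \<omega>|\<mu>. \<omega> a)" by simp
  qed
next
  case (add p q)
  have int: "integrable \<mu> p" "integrable \<mu> q"
    using add.hyps by (simp_all add: integrable_bounded_borel bounded_borel_continuous continuous_trig_poly)
  obtain N M where
    N: "\<And>n \<phi>. n \<ge> N \<Longrightarrow> bounded_borel \<phi> \<Longrightarrow>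
      (LINT \<omega>|\<mu>. \<phi> (pull n \<omega>) * p \<omega>) = (LINT \<omega>|\<mu>. \<phi> \<omega>) * (LINT \<omega>|\<mu>. p \<omega>)" and
    M: "\<And>n \<phi>. n \<ge> M \<Longrightarrow> bounded_borel \<phi> \<Longrightarrow>
      (LINT \<omega>|\<mu>. \<phi> (pull n \<omega>) * q \<omega>) = (LINT \<omega>|\<mu>. \<phi> \<omega>) * (LINT \<omega>|\<mu>. q \<omega>)"
    using add.IH by blast
  show ?case
    by (rule exI[of _ "max N M"])
      (simp add: distrib_left N M int integrable_bounded_mult bounded_borel_pull)
next
  case (scale p c)
  then show ?case by (auto simp: mult.left_commute)
next
  case (cong p q)
  have "(LINT \<omega>|\<mu>. f \<omega> * q \<omega>) = (LINT \<omega>|\<mu>. f \<omega> * p \<omega>)" for f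
    by (rule Bochner_Integration.integral_cong) (simp_all add: space_haar cong.hyps)
  from this this[of "\<lambda>_. 1"] show ?case using cong.IH by simp
qed

end

section \<open>Density of trigonometric polynomials, and convergence of transfers in L^1\<close>

context haar_dilation
begin

lemma integrable_trig_poly: "trig_poly p \<Longrightarrow> integrable \<mu> p"
  by (intro integrable_bounded_borel bounded_borel_continuous continuous_trig_poly)

lemma integral_norm_diff_triangle:
  fixes f g h :: "('g \<Rightarrow> complex) \<Rightarrow> complex"
  assumes "integrable \<mu> f" "integrable \<mu> g" "integrable \<mu> h"
  shows "(LINT \<omega>|\<mu>. cmod (f \<omega> - h \<omega>)) \<le> (LINT \<omega>|\<mu>. cmod (f \<omega> - g \<omega>)) + (LINT \<omega>|\<mu>. cmod (g \<omega> - h \<omega>))"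
proof -
  have "(LINT \<omega>|\<mu>. cmod (f \<omega> - h \<omega>)) \<le> (LINT \<omega>|\<mu>. cmod (f \<omega> - g \<omega>) + cmod (g \<omega> - h \<omega>))"
    using assms norm_triangle_ineq4 by (intro integral_mono) (auto intro: norm_diff_triangle_le)
  then show ?thesis using assms by simp
qed

lemma trig_poly_dense_bounded:
  assumes "bounded_borel f"
  shows "\<forall>\<epsilon>>0. \<exists>p. trig_poly p \<and> (LINT \<omega>|\<mu>. cmod (f \<omega> - p \<omega>)) < \<epsilon>"
  using assms
proof (induction rule: bounded_borel_induct)
  case (character a)
  show ?case using trig_poly.character[of a] by (auto intro!: exI[of _ "\<lambda>\<omega>. \<omega> a"])
next
  case (add f g)
  show ?case
  proof (intro allI impI)
    fix \<epsilon> :: real assume "\<epsilon> > 0"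
    then obtain p q where p: "trig_poly p" "(LINT \<omega>|\<mu>. cmod (f \<omega> - p \<omega>)) < \<epsilon> / 2"
      and q: "trig_poly q" "(LINT \<omega>|\<mu>. cmod (g \<omega> - q \<omega>)) < \<epsilon> / 2"
      using add.IH half_gt_zero by metis
    have int: "integrable \<mu> f" "integrable \<mu> g" "integrable \<mu> p" "integrable \<mu> q"
      by (simp_all add: add.hyps p q integrable_bounded_borel integrable_trig_poly)
    have "(LINT \<omega>|\<mu>. cmod (f \<omega> + g \<omega> - (p \<omega> + q \<omega>))) \<le>
        (LINT \<omega>|\<mu>. cmod (f \<omega> - p \<omega>) + cmod (g \<omega> - q \<omega>))"
      using int by (intro integral_mono) (auto intro: norm_diff_triangle_ineq)
    also have "\<dots> < \<epsilon>" using int p q by simp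
    finally show "\<exists>p. trig_poly p \<and> (LINT \<omega>|\<mu>. cmod (f \<omega> + g \<omega> - p \<omega>)) < \<epsilon>"
      using trig_poly.add[OF p(1) q(1)] by blast
  qed
next
  case (scale f c)
  show ?case
  proof (intro allI impI)
    fix \<epsilon> :: real assume "\<epsilon> > 0"
    \<comment> \<open>The added 1 in the denominator covers \<open>c = 0\<close> and makes the final
      estimate strict.\<close>
    then have "\<epsilon> / (cmod c + 1) > 0" by (intro divide_pos_pos) (auto intro: add_nonneg_pos)
    then obtain p where p: "trig_poly p" "(LINT \<omega>|\<mu>. cmod (f \<omega> - p \<omega>)) < \<epsilon> / (cmod c + 1)"
      using scale.IH by blast
    have "(LINT \<omega>|\<mu>. cmod (c * f \<omega> - c * p \<omega>)) = cmod c * (LINT \<omega>|\<mu>. cmod (f \<omega> - p \<omega>))"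
      by (simp add: right_diff_distrib[symmetric] norm_mult)
    also have "\<dots> \<le> cmod c * (\<epsilon> / (cmod c + 1))"
      using p(2) by (intro mult_left_mono) auto
    also have "\<dots> < (cmod c + 1) * (\<epsilon> / (cmod c + 1))"
      using \<open>\<epsilon> / (cmod c + 1) > 0\<close> by (intro mult_strict_right_mono) auto
    also have "\<dots> = \<epsilon>"
    proof -
      have "cmod c + 1 \<noteq> 0" using norm_ge_zero[of c] by linarith
      then show ?thesis by simp
    qed
    finally show "\<exists>p. trig_poly p \<and> (LINT \<omega>|\<mu>. cmod (c * f \<omega> - p \<omega>)) < \<epsilon>"
      using trig_poly.scale[OF p(1)] by blast
  qed
next
  case (limit f g C)
  have int: "integrable \<mu> (f n)" "integrable \<mu> g" for n
    by (simp_all add: limit.hyps integrable_bounded_borel)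
  have "(\<lambda>n. LINT \<omega>|\<mu>. cmod (g \<omega> - f n \<omega>)) \<longlonglongrightarrow> (LINT \<omega>|\<mu>. 0)"
  proof (rule integral_dominated_convergence[where w = "\<lambda>\<omega>. cmod (g \<omega>) + C"])
    show "(\<lambda>\<omega>. cmod (g \<omega> - f n \<omega>)) \<in> borel_measurable \<mu>" for n
      using int by (intro borel_measurable_integrable) simp
    show "integrable \<mu> (\<lambda>\<omega>. cmod (g \<omega>) + C)" using int(2) by simp
    show "AE \<omega> in \<mu>. (\<lambda>n. cmod (g \<omega> - f n \<omega>)) \<longlonglongrightarrow> 0"
    proof (rule AE_I2)
      fix \<omega> assume "\<omega> \<in> space \<mu>"
      then have "(\<lambda>n. f n \<omega>) \<longlonglongrightarrow> g \<omega>" using limit.hyps(4) by (simp add: space_haar)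
      then have "(\<lambda>n. cmod (g \<omega> - f n \<omega>)) \<longlonglongrightarrow> cmod (g \<omega> - g \<omega>)"
        by (intro tendsto_norm tendsto_diff tendsto_const)
      then show "(\<lambda>n. cmod (g \<omega> - f n \<omega>)) \<longlonglongrightarrow> 0" by simp
    qed
    show "AE \<omega> in \<mu>. norm (cmod (g \<omega> - f n \<omega>)) \<le> cmod (g \<omega>) + C" for n
    proof (rule AE_I2)
      fix \<omega> assume "\<omega> \<in> space \<mu>"
      then have "cmod (f n \<omega>) \<le> C" using limit.hyps(3) by (simp add: space_haar)
      then show "norm (cmod (g \<omega> - f n \<omega>)) \<le> cmod (g \<omega>) + C"
        using norm_triangle_ineq4[of "g \<omega>" "f n \<omega>"] by simp
    qed
  qed simp
  then have lim: "(\<lambda>n. LINT \<omega>|\<mu>. cmod (g \<omega> - f n \<omega>)) \<longlonglongrightarrow> 0" by simp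
  show ?case
  proof (intro allI impI)
    fix \<epsilon> :: real assume "\<epsilon> > 0"
    then have half: "0 < \<epsilon> / 2" by simp
    obtain n where n: "(LINT \<omega>|\<mu>. cmod (g \<omega> - f n \<omega>)) < \<epsilon> / 2"
      using eventually_happens[OF order_tendstoD(2)[OF lim half]] by auto
    obtain p where p: "trig_poly p" "(LINT \<omega>|\<mu>. cmod (f n \<omega> - p \<omega>)) < \<epsilon> / 2"
      using limit.IH half by blast
    have "(LINT \<omega>|\<mu>. cmod (g \<omega> - p \<omega>)) < \<epsilon>"
      using integral_norm_diff_triangle[OF int(2) int(1)[of n] integrable_trig_poly[OF p(1)]] n p(2)
      by linarith
    then show "\<exists>p. trig_poly p \<and> (LINT \<omega>|\<mu>. cmod (g \<omega> - p \<omega>)) < \<epsilon>" using p(1) by blast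
  qed
qed

text \<open>Truncation to the set where the modulus is at most \<open>k\<close> gives bounded
  functions that converge to \<open>h\<close> in L^1 by dominated convergence.\<close>

lemma trig_poly_dense:
  assumes h: "integrable \<mu> h" and "\<epsilon> > 0"
  shows "\<exists>p. trig_poly p \<and> (LINT \<omega>|\<mu>. cmod (h \<omega> - p \<omega>)) < \<epsilon>"
proof -
  define t where "t k \<omega> = (if cmod (h \<omega>) \<le> real k then h \<omega> else 0)" for k \<omega>
  have hm [measurable]: "h \<in> borel_measurable dual_borel"
    using borel_measurable_integrable[OF h] by (simp add: measurable_haar)
  have t: "bounded_borel (t k)" for k
    unfolding bounded_borel_def
  proof (intro conjI exI[of _ "real k"] ballI)
    show "t k \<in> borel_measurable dual_borel" unfolding t_def by measurable
  qed (simp add: t_def)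
  have "(\<lambda>k. LINT \<omega>|\<mu>. cmod (h \<omega> - t k \<omega>)) \<longlonglongrightarrow> (LINT \<omega>|\<mu>. 0)"
  proof (rule integral_dominated_convergence[where w = "\<lambda>\<omega>. cmod (h \<omega>)"])
    show "(\<lambda>\<omega>. cmod (h \<omega> - t k \<omega>)) \<in> borel_measurable \<mu>" for k
      using h integrable_bounded_borel[OF t] by (intro borel_measurable_integrable) simp
    show "integrable \<mu> (\<lambda>\<omega>. cmod (h \<omega>))" using h by simp
    show "AE \<omega> in \<mu>. (\<lambda>k. cmod (h \<omega> - t k \<omega>)) \<longlonglongrightarrow> 0"
    proof (rule AE_I2)
      fix \<omega>
      obtain K where K: "cmod (h \<omega>) \<le> real K" using real_arch_simple by blast
      have "eventually (\<lambda>k. cmod (h \<omega> - t k \<omega>) = 0) sequentially"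
        using K by (intro eventually_sequentiallyI[of K]) (auto simp: t_def)
      then show "(\<lambda>k. cmod (h \<omega> - t k \<omega>)) \<longlonglongrightarrow> 0" by (rule tendsto_eventually)
    qed
    show "AE \<omega> in \<mu>. norm (cmod (h \<omega> - t k \<omega>)) \<le> cmod (h \<omega>)" for k
      by (rule AE_I2) (simp add: t_def)
  qed simp
  then have lim: "(\<lambda>k. LINT \<omega>|\<mu>. cmod (h \<omega> - t k \<omega>)) \<longlonglongrightarrow> 0" by simp
  have half: "0 < \<epsilon> / 2" using \<open>\<epsilon> > 0\<close> by simp
  obtain k where k: "(LINT \<omega>|\<mu>. cmod (h \<omega> - t k \<omega>)) < \<epsilon> / 2"
    using eventually_happens[OF order_tendstoD(2)[OF lim half]] by auto
  obtain p where p: "trig_poly p" "(LINT \<omega>|\<mu>. cmod (t k \<omega> - p \<omega>)) < \<epsilon> / 2"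
    using trig_poly_dense_bounded[OF t] half by blast
  have "(LINT \<omega>|\<mu>. cmod (h \<omega> - p \<omega>)) < \<epsilon>"
    using integral_norm_diff_triangle[OF h integrable_bounded_borel[OF t[of k]]
        integrable_trig_poly[OF p(1)]] k p(2)
    by linarith
  then show ?thesis using p(1) by blast
qed

text \<open>Replacing \<open>h\<close> by a trigonometric polynomial close to it in L^1 costs less
  than \<open>\<epsilon> / 2\<close> in each of the two terms, whatever \<open>\<phi>\<close> of
  modulus at most 1 is used; for the polynomial the identity is exact.\<close>

lemma integral_pull_uniform:
  assumes h: "integrable \<mu> h" and "\<epsilon> > 0"
  shows "\<exists>N. \<forall>n\<ge>N. \<forall>\<phi>. bounded_borel \<phi> \<longrightarrow> (\<forall>\<omega>\<in>dual_group. cmod (\<phi> \<omega>) \<le> 1) \<longrightarrow>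
    cmod ((LINT \<omega>|\<mu>. \<phi> (pull n \<omega>) * h \<omega>) - (LINT \<omega>|\<mu>. \<phi> \<omega>) * (LINT \<omega>|\<mu>. h \<omega>)) < \<epsilon>"
proof -
  obtain p where p: "trig_poly p" "(LINT \<omega>|\<mu>. cmod (h \<omega> - p \<omega>)) < \<epsilon> / 2"
    using trig_poly_dense[OF h, of "\<epsilon> / 2"] \<open>\<epsilon> > 0\<close> by auto
  note ip = integrable_trig_poly[OF p(1)]
  obtain N where N: "\<And>n \<phi>. n \<ge> N \<Longrightarrow> bounded_borel \<phi> \<Longrightarrow>
      (LINT \<omega>|\<mu>. \<phi> (pull n \<omega>) * p \<omega>) = (LINT \<omega>|\<mu>. \<phi> \<omega>) * (LINT \<omega>|\<mu>. p \<omega>)"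
    using integral_pull_trig_poly[OF p(1)] by blast
  have hp: "integrable \<mu> (\<lambda>\<omega>. h \<omega> - p \<omega>)" using h ip by simp
  have "cmod ((LINT \<omega>|\<mu>. \<phi> (pull n \<omega>) * h \<omega>) - (LINT \<omega>|\<mu>. \<phi> \<omega>) * (LINT \<omega>|\<mu>. h \<omega>)) < \<epsilon>"
    if n: "n \<ge> N" and \<phi>: "bounded_borel \<phi>" "\<And>\<omega>. \<omega> \<in> dual_group \<Longrightarrow> cmod (\<phi> \<omega>) \<le> 1" for n \<phi>
  proof -
    note \<phi>n = bounded_borel_pull[OF \<phi>(1), of n]
    let ?A = "LINT \<omega>|\<mu>. \<phi> (pull n \<omega>) * (h \<omega> - p \<omega>)" and ?c = "LINT \<omega>|\<mu>. (h \<omega> - p \<omega>)"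
      and ?B = "LINT \<omega>|\<mu>. \<phi> \<omega>"
    have "?A = (LINT \<omega>|\<mu>. \<phi> (pull n \<omega>) * h \<omega>) - (LINT \<omega>|\<mu>. \<phi> \<omega>) * (LINT \<omega>|\<mu>. p \<omega>)"
      by (simp add: right_diff_distrib integrable_bounded_mult[OF \<phi>n] h ip N[OF n \<phi>(1)])
    moreover have "?c = (LINT \<omega>|\<mu>. h \<omega>) - (LINT \<omega>|\<mu>. p \<omega>)" using h ip by simp
    ultimately have eq: "(LINT \<omega>|\<mu>. \<phi> (pull n \<omega>) * h \<omega>) - ?B * (LINT \<omega>|\<mu>. h \<omega>) = ?A - ?B * ?c"
      by (simp only: right_diff_distrib) simp
    have A: "cmod ?A < \<epsilon> / 2"
      using integral_bounded_mult_le[OF \<phi>n \<phi>(2)[OF pull_dual_group] hp] p(2) by linarith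
    have c: "cmod ?c < \<epsilon> / 2" using integral_norm_bound[of \<mu> "\<lambda>\<omega>. h \<omega> - p \<omega>"] p(2) by linarith
    have "cmod ?B \<le> 1"
      using integral_bounded_mult_le[OF \<phi>, of "\<lambda>_. 1"] by (simp add: measure_haar_space)
    then have "cmod (?B * ?c) \<le> cmod ?c"
      by (simp add: norm_mult mult_left_le_one_le)
    then show ?thesis unfolding eq using A c norm_triangle_ineq4[of ?A "?B * ?c"] by linarith
  qed
  then show ?thesis by blast
qed

text \<open>
  The functions \<open>h' n\<close> are the images of \<open>h\<close> under the iterated transfer operator of the
  endomorphism of the dual group, given here by their Fourier coefficients only.
\<close>

lemma transfer_tendsto_L1:
  assumes h: "integrable \<mu> h" and h': "\<And>n. integrable \<mu> (h' n)"
    and eq: "\<And>n a. (LINT \<omega>|\<mu>. \<omega> a * h' n \<omega>) = (LINT \<omega>|\<mu>. \<omega> ((\<alpha> ^^ n) a) * h \<omega>)"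
  shows "(\<lambda>n. LINT \<omega>|\<mu>. cmod (h' n \<omega> - (LINT \<omega>|\<mu>. h \<omega>))) \<longlonglongrightarrow> 0"
proof (rule LIMSEQ_I)
  fix \<epsilon> :: real assume "\<epsilon> > 0"
  let ?c = "LINT \<omega>|\<mu>. h \<omega>"
  obtain N where N: "\<And>n \<phi>. n \<ge> N \<Longrightarrow> bounded_borel \<phi> \<Longrightarrow> (\<And>\<omega>. \<omega> \<in> dual_group \<Longrightarrow> cmod (\<phi> \<omega>) \<le> 1) \<Longrightarrow>
      cmod ((LINT \<omega>|\<mu>. \<phi> (pull n \<omega>) * h \<omega>) - (LINT \<omega>|\<mu>. \<phi> \<omega>) * ?c) < \<epsilon>"
    using integral_pull_uniform[OF h \<open>\<epsilon> > 0\<close>] by blast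
  have "(LINT \<omega>|\<mu>. cmod (h' n \<omega> - ?c)) < \<epsilon>" if "n \<ge> N" for n
  proof -
    \<comment> \<open>Pairing with this conjugate phase produces the L^1 norm. Since it depends on
      \<open>n\<close>, the preceding estimate has to hold with a threshold common to all
      \<open>\<phi>\<close>.\<close>
    define \<phi> where "\<phi> \<omega> = cnj (sgn (h' n \<omega> - ?c))" for \<omega>
    have [measurable]: "(\<lambda>\<omega>. h' n \<omega> - ?c) \<in> borel_measurable dual_borel"
      using borel_measurable_integrable[OF h'] by (simp add: measurable_haar)
    have sgn: "(\<lambda>\<omega>. sgn (h' n \<omega> - ?c)) \<in> borel_measurable dual_borel"
      unfolding sgn_div_norm by measurable
    have 1: "cmod (\<phi> \<omega>) \<le> 1" for \<omega> by (simp add: \<phi>_def norm_sgn)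
    have \<phi>: "bounded_borel \<phi>"
      unfolding bounded_borel_def
    proof (intro conjI exI[of _ 1] ballI 1)
      show "\<phi> \<in> borel_measurable dual_borel"
        unfolding \<phi>_def using sgn
        by (rule measurable_compose) (intro borel_measurable_continuous_onI continuous_on_cnj continuous_on_id)
    qed
    have "complex_of_real (cmod z) = cnj (sgn z) * z" for z
      by (cases "z = 0") (simp_all add: sgn_div_norm scaleR_conv_of_real field_simps
          complex_norm_square[symmetric] power2_eq_square[symmetric])
    then have "complex_of_real (cmod (h' n \<omega> - ?c)) = \<phi> \<omega> * h' n \<omega> - \<phi> \<omega> * ?c" for \<omega>
      unfolding \<phi>_def by (simp only: right_diff_distrib)
    then have "complex_of_real (LINT \<omega>|\<mu>. cmod (h' n \<omega> - ?c)) = (LINT \<omega>|\<mu>. \<phi> \<omega> * h' n \<omega> - \<phi> \<omega> * ?c)"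
      by (simp only: integral_complex_of_real[symmetric])
    also have "\<dots> = (LINT \<omega>|\<mu>. \<phi> \<omega> * h' n \<omega>) - (LINT \<omega>|\<mu>. \<phi> \<omega>) * ?c"
      using integrable_bounded_mult[OF \<phi> h'] integrable_bounded_borel[OF \<phi>] by simp
    also have "(LINT \<omega>|\<mu>. \<phi> \<omega> * h' n \<omega>) = (LINT \<omega>|\<mu>. \<phi> (pull n \<omega>) * h \<omega>)"
      by (rule pull_integral_eqI[OF \<phi> h h' eq])
    finally have "cmod (complex_of_real (LINT \<omega>|\<mu>. cmod (h' n \<omega> - ?c))) < \<epsilon>"
      using N[OF that \<phi> 1] by simp
    then show ?thesis unfolding norm_of_real by linarith
  qed
  then show "\<exists>N. \<forall>n\<ge>N. norm ((LINT \<omega>|\<mu>. cmod (h' n \<omega> - ?c)) - 0) < \<epsilon>" by auto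
qed

end

section \<open>Subspaces of bounded dimension\<close>

text \<open>With \<open>X\<close> the matrix of the \<open>x p i\<close>, \<open>G\<close> is X X*
  and \<open>H\<close> below is X* X. The two have the same trace and the same sum of squared
  moduli, but \<open>H\<close> has size \<open>k\<close>, so Cauchy-Schwarz on its diagonal costs
  only the factor \<open>k\<close>.\<close>

lemma gram_trace_le:
  fixes x :: "'p \<Rightarrow> nat \<Rightarrow> complex" and k :: nat
  defines "G \<equiv> \<lambda>p q. \<Sum>i<k. x p i * cnj (x q i)"
  shows "(cmod (\<Sum>p\<in>P. G p p))\<^sup>2 \<le> real k * (\<Sum>p\<in>P. \<Sum>q\<in>P. (cmod (G p q))\<^sup>2)"
proof -
  define H where "H i j = (\<Sum>q\<in>P. cnj (x q i) * x q j)" for i j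
  have trace: "(\<Sum>p\<in>P. G p p) = (\<Sum>i<k. H i i)"
    unfolding G_def H_def by (subst sum.swap) (simp add: mult.commute)
  have sq: "complex_of_real (\<Sum>p\<in>P. \<Sum>q\<in>P. (cmod (G p q))\<^sup>2) =
      complex_of_real (\<Sum>i<k. \<Sum>j<k. (cmod (H i j))\<^sup>2)"
  proof -
    have "complex_of_real (\<Sum>p\<in>P. \<Sum>q\<in>P. (cmod (G p q))\<^sup>2) = (\<Sum>p\<in>P. \<Sum>q\<in>P. G p q * cnj (G p q))"
      by (simp only: of_real_sum complex_norm_square)
    also have "\<dots> = (\<Sum>p\<in>P. \<Sum>q\<in>P. \<Sum>i<k. \<Sum>j<k. (cnj (x q i) * x q j) * (x p i * cnj (x p j)))"
      unfolding G_def by (simp add: sum_product ac_simps)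
    also have "\<dots> = (\<Sum>p\<in>P. \<Sum>i<k. \<Sum>q\<in>P. \<Sum>j<k. (cnj (x q i) * x q j) * (x p i * cnj (x p j)))"
      by (intro sum.cong refl sum.swap)
    also have "\<dots> = (\<Sum>i<k. \<Sum>p\<in>P. \<Sum>j<k. \<Sum>q\<in>P. (cnj (x q i) * x q j) * (x p i * cnj (x p j)))"
      by (subst sum.swap) (intro sum.cong refl sum.swap)
    also have "\<dots> = (\<Sum>i<k. \<Sum>j<k. \<Sum>p\<in>P. \<Sum>q\<in>P. (cnj (x q i) * x q j) * (x p i * cnj (x p j)))"
      by (intro sum.cong refl sum.swap)
    also have "\<dots> = (\<Sum>i<k. \<Sum>j<k. H i j * cnj (H i j))"
      unfolding H_def by (intro sum.cong refl, subst mult.commute) (simp add: sum_product ac_simps)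
    also have "\<dots> = complex_of_real (\<Sum>i<k. \<Sum>j<k. (cmod (H i j))\<^sup>2)"
      by (simp only: of_real_sum complex_norm_square)
    finally show ?thesis .
  qed
  have "(cmod (\<Sum>i<k. H i i))\<^sup>2 \<le> (\<Sum>i<k. cmod (H i i))\<^sup>2"
    by (intro power_mono norm_sum) auto
  also have "\<dots> \<le> (\<Sum>i<k. (cmod (H i i))\<^sup>2) * real k"
    using sum_squared_le_sum_of_squares[of "\<lambda>i. cmod (H i i)" "{..<k}"] by (simp add: mult.commute)
  also have "\<dots> \<le> (\<Sum>i<k. \<Sum>j<k. (cmod (H i j))\<^sup>2) * real k"
  proof (intro mult_right_mono sum_mono)
    fix i assume "i \<in> {..<k}"
    then show "(cmod (H i i))\<^sup>2 \<le> (\<Sum>j<k. (cmod (H i j))\<^sup>2)"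
      by (intro member_le_sum) auto
  qed simp
  finally show ?thesis using sq unfolding trace of_real_eq_iff by (simp add: mult.commute)
qed

text \<open>The vector p(U) f, evaluated by the Horner scheme.\<close>

definition poly_orbit :: "('h::complex_hilbert \<Rightarrow> 'h) \<Rightarrow> 'h \<Rightarrow> complex poly \<Rightarrow> 'h" where
  "poly_orbit U f p = fold_coeffs (\<lambda>a y. a *\<^sub>C f + U y) p 0"

context
  fixes U :: "'h::complex_hilbert \<Rightarrow> 'h" and f :: 'h
  assumes U: "unitary_op U"
begin

lemma poly_orbit_0 [simp]: "poly_orbit U f 0 = 0"
  by (simp add: poly_orbit_def)

lemma poly_orbit_pCons [simp]: "poly_orbit U f (pCons a p) = a *\<^sub>C f + U (poly_orbit U f p)"
  by (cases "p = 0 \<and> a = 0") (auto simp: poly_orbit_def unitary_op_zero[OF U])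

lemma poly_orbit_add: "poly_orbit U f (p + q) = poly_orbit U f p + poly_orbit U f q"
  by (induction p q rule: poly_induct2) (simp_all add: scaleC_add_left unitary_opD(1)[OF U])

lemma poly_orbit_smult: "poly_orbit U f (smult c p) = c *\<^sub>C poly_orbit U f p"
  by (induction p) (simp_all add: scaleC_add_right scaleC_scaleC unitary_opD(2)[OF U])

lemma poly_orbit_diff: "poly_orbit U f (p - q) = poly_orbit U f p - poly_orbit U f q"
  using poly_orbit_add[of "p - q" q] by (simp add: algebra_simps)

lemma poly_orbit_sum: "poly_orbit U f (\<Sum>i\<in>I. p i) = (\<Sum>i\<in>I. poly_orbit U f (p i))"
  by (induction I rule: infinite_finite_induct) (simp_all add: poly_orbit_add)

lemma poly_orbit_in:
  assumes "closed_csubspace K" "U ` K \<subseteq> K" "f \<in> K"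
  shows "poly_orbit U f p \<in> K"
proof (induction p)
  case 0
  then show ?case using assms(1) by (simp add: closed_csubspace_def)
next
  case (pCons a p)
  then have "a *\<^sub>C f \<in> K" "U (poly_orbit U f p) \<in> K"
    using assms closed_csubspace_scaleC by blast+
  then show ?case using assms(1) by (simp add: closed_csubspace_def)
qed

text \<open>Split off a root: p = (X - z) q. Either q(U) f is nonzero and is an eigenvector for z,
  or the polynomial q of smaller degree annihilates f as well.\<close>

lemma eigenvector_if_annihilated:
  assumes "f \<noteq> 0" "p \<noteq> 0" "poly_orbit U f p = 0"
  shows "\<exists>v. is_eigenvector U v"
  using assms(2,3)
proof (induction "degree p" arbitrary: p rule: less_induct)
  case less
  have "degree p \<noteq> 0"
  proof
    assume "degree p = 0"
    then obtain c where "p = [:c:]" using degree_eq_zeroE by blast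
    then have "c *\<^sub>C f = 0" "c \<noteq> 0" using less.prems by (auto simp: unitary_op_zero[OF U])
    then show False using \<open>f \<noteq> 0\<close> norm_scaleC[of c f] by simp
  qed
  then have "\<not> constant (poly p)" by (simp add: constant_degree)
  then obtain z where "poly p z = 0" using fundamental_theorem_of_algebra by blast
  then obtain q where q: "p = [:- z, 1:] * q" unfolding poly_eq_0_iff_dvd by (auto elim: dvdE)
  have "q \<noteq> 0" using q less.prems(1) by auto
  have "degree p = Suc (degree q)" unfolding q using \<open>q \<noteq> 0\<close> by (subst degree_mult_eq) auto
  show ?case
  proof (cases "poly_orbit U f q = 0")
    case True
    then show ?thesis using less.hyps[of q] \<open>q \<noteq> 0\<close> \<open>degree p = _\<close> by simp
  next
    case False
    have "p = pCons 0 q - smult z q" by (simp add: q)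
    then have "poly_orbit U f p = U (poly_orbit U f q) - z *\<^sub>C poly_orbit U f q"
      by (simp add: poly_orbit_diff poly_orbit_smult)
    then have "U (poly_orbit U f q) = z *\<^sub>C poly_orbit U f q" using less.prems(2) by simp
    then show ?thesis using False unfolding is_eigenvector_def by blast
  qed
qed

text \<open>The Gram-Schmidt process for f, U f, U^2 f, ... is carried out on polynomials. The
  degree bound keeps the coefficient of order \<open>n\<close> in the new polynomial
  \<open>Q\<close> equal to 1, so \<open>Q\<close> is nonzero and its vector can be
  normalised.\<close>

lemma gram_schmidt_orbit:
  assumes free: "\<And>p. p \<noteq> 0 \<Longrightarrow> poly_orbit U f p \<noteq> 0"
  shows "\<exists>P. (\<forall>i<n. \<forall>m>i. coeff (P i) m = 0) \<and>
    (\<forall>i<n. \<forall>j<n. cinner (poly_orbit U f (P i)) (poly_orbit U f (P j)) = (if i = j then 1 else 0))"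
proof (induction n)
  case (Suc n)
  then obtain P where P: "\<And>i m. i < n \<Longrightarrow> m > i \<Longrightarrow> coeff (P i) m = 0"
    and ortho: "\<And>i j. i < n \<Longrightarrow> j < n \<Longrightarrow>
      cinner (poly_orbit U f (P i)) (poly_orbit U f (P j)) = (if i = j then 1 else 0)" by blast
  define e where "e i = poly_orbit U f (P i)" for i
  define w where "w = poly_orbit U f (monom 1 n)"
  define Q where "Q = monom 1 n - (\<Sum>i<n. smult (cinner w (e i)) (P i))"
  define v where "v = poly_orbit U f Q"
  define R where "R = smult (complex_of_real (inverse (norm v))) Q"
  have "coeff Q n = 1" using P by (simp add: Q_def coeff_sum)
  then have "Q \<noteq> 0" by auto
  then have "norm v \<noteq> 0" using free unfolding v_def by simp
  have v: "v = w - (\<Sum>i<n. cinner w (e i) *\<^sub>C e i)"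
    unfolding v_def Q_def w_def e_def by (simp add: poly_orbit_diff poly_orbit_sum poly_orbit_smult)
  have ve: "cinner v (e j) = 0" if "j < n" for j
  proof -
    have "cinner v (e j) = cinner w (e j) - (\<Sum>i<n. cinner w (e i) * (if i = j then 1 else 0))"
      unfolding v cinner_diff_left cinner_sum_left cinner_scaleC_left
      using ortho that by (simp add: e_def)
    also have "\<dots> = 0" using that by (simp add: if_distrib cong: if_cong)
    finally show ?thesis .
  qed
  have R: "poly_orbit U f R = complex_of_real (inverse (norm v)) *\<^sub>C v"
    by (simp add: R_def v_def poly_orbit_smult)
  have RR: "cinner (poly_orbit U f R) (poly_orbit U f R) = 1"
    using \<open>norm v \<noteq> 0\<close>
    by (simp add: R cinner_self norm_scaleC norm_inverse)
  have Re: "cinner (poly_orbit U f R) (e j) = 0" "cinner (e j) (poly_orbit U f R) = 0" if "j < n" for j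
    using ve[OF that] cinner_commute[of v "e j"] by (simp_all add: R cinner_scaleC_left cinner_scaleC_right)
  show ?case
  proof (intro exI[of _ "P(n := R)"] conjI allI impI)
    fix i m assume "i < Suc n" "i < m"
    then show "coeff ((P(n := R)) i) m = 0"
      using P by (cases "i = n") (simp_all add: R_def Q_def coeff_sum)
  next
    fix i j assume ij: "i < Suc n" "j < Suc n"
    then consider "i < n" "j < n" | "i < n" "j = n" | "i = n" "j < n" | "i = n" "j = n" by linarith
    then show "cinner (poly_orbit U f ((P(n := R)) i)) (poly_orbit U f ((P(n := R)) j)) =
        (if i = j then 1 else 0)"
    proof cases
      case 1
      then show ?thesis using ortho by simp
    qed (use RR Re in \<open>simp_all add: e_def\<close>)
  qed
qed simp

end

text \<open>A nonzero \<open>f\<close> in \<open>K\<close> is annihilated by some nonzero polynomial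
  in \<open>U\<close>, for otherwise the Gram-Schmidt process would produce \<open>n\<close>
  orthonormal vectors in \<open>K\<close>.\<close>

lemma eigenvector_if_bounded_dimension:
  fixes U :: "'h::complex_hilbert \<Rightarrow> 'h"
  assumes U: "unitary_op U" and K: "closed_csubspace K" "U ` K \<subseteq> K" "K \<noteq> {0}"
    and dim: "\<And>e. (\<And>i. i < n \<Longrightarrow> e i \<in> K) \<Longrightarrow> \<not> orthonormal_family e {..<n :: nat}"
  shows "\<exists>v. is_eigenvector U v"
proof -
  obtain f where f: "f \<in> K" "f \<noteq> 0" using K(1,3) by (auto simp: closed_csubspace_def)
  have "\<exists>p. p \<noteq> 0 \<and> poly_orbit U f p = 0"
  proof (rule ccontr)
    assume "\<not> ?thesis"
    then have free: "p \<noteq> 0 \<Longrightarrow> poly_orbit U f p \<noteq> 0" for p by blast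
    have "\<exists>P. (\<forall>i<n. \<forall>m>i. coeff (P i) m = 0) \<and>
      (\<forall>i<n. \<forall>j<n. cinner (poly_orbit U f (P i)) (poly_orbit U f (P j)) = (if i = j then 1 else 0))"
      by (rule gram_schmidt_orbit[OF U]) (rule free)
    then obtain P where
      "\<forall>i<n. \<forall>j<n. cinner (poly_orbit U f (P i)) (poly_orbit U f (P j)) = (if i = j then 1 else 0)"
      by (elim exE conjE)
    then have "orthonormal_family (\<lambda>i. poly_orbit U f (P i)) {..<n}"
      by (simp add: orthonormal_family_def)
    moreover have "\<not> orthonormal_family (\<lambda>i. poly_orbit U f (P i)) {..<n}"
      by (rule dim) (rule poly_orbit_in[OF U K(1,2) f(1)])
    ultimately show False by contradiction
  qed
  then show ?thesis using eigenvector_if_annihilated[OF U f(2)] by blast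
qed

section \<open>The bracket product\<close>

text \<open>The finite total of the extended integrals bounds each of them. Exchanging sum and
  integral shows that the sum of squares is finite almost everywhere.\<close>

lemma L2_sum_components:
  fixes \<mu> :: "'w measure"
  assumes "h \<in> L2_sum \<mu> \<sigma>"
  shows "integrable \<mu> (\<lambda>\<omega>. (cmod (h i \<omega>))\<^sup>2)"
    and "summable (\<lambda>i. LINT \<omega>|\<mu>. (cmod (h i \<omega>))\<^sup>2)"
    and "AE \<omega> in \<mu>. summable (\<lambda>i. (cmod (h i \<omega>))\<^sup>2)"
proof -
  have [measurable]: "h i \<in> borel_measurable \<mu>" for i
    using assms by (simp add: L2_sum_def)
  have fin: "(\<Sum>i. \<integral>\<^sup>+\<omega>. ennreal ((cmod (h i \<omega>))\<^sup>2) \<partial>\<mu>) < \<infinity>"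
    using assms by (simp add: L2_sum_def)
  show int: "integrable \<mu> (\<lambda>\<omega>. (cmod (h i \<omega>))\<^sup>2)" for i
  proof (rule integrableI_bounded)
    have "(\<integral>\<^sup>+\<omega>. ennreal ((cmod (h i \<omega>))\<^sup>2) \<partial>\<mu>) \<le> (\<Sum>i. \<integral>\<^sup>+\<omega>. ennreal ((cmod (h i \<omega>))\<^sup>2) \<partial>\<mu>)"
      using sum_le_suminf[of "\<lambda>i. \<integral>\<^sup>+\<omega>. ennreal ((cmod (h i \<omega>))\<^sup>2) \<partial>\<mu>" "{i}"] by simp
    then show "(\<integral>\<^sup>+\<omega>. ennreal (norm ((cmod (h i \<omega>))\<^sup>2)) \<partial>\<mu>) < \<infinity>"
      using fin by simp
  qed measurable
  have "(\<integral>\<^sup>+\<omega>. ennreal ((cmod (h i \<omega>))\<^sup>2) \<partial>\<mu>) = ennreal (LINT \<omega>|\<mu>. (cmod (h i \<omega>))\<^sup>2)" for i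
    by (rule nn_integral_eq_integral[OF int]) simp
  then show "summable (\<lambda>i. LINT \<omega>|\<mu>. (cmod (h i \<omega>))\<^sup>2)"
    using fin by (intro summable_suminf_not_top) auto
  have "(\<integral>\<^sup>+\<omega>. (\<Sum>i. ennreal ((cmod (h i \<omega>))\<^sup>2)) \<partial>\<mu>) \<noteq> \<infinity>"
    using fin by (subst nn_integral_suminf) auto
  then have "AE \<omega> in \<mu>. (\<Sum>i. ennreal ((cmod (h i \<omega>))\<^sup>2)) \<noteq> \<infinity>"
    by (intro nn_integral_PInf_AE) auto
  then show "AE \<omega> in \<mu>. summable (\<lambda>i. (cmod (h i \<omega>))\<^sup>2)"
    by eventually_elim (auto intro: summable_suminf_not_top)
qed

text \<open>Each product is dominated by the sum of the two squared moduli. The conclusions are the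
  conditions for integrating the bracket series term by term.\<close>

lemma L2_sum_products:
  fixes \<mu> :: "'w measure"
  assumes g: "g \<in> L2_sum \<mu> \<sigma>" and h: "h \<in> L2_sum \<mu> \<sigma>"
  shows "integrable \<mu> (\<lambda>\<omega>. g i \<omega> * cnj (h i \<omega>))"
    and "AE \<omega> in \<mu>. summable (\<lambda>i. norm (g i \<omega> * cnj (h i \<omega>)))"
    and "summable (\<lambda>i. LINT \<omega>|\<mu>. norm (g i \<omega> * cnj (h i \<omega>)))"
proof -
  note g' = L2_sum_components[OF g] and h' = L2_sum_components[OF h]
  have [measurable]: "g i \<in> borel_measurable \<mu>" "h i \<in> borel_measurable \<mu>" for i
    using g h by (simp_all add: L2_sum_def)
  have [measurable]: "(\<lambda>\<omega>. cnj (h i \<omega>)) \<in> borel_measurable \<mu>" for i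
    by (rule measurable_compose[of "h i" _ borel])
      (auto intro!: borel_measurable_continuous_onI continuous_on_cnj continuous_on_id)
  have le: "norm (g i \<omega> * cnj (h i \<omega>)) \<le> (cmod (g i \<omega>))\<^sup>2 + (cmod (h i \<omega>))\<^sup>2" for i \<omega>
    using sum_squares_bound[of "cmod (g i \<omega>)" "cmod (h i \<omega>)"]
      zero_le_power2[of "cmod (g i \<omega>)"] zero_le_power2[of "cmod (h i \<omega>)"]
    unfolding norm_mult complex_mod_cnj by linarith
  have dom: "integrable \<mu> (\<lambda>\<omega>. (cmod (g i \<omega>))\<^sup>2 + (cmod (h i \<omega>))\<^sup>2)" for i
    using g'(1) h'(1) by simp
  show int: "integrable \<mu> (\<lambda>\<omega>. g i \<omega> * cnj (h i \<omega>))" for i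
  proof (rule Bochner_Integration.integrable_bound[OF dom[of i]])
    show "AE \<omega> in \<mu>. norm (g i \<omega> * cnj (h i \<omega>)) \<le> norm ((cmod (g i \<omega>))\<^sup>2 + (cmod (h i \<omega>))\<^sup>2)"
      using le by (intro AE_I2) simp
  qed measurable
  show "AE \<omega> in \<mu>. summable (\<lambda>i. norm (g i \<omega> * cnj (h i \<omega>)))"
    using g'(3) h'(3)
  proof eventually_elim
    case (elim \<omega>)
    show ?case
      by (rule summable_comparison_test'[OF summable_add[OF elim]]) (use le in simp)
  qed
  show "summable (\<lambda>i. LINT \<omega>|\<mu>. norm (g i \<omega> * cnj (h i \<omega>)))"
  proof (rule summable_comparison_test'[OF summable_add[OF g'(2) h'(2)]])
    fix i :: nat
    have "(LINT \<omega>|\<mu>. norm (g i \<omega> * cnj (h i \<omega>))) \<le> (LINT \<omega>|\<mu>. (cmod (g i \<omega>))\<^sup>2 + (cmod (h i \<omega>))\<^sup>2)"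
      using int dom le by (intro integral_mono) auto
    then show "norm (LINT \<omega>|\<mu>. norm (g i \<omega> * cnj (h i \<omega>))) \<le>
        (LINT \<omega>|\<mu>. (cmod (g i \<omega>))\<^sup>2) + (LINT \<omega>|\<mu>. (cmod (h i \<omega>))\<^sup>2)"
      using g'(1) h'(1) by simp
  qed
qed

lemma gmra_invariant:
  assumes "gmra_except_intersection \<pi> \<delta> V"
  shows "\<delta> ` (\<Inter>j. V j) \<subseteq> (\<Inter>j. V j)"
proof safe
  fix f j assume "f \<in> (\<Inter>j. V j)"
  then have "f \<in> V (j - 1)" by blast
  moreover have "V (j - 1 + 1) = \<delta> ` V (j - 1)"
    using assms unfolding gmra_except_intersection_def by blast
  ultimately show "\<delta> f \<in> V j" by auto
qed

section \<open>Brackets in \<open>V 0\<close> and their behaviour under dilation\<close>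

locale haar_gmra = haar_dilation \<alpha> \<mu>
  for \<alpha> :: "'g::{ab_group_add,countable} \<Rightarrow> 'g" and \<mu> :: "('g \<Rightarrow> complex) measure" +
  fixes \<pi> :: "'g \<Rightarrow> 'h::complex_hilbert \<Rightarrow> 'h" and \<delta> :: "'h \<Rightarrow> 'h" and V :: "int \<Rightarrow> 'h set"
    and \<sigma> :: "nat \<Rightarrow> ('g \<Rightarrow> complex) set"
    and J :: "'h \<Rightarrow> nat \<Rightarrow> ('g \<Rightarrow> complex) \<Rightarrow> complex"
  assumes rep: "unitary_rep \<pi>" and dilation: "unitary_op \<delta>"
    and commutation: "inv \<delta> (\<pi> a (\<delta> f)) = \<pi> (\<alpha> a) f"
    and gmra: "gmra_except_intersection \<pi> \<delta> V"
    and stone: "stone_data \<pi> (V 0) \<mu> \<sigma> J"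
    and finite_multiplicity: "emeasure \<mu> {\<omega> \<in> space \<mu>. multiplicity_fun \<sigma> \<omega> < \<infinity>} > 0"
begin

definition bracket :: "'h \<Rightarrow> 'h \<Rightarrow> ('g \<Rightarrow> complex) \<Rightarrow> complex" where
  "bracket f g \<omega> = (\<Sum>i. J f i \<omega> * cnj (J g i \<omega>))"

lemma J_L2_sum: "f \<in> V 0 \<Longrightarrow> J f \<in> L2_sum \<mu> \<sigma>"
  using stone by (simp add: stone_data_def unitary_onto_L2_sum_def)

lemma V0_invariant: "f \<in> V 0 \<Longrightarrow> \<pi> a f \<in> V 0"
  using gmra unfolding gmra_except_intersection_def by blast

lemma integrable_bracket:
  assumes "f \<in> V 0" "g \<in> V 0"
  shows "integrable \<mu> (bracket f g)"
  unfolding bracket_def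
  by (rule integrable_suminf) (rule L2_sum_products[OF J_L2_sum J_L2_sum, OF assms])+

lemma integral_bracket:
  assumes "f \<in> V 0" "g \<in> V 0"
  shows "(LINT \<omega>|\<mu>. bracket f g \<omega>) = cinner f g"
proof -
  have "(\<lambda>i. LINT \<omega>|\<mu>. J f i \<omega> * cnj (J g i \<omega>)) sums (LINT \<omega>|\<mu>. bracket f g \<omega>)"
    unfolding bracket_def
    by (rule sums_integral) (rule L2_sum_products[OF J_L2_sum J_L2_sum, OF assms])+
  moreover have "(\<lambda>i. LINT \<omega>|\<mu>. J f i \<omega> * cnj (J g i \<omega>)) sums cinner f g"
    using stone assms by (simp add: stone_data_def unitary_onto_L2_sum_def)
  ultimately show ?thesis by (rule sums_unique2)
qed

text \<open>Under \<open>J\<close> the operator \<open>\<pi> a\<close> becomes multiplication by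
  \<open>\<omega> a\<close>, simultaneously for all components off one null set, and the factor
  comes out of the series wherever that converges absolutely.\<close>

lemma fourier_bracket:
  assumes "f \<in> V 0" "g \<in> V 0"
  shows "(LINT \<omega>|\<mu>. \<omega> a * bracket f g \<omega>) = cinner (\<pi> a f) g"
proof -
  have "AE \<omega> in \<mu>. \<forall>i. J (\<pi> a f) i \<omega> = \<omega> a * J f i \<omega>"
    using stone assms by (subst AE_all_countable) (simp add: stone_data_def)
  moreover note L2_sum_products(2)[OF J_L2_sum J_L2_sum, OF assms]
  ultimately have ae: "AE \<omega> in \<mu>. \<omega> a * bracket f g \<omega> = bracket (\<pi> a f) g \<omega>"
  proof eventually_elim
    case (elim \<omega>)
    have "summable (\<lambda>i. J f i \<omega> * cnj (J g i \<omega>))"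
      using elim(2) by (rule summable_norm_cancel)
    from suminf_mult[OF this, of "\<omega> a"] show ?case
      by (simp add: bracket_def elim(1) mult.assoc)
  qed
  have "bounded_borel (\<lambda>\<omega> :: 'g \<Rightarrow> complex. \<omega> a)"
    by (intro bounded_borel_continuous continuous_on_eval)
  from integrable_bounded_mult[OF this integrable_bracket[OF assms]]
  have "(LINT \<omega>|\<mu>. \<omega> a * bracket f g \<omega>) = (LINT \<omega>|\<mu>. bracket (\<pi> a f) g \<omega>)"
    using ae integrable_bracket[OF V0_invariant assms(2), OF assms(1)]
    by (intro integral_cong_AE) (auto intro: borel_measurable_integrable)
  then show ?thesis using integral_bracket[OF V0_invariant assms(2), OF assms(1)] by simp
qed

lemma rep_dilation_power: "\<pi> a ((\<delta> ^^ n) f) = (\<delta> ^^ n) (\<pi> ((\<alpha> ^^ n) a) f)"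
proof (induction n arbitrary: a)
  case (Suc n)
  have "\<pi> a (\<delta> f) = \<delta> (\<pi> (\<alpha> a) f)" for f
    using commutation[of a f] unitary_opD(5)[OF dilation] by metis
  then show ?case by (simp add: Suc.IH pow_alpha)
qed simp

lemma dilation_power_core:
  assumes "f \<in> (\<Inter>j. V j)"
  shows "(\<delta> ^^ n) f \<in> (\<Inter>j. V j)"
  proof (induction n)
  case 0
  show ?case using assms by simp
next
  case (Suc n)
  have "\<delta> ((\<delta> ^^ n) f) \<in> (\<Inter>j. V j)" by (rule subsetD[OF gmra_invariant[OF gmra] imageI[OF Suc]])
  then show ?case by simp
qed

lemma core_V0: "f \<in> (\<Inter>j. V j) \<Longrightarrow> f \<in> V 0"
  by blast

text \<open>Membership in the intersection keeps every dilate in \<open>V 0\<close>, where brackets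
  have the stated Fourier coefficients; the dilated brackets are then transfers of the original
  one.\<close>

lemma bracket_dilation_tendsto:
  assumes f: "f \<in> (\<Inter>j. V j)" and g: "g \<in> (\<Inter>j. V j)"
  shows "(\<lambda>n. LINT \<omega>|\<mu>. cmod (bracket ((\<delta> ^^ n) f) ((\<delta> ^^ n) g) \<omega> - cinner f g)) \<longlonglongrightarrow> 0"
proof -
  note V0 = core_V0[OF dilation_power_core]
  have "(LINT \<omega>|\<mu>. \<omega> a * bracket ((\<delta> ^^ n) f) ((\<delta> ^^ n) g) \<omega>) =
      (LINT \<omega>|\<mu>. \<omega> ((\<alpha> ^^ n) a) * bracket f g \<omega>)" for n a
    unfolding fourier_bracket[OF V0[OF f] V0[OF g]] fourier_bracket[OF core_V0[OF f] core_V0[OF g]]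
      rep_dilation_power
    by (rule unitary_opD(3)[OF unitary_op_funpow[OF dilation]])
  from transfer_tendsto_L1[OF integrable_bracket[OF core_V0[OF f] core_V0[OF g]]
      integrable_bracket[OF V0[OF f] V0[OF g]] this]
  show ?thesis by (simp add: integral_bracket[OF core_V0[OF f] core_V0[OF g]])
qed

text \<open>The eigenvalue has modulus 1, so the inner product is unchanged when \<open>f\<close> is
  replaced by its dilates. It is then the coefficient at \<open>a\<close> of their bracket minus a
  constant, as the character of \<open>a\<close> integrates to 0, and is bounded by an L^1 norm that
  tends to 0.\<close>

lemma cinner_translate_core:
  assumes f: "f \<in> (\<Inter>j. V j)" "\<delta> f = c *\<^sub>C f" and a: "a \<noteq> 0"
  shows "cinner (\<pi> a f) f = 0"
proof (cases "f = 0")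
  case False
  have "cmod c = 1" by (rule eigenvalue_norm[OF dilation f(2) False])
  have \<delta>n: "(\<delta> ^^ n) f = (c ^ n) *\<^sub>C f" for n
    by (induction n) (simp_all add: f(2) unitary_opD(2)[OF dilation] scaleC_scaleC mult.commute)
  have same: "cinner (\<pi> a f) f = cinner (\<pi> a ((\<delta> ^^ n) f)) ((\<delta> ^^ n) f)" for n
  proof -
    have "unitary_op (\<pi> a)" using rep by (simp add: unitary_rep_def)
    then have "\<pi> a ((\<delta> ^^ n) f) = (c ^ n) *\<^sub>C \<pi> a f" unfolding \<delta>n by (rule unitary_opD(2))
    moreover have "c ^ n * cnj (c ^ n) = 1"
      using \<open>cmod c = 1\<close> complex_norm_square[of "c ^ n"] by (simp add: norm_power)
    ultimately show ?thesis
      by (simp add: \<delta>n cinner_scaleC_left cinner_scaleC_right mult.assoc[symmetric] mult.commute)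
  qed
  have "cmod (cinner (\<pi> a f) f) \<le> (LINT \<omega>|\<mu>. cmod (bracket ((\<delta> ^^ n) f) ((\<delta> ^^ n) f) \<omega> - cinner f f))"
    for n
  proof -
    let ?f = "(\<delta> ^^ n) f"
    have V0: "?f \<in> V 0" by (rule core_V0[OF dilation_power_core[OF f(1)]])
    have char: "bounded_borel (\<lambda>\<omega> :: 'g \<Rightarrow> complex. \<omega> a)"
      by (intro bounded_borel_continuous continuous_on_eval)
    have int: "integrable \<mu> (\<lambda>\<omega>. bracket ?f ?f \<omega> - cinner f f)"
      using integrable_bracket[OF V0 V0] by simp
    have "(LINT \<omega>|\<mu>. \<omega> a * (bracket ?f ?f \<omega> - cinner f f)) = cinner (\<pi> a f) f"
      using integrable_bounded_mult[OF char integrable_bracket[OF V0 V0]] integrable_bounded_borel[OF char]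
      by (simp add: right_diff_distrib fourier_bracket[OF V0 V0] integral_character a same[of n])
    then show ?thesis
      using integral_bounded_mult_le[OF char _ int] by (simp add: dual_groupD)
  qed
  then have "cmod (cinner (\<pi> a f) f) \<le> 0"
    by (intro LIMSEQ_le_const[OF bracket_dilation_tendsto[OF f(1) f(1)]]) blast
  then show ?thesis by simp
qed simp

text \<open>If all these complements were null, almost every point would lie in every
  \<open>\<sigma> k\<close> and have infinite multiplicity. As indices start at 0 and
  \<open>\<sigma>\<close> decreases, a point off \<open>\<sigma> k\<close> has multiplicity at most
  \<open>k\<close>.\<close>

lemma multiplicity_level:
  "\<exists>k. space \<mu> - \<sigma> k \<in> sets \<mu> \<and> measure \<mu> (space \<mu> - \<sigma> k) > 0"
proof -
  have \<sigma>: "space \<mu> - \<sigma> k \<in> sets \<mu>" for k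
    using stone by (auto simp: stone_data_def)
  have "\<exists>k. emeasure \<mu> (space \<mu> - \<sigma> k) \<noteq> 0"
  proof (rule ccontr)
    assume "\<not> ?thesis"
    then have null: "emeasure \<mu> (\<Union>k. space \<mu> - \<sigma> k) = 0"
      using \<sigma> by (intro emeasure_UN_eq_0) auto
    have sub: "{\<omega> \<in> space \<mu>. multiplicity_fun \<sigma> \<omega> < \<infinity>} \<subseteq> (\<Union>k. space \<mu> - \<sigma> k)"
    proof (rule subsetI, rule ccontr)
      fix \<omega> assume "\<omega> \<in> {\<omega> \<in> space \<mu>. multiplicity_fun \<sigma> \<omega> < \<infinity>}"
        and "\<omega> \<notin> (\<Union>k. space \<mu> - \<sigma> k)"
      then have \<omega>: "\<omega> \<in> space \<mu>" "multiplicity_fun \<sigma> \<omega> < \<infinity>" "\<And>k. \<omega> \<in> \<sigma> k" by auto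
      obtain n where n: "multiplicity_fun \<sigma> \<omega> < of_nat n"
        using ennreal_Ex_less_of_nat[of "multiplicity_fun \<sigma> \<omega>"] \<omega>(2) by auto
      have "(of_nat n :: ennreal) = (\<Sum>i<n. indicator (\<sigma> i) \<omega>)" using \<omega>(1,3) by simp
      also have "\<dots> \<le> multiplicity_fun \<sigma> \<omega>"
        unfolding multiplicity_fun_def by (intro sum_le_suminf) auto
      finally show False using n by simp
    qed
    have "(\<Union>k. space \<mu> - \<sigma> k) \<in> sets \<mu>" by (intro sets.countable_UN'' \<sigma>) simp
    from emeasure_mono[OF sub this] show False using finite_multiplicity unfolding null by simp
  qed
  then obtain k where "emeasure \<mu> (space \<mu> - \<sigma> k) \<noteq> 0" by blast
  then have "measure \<mu> (space \<mu> - \<sigma> k) > 0"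
    by (simp add: emeasure_eq_measure zero_less_measure_iff)
  then show ?thesis using \<sigma> by blast
qed

text \<open>The sets decrease and components are extended by zero, so off \<open>\<sigma> k\<close>
  all terms with index at least \<open>k\<close> vanish.\<close>

lemma bracket_level:
  assumes "f \<in> V 0" "\<omega> \<notin> \<sigma> k"
  shows "bracket f g \<omega> = (\<Sum>i<k. J f i \<omega> * cnj (J g i \<omega>))"
  unfolding bracket_def
proof (rule suminf_finite)
  fix i assume "i \<notin> {..<k}"
  moreover have "decseq \<sigma>" using stone by (simp add: stone_data_def)
  ultimately have "\<sigma> i \<subseteq> \<sigma> k" by (auto dest!: decseqD[where i = k and j = i])
  then show "J f i \<omega> * cnj (J g i \<omega>) = 0"
    using J_L2_sum[OF assms(1)] assms(2) by (auto simp: L2_sum_def)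
qed simp

text \<open>
  On the complement of \<open>\<sigma> k\<close> the Gram matrices of brackets have rank at most \<open>k\<close>, while they
  converge to the identity matrix in \<open>L\<^sup>1\<close> along the dilates of an orthonormal family.
\<close>

lemma core_dimension_le:
  assumes k: "space \<mu> - \<sigma> k \<in> sets \<mu>" "measure \<mu> (space \<mu> - \<sigma> k) > 0"
    and e: "\<And>i. i < Suc k \<Longrightarrow> e i \<in> (\<Inter>j. V j)"
  shows "\<not> orthonormal_family e {..<Suc k}"
proof
  assume "orthonormal_family e {..<Suc k}"
  then have ortho: "cinner (e p) (e q) = (if p = q then 1 else 0)" if "p < Suc k" "q < Suc k" for p q
    using that by (simp add: orthonormal_family_def)
  define B where "B n p q = bracket ((\<delta> ^^ n) (e p)) ((\<delta> ^^ n) (e q))" for n p q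
  \<comment> \<open>Adding up the deviations of all entries lets a single point control the whole
    matrix.\<close>
  define S where "S n \<omega> = (\<Sum>p<Suc k. \<Sum>q<Suc k. cmod (B n p q \<omega> - cinner (e p) (e q)))" for n \<omega>
  let ?E = "space \<mu> - \<sigma> k"
  have V0: "(\<delta> ^^ n) (e p) \<in> V 0" if "p < Suc k" for n p
    by (rule core_V0[OF dilation_power_core[OF e[OF that]]])
  have int: "integrable \<mu> (\<lambda>\<omega>. cmod (B n p q \<omega> - cinner (e p) (e q)))" if "p < Suc k" "q < Suc k" for n p q
    unfolding B_def using integrable_bracket[OF V0 V0, OF that] by simp
  have intS: "integrable \<mu> (S n)" for n
    unfolding S_def by (intro Bochner_Integration.integrable_sum int) auto
  have "(\<lambda>n. \<Sum>p<Suc k. \<Sum>q<Suc k. LINT \<omega>|\<mu>. cmod (B n p q \<omega> - cinner (e p) (e q))) \<longlonglongrightarrow>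
      (\<Sum>p<Suc k. \<Sum>q<Suc k. 0)"
    unfolding B_def by (intro tendsto_sum bracket_dilation_tendsto e) auto
  moreover have "(LINT \<omega>|\<mu>. S n \<omega>) =
      (\<Sum>p<Suc k. \<Sum>q<Suc k. LINT \<omega>|\<mu>. cmod (B n p q \<omega> - cinner (e p) (e q)))" for n
  proof -
    have "(LINT \<omega>|\<mu>. S n \<omega>) =
        (\<Sum>p<Suc k. LINT \<omega>|\<mu>. (\<Sum>q<Suc k. cmod (B n p q \<omega> - cinner (e p) (e q))))"
      unfolding S_def by (intro Bochner_Integration.integral_sum Bochner_Integration.integrable_sum int) auto
    also have "\<dots> = (\<Sum>p<Suc k. \<Sum>q<Suc k. LINT \<omega>|\<mu>. cmod (B n p q \<omega> - cinner (e p) (e q)))"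
      by (intro sum.cong refl Bochner_Integration.integral_sum int) auto
    finally show ?thesis .
  qed
  ultimately have lim: "(\<lambda>n. LINT \<omega>|\<mu>. S n \<omega>) \<longlonglongrightarrow> 0" by simp
  \<comment> \<open>If \<open>S n\<close> were at least \<open>\<epsilon>\<close> throughout
    \<open>?E\<close> for every \<open>n\<close>, its integral would stay above the positive number
    \<open>\<epsilon> * measure \<mu> ?E\<close>, against the limit 0.\<close>
  have ex: "\<exists>n \<omega>. \<omega> \<in> ?E \<and> S n \<omega> < \<epsilon>" if "\<epsilon> > 0" for \<epsilon>
  proof (rule ccontr)
    assume contra: "\<not> ?thesis"
    have "\<epsilon> * measure \<mu> ?E > 0" using that k(2) by simp
    then obtain n where n: "(LINT \<omega>|\<mu>. S n \<omega>) < \<epsilon> * measure \<mu> ?E"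
      using eventually_happens[OF order_tendstoD(2)[OF lim]] by auto
    have "\<epsilon> * measure \<mu> ?E = (LINT \<omega>|\<mu>. \<epsilon> * indicator ?E \<omega>)"
      using k(1) by simp
    also have "\<dots> \<le> (LINT \<omega>|\<mu>. S n \<omega>)"
    proof (rule integral_mono)
      show "integrable \<mu> (\<lambda>\<omega>. \<epsilon> * indicator ?E \<omega>)"
        using k(1) by (simp add: emeasure_eq_measure)
      show "\<epsilon> * indicator ?E \<omega> \<le> S n \<omega>" if "\<omega> \<in> space \<mu>" for \<omega>
      proof (cases "\<omega> \<in> ?E")
        case True
        then show ?thesis using contra by (auto simp: not_less)
      next
        case False
        have "0 \<le> S n \<omega>" unfolding S_def by (intro sum_nonneg) auto
        then show ?thesis using False by simp
      qed
    qed (rule intS)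
    finally show False using n by simp
  qed
  \<comment> \<open>The point varies with \<open>m\<close> as well as the exponent; each point lies
    off \<open>\<sigma> k\<close>, where the rank bound holds.\<close>
  have "\<forall>m. \<exists>n \<omega>. \<omega> \<in> ?E \<and> S n \<omega> < inverse (real (Suc m))"
    by (intro allI ex) simp
  then obtain n w where w: "\<And>m. w m \<in> ?E" and S: "\<And>m. S (n m) (w m) < inverse (real (Suc m))"
    by metis
  define G where "G m p q = B (n m) p q (w m)" for m p q
  have G: "(\<lambda>m. G m p q) \<longlonglongrightarrow> (if p = q then 1 else 0)" if pq: "p < Suc k" "q < Suc k" for p q
  proof -
    have "cmod (G m p q - cinner (e p) (e q)) \<le> inverse (real (Suc m))" for m
    proof -
      have "cmod (G m p q - cinner (e p) (e q)) \<le>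
          (\<Sum>q<Suc k. cmod (G m p q - cinner (e p) (e q)))"
        using pq(2) by (intro member_le_sum[of q "{..<Suc k}"]) auto
      also have "\<dots> \<le> (\<Sum>p<Suc k. \<Sum>q<Suc k. cmod (G m p q - cinner (e p) (e q)))"
        using pq(1) by (intro member_le_sum[of p "{..<Suc k}" "\<lambda>p. \<Sum>q<Suc k. cmod (G m p q - cinner (e p) (e q))"]
            sum_nonneg) auto
      also have "\<dots> = S (n m) (w m)" by (simp only: G_def S_def)
      finally show ?thesis using S[of m] by linarith
    qed
    then have "(\<lambda>m. G m p q - cinner (e p) (e q)) \<longlonglongrightarrow> 0"
      by (intro Lim_null_comparison[OF always_eventually LIMSEQ_inverse_real_of_nat]) blast
    then show ?thesis using ortho[OF pq] by (simp add: LIM_zero_iff)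
  qed
  have le: "(cmod (\<Sum>p<Suc k. G m p p))\<^sup>2 \<le> real k * (\<Sum>p<Suc k. \<Sum>q<Suc k. (cmod (G m p q))\<^sup>2)" for m
  proof -
    let ?x = "\<lambda>p i. J ((\<delta> ^^ n m) (e p)) i (w m)"
    have G_eq: "G m p q = (\<Sum>i<k. ?x p i * cnj (?x q i))" if "p < Suc k" for p q
      unfolding G_def B_def using w[of m] by (intro bracket_level V0 that) auto
    have "(\<Sum>p<Suc k. G m p p) = (\<Sum>p<Suc k. \<Sum>i<k. ?x p i * cnj (?x p i))"
      by (intro sum.cong refl G_eq) simp
    moreover have "(\<Sum>p<Suc k. \<Sum>q<Suc k. (cmod (G m p q))\<^sup>2) =
        (\<Sum>p<Suc k. \<Sum>q<Suc k. (cmod (\<Sum>i<k. ?x p i * cnj (?x q i)))\<^sup>2)"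
      by (intro sum.cong refl) (simp add: G_eq)
    ultimately show ?thesis using gram_trace_le[of ?x k "{..<Suc k}"] by (simp only:)
  qed
  \<comment> \<open>In the limit the Gram matrix is the identity of size \<open>Suc k\<close>. Its
    trace and its sum of squared entries both equal \<open>Suc k\<close>, so the inequality becomes
    (k+1)^2 \<le> k(k+1).\<close>
  have "(\<lambda>m. (cmod (\<Sum>p<Suc k. G m p p))\<^sup>2) \<longlonglongrightarrow> (cmod (\<Sum>p<Suc k. if p = p then 1 else 0))\<^sup>2"
    by (intro tendsto_power tendsto_norm tendsto_sum G) auto
  moreover have "(\<lambda>m. real k * (\<Sum>p<Suc k. \<Sum>q<Suc k. (cmod (G m p q))\<^sup>2)) \<longlonglongrightarrow>
      real k * (\<Sum>p<Suc k. \<Sum>q<Suc k. (cmod (if p = q then 1 else 0))\<^sup>2)"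
    by (intro tendsto_mult tendsto_const tendsto_power tendsto_norm tendsto_sum G) auto
  ultimately have "(cmod (\<Sum>p<Suc k. if p = p then 1 else 0))\<^sup>2 \<le>
      real k * (\<Sum>p<Suc k. \<Sum>q<Suc k. (cmod (if p = q then 1 else 0))\<^sup>2)"
    by (rule LIMSEQ_le) (use le in blast)
  moreover have "(cmod (\<Sum>p<Suc k. if p = p then 1 else 0))\<^sup>2 = (real (Suc k))\<^sup>2"
    unfolding simp_thms if_True sum_constant card_lessThan mult_1_right norm_of_nat ..
  moreover have "(\<Sum>p<Suc k. \<Sum>q<Suc k. (cmod (if p = q then 1 else 0))\<^sup>2) = (\<Sum>p<Suc k. 1)"
  proof (rule sum.cong[OF refl])
    fix p assume "p \<in> {..<Suc k}"
    then have p: "p < Suc k" by simp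
    have "(\<Sum>q<Suc k. (cmod (if p = q then 1 else 0))\<^sup>2) = (\<Sum>q<Suc k. if p = q then 1 else 0)"
      by (intro sum.cong) auto
    also have "\<dots> = 1" using p by (subst sum.delta') auto
    finally show "(\<Sum>q<Suc k. (cmod (if p = q then 1 else 0))\<^sup>2) = 1" .
  qed
  ultimately have "(real (Suc k))\<^sup>2 \<le> real k * (\<Sum>p<Suc k. 1)" by (simp only:)
  then have "(real (Suc k))\<^sup>2 \<le> real k * real (Suc k)" by simp
  then show False by (simp add: power2_eq_square algebra_simps)
qed

lemma eigenvector_if_core:
  assumes "(\<Inter>j. V j) \<noteq> {0}"
  shows "\<exists>f. is_eigenvector \<delta> f"
proof -
  obtain k where k: "space \<mu> - \<sigma> k \<in> sets \<mu>" "measure \<mu> (space \<mu> - \<sigma> k) > 0"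
    using multiplicity_level by blast
  have "closed_csubspace (V j)" for j
    using gmra unfolding gmra_except_intersection_def by blast
  then have core: "closed_csubspace (\<Inter>j. V j)"
    unfolding closed_csubspace_def by (auto intro!: closed_INT)
  show ?thesis
    by (rule eigenvector_if_bounded_dimension[OF dilation core gmra_invariant[OF gmra] assms])
      (rule core_dimension_le[OF k])
qed

end

section \<open>Eigenvectors and the representation of the semidirect product\<close>

lemma unitary_rep_zero:
  assumes "unitary_rep \<pi>"
  shows "\<pi> 0 f = f"
proof -
  have "unitary_op (\<pi> 0)" "\<pi> (0 + 0) = \<pi> 0 \<circ> \<pi> 0"
    using assms by (simp_all only: unitary_rep_def)
  then have "\<pi> 0 (\<pi> 0 f) = \<pi> 0 f" by (simp add: fun_eq_iff)
  then show ?thesis using unitary_opD(4)[OF \<open>unitary_op (\<pi> 0)\<close>] by metis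
qed

lemma op_power_eigenvector:
  assumes U: "unitary_op U" and f: "U f = c *\<^sub>C f" and c: "c \<noteq> 0"
  shows "op_power U j f = (c powi j) *\<^sub>C f"
proof -
  have pos: "(U ^^ n) f = (c ^ n) *\<^sub>C f" for n
    by (induction n) (simp_all add: f unitary_opD(2)[OF U] scaleC_scaleC mult.commute)
  have "f = inverse c *\<^sub>C U f" using c by (simp add: f scaleC_scaleC)
  then have "inv U f = inverse c *\<^sub>C inv U (U f)"
    using unitary_opD(2)[OF unitary_op_inv[OF U]] by metis
  then have inv: "inv U f = inverse c *\<^sub>C f" by (simp add: unitary_opD(4)[OF U])
  have neg: "(inv U ^^ n) f = (inverse c ^ n) *\<^sub>C f" for n
    by (induction n) (simp_all add: inv unitary_opD(2)[OF unitary_op_inv[OF U]] scaleC_scaleC mult.commute)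
  show ?thesis by (simp add: op_power_def pos neg power_int_def)
qed

text \<open>This holds for arbitrary indices, also outside the group: whichever pair the choice
  operator returns, the operator is a composition of unitaries.\<close>

lemma unitary_op_tilde_rep:
  assumes "unitary_rep \<pi>" "unitary_op \<delta>"
  shows "unitary_op (tilde_rep \<pi> \<delta> x)"
proof -
  obtain a k where "(SOME p. p \<in> fst x) = (a, k)" by (metis surj_pair)
  then show ?thesis
    using assms unfolding tilde_rep_def unitary_rep_def
    by (simp add: unitary_op_comp unitary_op_op_power)
qed

lemma gmra_subset:
  assumes "gmra_except_intersection \<pi> \<delta> V"
  shows "V j \<subseteq> V (j + int n)"
proof (induction n)
  case (Suc n)
  have "V (j + int n) \<subseteq> V (j + int n + 1)"
    using assms unfolding gmra_except_intersection_def by blast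
  then show ?case using Suc.IH by (simp add: add.assoc add.commute[of 1])
qed simp

text \<open>Approximants are carried downwards: if y = \<delta> x, then c x lies one level lower and
  is as far from \<open>f\<close> as y is, since \<open>\<delta>\<close> is isometric and |c| = 1.
  So \<open>f\<close> is approximated from every \<open>V j\<close>, which is closed.\<close>

lemma eigenvector_in_core:
  assumes gmra: "gmra_except_intersection \<pi> \<delta> V" and \<delta>: "unitary_op \<delta>"
    and f: "\<delta> f = c *\<^sub>C f" "f \<noteq> 0"
  shows "f \<in> (\<Inter>j. V j)"
proof
  fix j
  have c: "cmod c = 1" by (rule eigenvalue_norm[OF \<delta> f])
  have sub: "closed_csubspace (V i)" "V (i + 1) = \<delta> ` V i" for i
    using gmra unfolding gmra_except_intersection_def by blast+
  have descend: "\<exists>x\<in>V j. dist x f = dist y f" if "y \<in> V (j + int n)" for y n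
    using that
  proof (induction n arbitrary: y)
    case 0
    then show ?case by auto
  next
    case (Suc n)
    have "V (j + int (Suc n)) = \<delta> ` V (j + int n)"
      using sub(2)[of "j + int n"] by (simp add: add.assoc add.commute[of 1])
    then obtain x where x: "x \<in> V (j + int n)" "y = \<delta> x" using Suc.prems by blast
    have "c *\<^sub>C y - c *\<^sub>C f = c *\<^sub>C (y - f)"
      using scaleC_add_right[of c "y - f" f] by simp
    moreover have "\<delta> (c *\<^sub>C x - f) = c *\<^sub>C y - c *\<^sub>C f"
      by (simp add: unitary_op_diff[OF \<delta>] unitary_opD(2)[OF \<delta>] x(2) f(1))
    ultimately have "norm (\<delta> (c *\<^sub>C x - f)) = norm (y - f)" by (simp add: norm_scaleC c)
    then have "dist (c *\<^sub>C x) f = dist y f" by (simp add: dist_norm norm_unitary_op[OF \<delta>])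
    moreover have "c *\<^sub>C x \<in> V (j + int n)" by (rule closed_csubspace_scaleC[OF sub(1) x(1)])
    ultimately show ?case using Suc.IH by metis
  qed
  have "f \<in> closure (V j)"
    unfolding closure_approachable
  proof (intro allI impI)
    fix \<epsilon> :: real assume "\<epsilon> > 0"
    moreover have "f \<in> closure (\<Union>j. V j)"
      using gmra unfolding gmra_except_intersection_def by blast
    ultimately obtain i y where y: "y \<in> V i" "dist y f < \<epsilon>"
      unfolding closure_approachable by blast
    show "\<exists>x\<in>V j. dist x f < \<epsilon>"
    proof (cases "i \<le> j")
      case True
      then have "y \<in> V j" using gmra_subset[OF gmra, of i "nat (j - i)"] y(1) by auto
      then show ?thesis using y(2) by blast
    next
      case False
      then have "y \<in> V (j + int (nat (i - j)))" using y(1) by simp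
      then obtain x where "x \<in> V j" "dist x f = dist y f" using descend by blast
      then show ?thesis using y(2) by (intro bexI[of _ x]) simp_all
    qed
  qed
  then show "f \<in> V j" using sub(1)[of j] by (simp add: closed_csubspace_def)
qed

section \<open>Arithmetic in the direct limit group\<close>

context dilation_endomorphism
begin

lemma dl_alpha_power_inverse:
  assumes "d \<in> dl_carrier \<alpha>"
  shows "dl_alpha_power \<alpha> j (dl_alpha_power \<alpha> (- j) d) = d"
proof -
  obtain a k where d: "d = dl_class \<alpha> a k" using assms by (rule dl_carrierE)
  show ?thesis
  proof (cases "0 \<le> j")
    case True
    then obtain n where "j = int n" by (metis nonneg_int_cases)
    then show ?thesis by (simp add: d dl_alpha_power_class dl_class_eq_iff pow_pow)
  next
    case False
    then obtain n where "j = - int n" by (metis int_cases2 of_nat_0_le_iff)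
    then show ?thesis by (simp add: d dl_alpha_power_class dl_class_eq_iff pow_pow)
  qed
qed

lemma dl_alpha_power_in_carrier:
  assumes "d \<in> dl_carrier \<alpha>"
  shows "dl_alpha_power \<alpha> j d \<in> dl_carrier \<alpha>"
proof -
  obtain a k where d: "d = dl_class \<alpha> a k" using assms by (rule dl_carrierE)
  show ?thesis
    by (cases j rule: int_cases2) (simp_all add: d dl_alpha_power_class)
qed

lemma dl_add_in_carrier: "d \<in> dl_carrier \<alpha> \<Longrightarrow> d' \<in> dl_carrier \<alpha> \<Longrightarrow> dl_add \<alpha> d d' \<in> dl_carrier \<alpha>"
  by (elim dl_carrierE) (simp add: dl_add_class)

lemma dl_diff_in_carrier: "d \<in> dl_carrier \<alpha> \<Longrightarrow> d' \<in> dl_carrier \<alpha> \<Longrightarrow> dl_diff \<alpha> d d' \<in> dl_carrier \<alpha>"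
  by (elim dl_carrierE) (simp add: dl_diff_def dl_add_class dl_uminus_class)

lemma pow_diff: "(\<alpha> ^^ n) (x - y) = (\<alpha> ^^ n) x - (\<alpha> ^^ n) y"
  using pow_hom[of n x "- y"] by (simp add: pow_uminus)

lemma dl_add_diff:
  "d \<in> dl_carrier \<alpha> \<Longrightarrow> d' \<in> dl_carrier \<alpha> \<Longrightarrow> dl_add \<alpha> d (dl_diff \<alpha> d' d) = d'"
  by (elim dl_carrierE)
    (simp add: dl_diff_def dl_add_class dl_uminus_class dl_class_eq_iff pow_hom pow_diff pow_uminus pow_pow ac_simps)

text \<open>With a common denominator, the vectors attached to two classes carry the same power of
  \<open>\<delta>\<close>, which cancels in their inner product.\<close>

lemma dl_common_denominator:
  assumes "d \<in> dl_carrier \<alpha>" "d' \<in> dl_carrier \<alpha>"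
  obtains a b k where "d = dl_class \<alpha> a k" "d' = dl_class \<alpha> b k"
proof -
  obtain a k where d: "d = dl_class \<alpha> a k" using assms(1) by (rule dl_carrierE)
  obtain b l where d': "d' = dl_class \<alpha> b l" using assms(2) by (rule dl_carrierE)
  have "d = dl_class \<alpha> ((\<alpha> ^^ l) a) (k + l)" "d' = dl_class \<alpha> ((\<alpha> ^^ k) b) (k + l)"
    by (simp_all add: d d' dl_class_eq_iff pow_pow add.commute)
  then show thesis by (rule that)
qed

end

section \<open>Passage between eigenvectors and subrepresentations\<close>

context haar_gmra
begin

lemma tilde_rep_dl_class:
  "tilde_rep \<pi> \<delta> (dl_class \<alpha> a k, j) f = op_power \<delta> (int k) (\<pi> a (op_power \<delta> (- int k - j) f))"
  by (rule tilde_rep_class) (rule unitary_op_bij[OF dilation] commutation)+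

text \<open>The group permutes the orthonormal vectors \<open>e d\<close> up to the scalar
  \<open>c powi (- j)\<close>, in the way it acts on the unit vectors of \<open>l2\<close>; taking
  coefficients is therefore an intertwining unitary.\<close>

lemma subrep_if_eigenvector:
  assumes "is_eigenvector \<delta> g"
  shows "\<exists>z. cmod z = 1 \<and> contains_subrep_equivalent_to (G_carrier \<alpha>) (tilde_rep \<pi> \<delta>)
    (dl_carrier \<alpha>) (P_rep \<alpha> z)"
proof -
  obtain c where g: "g \<noteq> 0" "\<delta> g = c *\<^sub>C g" using assms by (auto simp: is_eigenvector_def)
  define f where "f = complex_of_real (inverse (norm g)) *\<^sub>C g"
  have norm_f: "norm f = 1" using g(1) by (simp add: f_def norm_scaleC norm_inverse)
  then have f0: "f \<noteq> 0" by auto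
  have \<delta>f: "\<delta> f = c *\<^sub>C f"
    by (simp add: f_def unitary_opD(2)[OF dilation] g(2) scaleC_scaleC mult.commute)
  have c: "cmod c = 1" by (rule eigenvalue_norm[OF dilation \<delta>f f0])
  then have c0: "c \<noteq> 0" by auto
  have core: "f \<in> (\<Inter>j. V j)" by (rule eigenvector_in_core[OF gmra dilation \<delta>f f0])
  note pow = op_power_eigenvector[OF dilation \<delta>f c0]
  have \<pi>: "unitary_op (\<pi> a)" "\<pi> (a + b) = \<pi> a \<circ> \<pi> b" for a b
    using rep by (simp_all add: unitary_rep_def)
  note lin = unitary_opD(2)[OF \<pi>(1)] unitary_opD(2)[OF unitary_op_op_power[OF dilation]]
  let ?\<rho> = "tilde_rep \<pi> \<delta>" and ?D = "dl_carrier \<alpha>"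
  define e where "e d = ?\<rho> (d, 0) f" for d
  have e_class: "e (dl_class \<alpha> a k) = (c powi (- int k)) *\<^sub>C op_power \<delta> (int k) (\<pi> a f)" for a k
    by (simp add: e_def tilde_rep_dl_class pow lin)
  have rep_f: "?\<rho> (d, j) f = (c powi (- j)) *\<^sub>C e d" if dD: "d \<in> ?D" for d j
  proof -
    obtain a k where d: "d = dl_class \<alpha> a k" using dD by (rule dl_carrierE)
    have "c powi (- int k - j) = c powi (- j) * c powi (- int k)"
    proof -
      have "- int k - j = - j + (- int k)" by simp
      then show ?thesis by (simp only: power_int_add c0 simp_thms)
    qed
    then show ?thesis unfolding d e_class by (simp add: tilde_rep_dl_class pow lin scaleC_scaleC)
  qed
  have unit: "cinner f f = 1" by (simp add: cinner_self norm_f)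
  interpret orthonormal_family e ?D
  proof
    fix d d' assume "d \<in> ?D" "d' \<in> ?D"
    then obtain a b k where d: "d = dl_class \<alpha> a k" "d' = dl_class \<alpha> b k"
      by (rule dl_common_denominator)
    have "c powi (- int k) * cnj (c powi (- int k)) = 1"
      using complex_norm_square[of "c powi (- int k)"] by (simp add: norm_power_int c)
    then have "cinner (e d) (e d') = cinner (\<pi> a f) (\<pi> b f)"
      by (simp add: d e_class cinner_scaleC_left cinner_scaleC_right mult.assoc[symmetric] mult.commute
          unitary_opD(3)[OF unitary_op_op_power[OF dilation]])
    also have "\<dots> = cinner (\<pi> b (\<pi> (a - b) f)) (\<pi> b f)"
      using \<pi>(2)[of b "a - b"] by (simp add: fun_eq_iff)
    also have "\<dots> = cinner (\<pi> (a - b) f) f" by (rule unitary_opD(3)[OF \<pi>(1)])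
    also have "\<dots> = (if a = b then 1 else 0)"
      using cinner_translate_core[OF core \<delta>f, of "a - b"] unitary_rep_zero[OF rep] unit by simp
    also have "a = b \<longleftrightarrow> d = d'" by (simp add: d dl_class_eq_iff)
    finally show "cinner (e d) (e d') = (if d = d' then 1 else 0)" .
  qed
  have rep_e: "?\<rho> (d, j) (e d') = (c powi (- j)) *\<^sub>C e (dl_add \<alpha> d (dl_alpha_power \<alpha> j d'))"
    if "d \<in> ?D" "d' \<in> ?D" for d d' j
  proof -
    \<comment> \<open>Since \<open>e d'\<close> is itself a translate of \<open>f\<close>, the
      action on it is a product in the group applied to \<open>f\<close>.\<close>
    have "?\<rho> (d, j) (e d') = ?\<rho> (G_mult \<alpha> (d, j) (d', 0)) f"
      unfolding e_def
      by (rule tilde_rep_mult[OF unitary_op_bij[OF dilation] commutation \<pi>(2), symmetric])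
        (simp_all add: G_carrier_def that)
    also have "G_mult \<alpha> (d, j) (d', 0) = (dl_add \<alpha> d (dl_alpha_power \<alpha> j d'), j)"
      by (simp add: G_mult_def)
    finally show ?thesis
      using rep_f[OF dl_add_in_carrier[OF that(1) dl_alpha_power_in_carrier[OF that(2)]]] by simp
  qed
  show ?thesis
    unfolding contains_subrep_equivalent_to_def
  \<comment> \<open>Coefficients pair with \<open>e\<close> in the conjugate-linear argument, so the
    conjugate of the eigenvalue appears; it is its inverse, the modulus being 1.\<close>
  proof (intro exI[of _ "cnj c"] exI[of _ closed_span] exI[of _ coefficients] conjI ballI)
    show "cmod (cnj c) = 1" by (simp add: c)
    show "closed_csubspace closed_span" by (rule closed_csubspace_closed_span)
    show "unitary_onto_l2 closed_span ?D coefficients" by (rule unitary_coefficients)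
  next
    fix x assume x: "x \<in> G_carrier \<alpha>"
    obtain d j where dj: "x = (d, j)" "d \<in> ?D" using x by (auto simp: G_carrier_def)
    show "?\<rho> x ` closed_span \<subseteq> closed_span"
      using rep_e[OF dj(2), of _ j] dl_add_in_carrier[OF dj(2) dl_alpha_power_in_carrier, of _ j]
      unfolding dj(1) by (intro unitary_maps_closed_span unitary_op_tilde_rep rep dilation) blast
    fix w assume "w \<in> closed_span"
    show "coefficients (?\<rho> x w) = P_rep \<alpha> (cnj c) x (coefficients w)"
    proof
      fix d'
      show "coefficients (?\<rho> x w) d' = P_rep \<alpha> (cnj c) x (coefficients w) d'"
      proof (cases "d' \<in> ?D")
        case True
        \<comment> \<open>The element that the action of \<open>(d, j)\<close> moves to
          \<open>d'\<close>.\<close>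
        let ?d0 = "dl_alpha_power \<alpha> (- j) (dl_diff \<alpha> d' d)"
        have diff: "dl_diff \<alpha> d' d \<in> ?D" by (rule dl_diff_in_carrier[OF True dj(2)])
        then have d0: "?d0 \<in> ?D" by (rule dl_alpha_power_in_carrier)
        have "dl_add \<alpha> d (dl_alpha_power \<alpha> j ?d0) = d'"
          unfolding dl_alpha_power_inverse[OF diff] by (rule dl_add_diff[OF dj(2) True])
        then have "?\<rho> x (e ?d0) = (c powi (- j)) *\<^sub>C e d'" using rep_e[OF dj(2) d0, of j] dj(1) by simp
        then have "e d' = (c powi j) *\<^sub>C ?\<rho> x (e ?d0)"
          using c0 by (simp add: scaleC_scaleC power_int_add[symmetric])
        then have "cinner (?\<rho> x w) (e d') = cnj (c powi j) * cinner w (e ?d0)"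
          by (simp add: cinner_scaleC_right unitary_opD(3)[OF unitary_op_tilde_rep[OF rep dilation]])
        then show ?thesis using True d0 by (simp add: coefficients_def P_rep_def dj(1))
      qed (simp add: coefficients_def P_rep_def)
    qed
  qed
qed

lemma eigenvector_if_subrep:
  assumes "cmod z = 1"
    and "contains_subrep_equivalent_to (G_carrier \<alpha>) (tilde_rep \<pi> \<delta>) (dl_carrier \<alpha>) (P_rep \<alpha> z)"
  shows "\<exists>f. is_eigenvector \<delta> f"
proof -
  let ?\<rho> = "tilde_rep \<pi> \<delta>" and ?D = "dl_carrier \<alpha>"
  define u where "u = dl_class \<alpha> 0 0"
  define g where "g d = (if d = u then 1 else 0 :: complex)" for d
  have uD: "u \<in> ?D" by (simp add: u_def)
  obtain W U where W: "closed_csubspace W" "\<And>x. x \<in> G_carrier \<alpha> \<Longrightarrow> ?\<rho> x ` W \<subseteq> W"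
    and UW: "unitary_onto_l2 W ?D U" and inter: "\<And>x w. x \<in> G_carrier \<alpha> \<Longrightarrow> w \<in> W \<Longrightarrow> U (?\<rho> x w) = P_rep \<alpha> z x (U w)"
    using assms(2) unfolding contains_subrep_equivalent_to_def by metis
  have U: "U ` W = l2 ?D" "\<And>v w d. v \<in> W \<Longrightarrow> w \<in> W \<Longrightarrow> U (v + w) d = U v d + U w d"
    "\<And>c v d. v \<in> W \<Longrightarrow> U (c *\<^sub>C v) d = c * U v d"
    "\<And>v w. v \<in> W \<Longrightarrow> w \<in> W \<Longrightarrow> (\<Sum>\<^sub>\<infinity>d\<in>?D. U v d * cnj (U w d)) = cinner v w"
    using UW unfolding unitary_onto_l2_def by blast+
  have "(\<lambda>d. (cmod (g d))\<^sup>2) summable_on ?D"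
    by (rule finite_nonzero_values_imp_summable_on) (simp add: g_def)
  then have "g \<in> l2 ?D" using uD by (auto simp: l2_def g_def)
  then have "g \<in> U ` W" by (simp only: U(1))
  then obtain w where w: "w \<in> W" "U w = g" by blast
  have x: "(u, 1) \<in> G_carrier \<alpha>" using uD by (simp add: G_carrier_def)
  have P: "P_rep \<alpha> z (u, 1) g d = z * g d" for d
  proof (cases "d \<in> ?D")
    case True
    then obtain a k where d: "d = dl_class \<alpha> a k" by (rule dl_carrierE)
    have "dl_alpha_power \<alpha> (- 1) (dl_diff \<alpha> d u) = dl_class \<alpha> a (k + 1)"
      using dl_alpha_power_class(2)[of 1 a k]
      by (simp add: d u_def dl_diff_def dl_uminus_class dl_add_class pow_zero)
    \<comment> \<open>Whether a class is zero does not depend on its denominator, so the unit vector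
      at \<open>u\<close> is only rescaled.\<close>
    moreover have "dl_class \<alpha> a (k + 1) = u \<longleftrightarrow> d = u"
      unfolding d u_def dl_class_eq_iff pow_zero ..
    ultimately show ?thesis using True by (simp add: P_rep_def g_def)
  qed (use uD in \<open>auto simp: P_rep_def g_def\<close>)
  \<comment> \<open>Injectivity of \<open>U\<close> on \<open>W\<close> comes from its isometry: all
    coordinates of \<open>v\<close> vanish, hence so does its inner product with itself.\<close>
  define v where "v = ?\<rho> (u, 1) w - z *\<^sub>C w"
  have rW: "?\<rho> (u, 1) w \<in> W" using W(2)[OF x] w(1) by blast
  have zW: "z *\<^sub>C w \<in> W" by (rule closed_csubspace_scaleC[OF W(1) w(1)])
  have vW: "v \<in> W" unfolding v_def by (rule closed_csubspace_diff[OF W(1) rW zW])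
  have "U v d = 0" for d
  proof -
    have "U (v + z *\<^sub>C w) d = U v d + U (z *\<^sub>C w) d" by (rule U(2)[OF vW zW])
    moreover have "U (v + z *\<^sub>C w) d = z * g d"
      unfolding v_def by (simp add: inter[OF x w(1)] w(2) P)
    ultimately show ?thesis by (simp add: U(3)[OF w(1)] w(2))
  qed
  then have "cinner v v = 0" using U(4)[OF vW vW] by simp
  then have "?\<rho> (u, 1) w = z *\<^sub>C w" by (simp add: v_def)
  \<comment> \<open>For the pair (0, 0) and j = 1 the defining formula reduces to
    \<open>op_power \<delta> (- 1)\<close>.\<close>
  moreover have "?\<rho> (u, 1) w = inv \<delta> w"
    by (simp add: u_def tilde_rep_dl_class unitary_rep_zero[OF rep] op_power_def)
  ultimately have "w = z *\<^sub>C \<delta> w"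
    using unitary_opD(2,5)[OF dilation] by metis
  then have "inverse z *\<^sub>C w = inverse z *\<^sub>C z *\<^sub>C \<delta> w" by simp
  moreover have "z \<noteq> 0" using assms(1) by auto
  ultimately have "\<delta> w = inverse z *\<^sub>C w" by (simp add: scaleC_scaleC)
  moreover have "w \<noteq> 0"
  proof
    assume "w = 0"
    then have "U w u = 0" using U(3)[OF w(1), of 0 u] by simp
    then show False by (simp add: w(2) g_def)
  qed
  ultimately show ?thesis unfolding is_eigenvector_def by blast
qed

end

theorem theorem12:
  fixes \<alpha> :: "'g::{ab_group_add,countable} \<Rightarrow> 'g"
    and \<pi> :: "'g \<Rightarrow> 'h::complex_hilbert \<Rightarrow> 'h"
    and \<delta> :: "'h \<Rightarrow> 'h"
    and V :: "int \<Rightarrow> 'h set"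
    and \<mu> :: "('g \<Rightarrow> complex) measure"
    and \<sigma> :: "nat \<Rightarrow> ('g \<Rightarrow> complex) set"
    and J :: "'h \<Rightarrow> nat \<Rightarrow> ('g \<Rightarrow> complex) \<Rightarrow> complex"
  assumes "dilation_endomorphism \<alpha>"
    and "unitary_rep \<pi>"
    and "unitary_op \<delta>"
    and "\<And>a f. inv \<delta> (\<pi> a (\<delta> f)) = \<pi> (\<alpha> a) f"
    and "gmra_except_intersection \<pi> \<delta> V"
    and "stone_data \<pi> (V 0) \<mu> \<sigma> J"
    and "is_haar_measure \<mu>"
    and "emeasure \<mu> {\<omega> \<in> space \<mu>. multiplicity_fun \<sigma> \<omega> < \<infinity>} > 0"
  shows "((\<Inter>j. V j) \<noteq> {0} \<longleftrightarrow> (\<exists>f. is_eigenvector \<delta> f)) \<and>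
    ((\<exists>f. is_eigenvector \<delta> f) \<longleftrightarrow>
      (\<exists>z. cmod z = 1 \<and>
        contains_subrep_equivalent_to (G_carrier \<alpha>) (tilde_rep \<pi> \<delta>)
          (dl_carrier \<alpha>) (P_rep \<alpha> z)))"
proof -
  interpret haar_gmra \<alpha> \<mu> \<pi> \<delta> V \<sigma> J
    by (intro haar_gmra.intro haar_gmra_axioms.intro haar_dilation.intro haar_measure.intro)
      (rule assms)+
  have core: "(\<Inter>j. V j) \<noteq> {0}" if "\<exists>f. is_eigenvector \<delta> f"
  proof -
    from that obtain f c where "f \<noteq> 0" "\<delta> f = c *\<^sub>C f" unfolding is_eigenvector_def by blast
    then show ?thesis using eigenvector_in_core[OF assms(5,3), of f c] by auto
  qed
  show ?thesis
  proof (intro conjI iffI)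
    show "\<exists>f. is_eigenvector \<delta> f" if "(\<Inter>j. V j) \<noteq> {0}" using that by (rule eigenvector_if_core)
    show "\<exists>z. cmod z = 1 \<and> contains_subrep_equivalent_to (G_carrier \<alpha>) (tilde_rep \<pi> \<delta>)
        (dl_carrier \<alpha>) (P_rep \<alpha> z)" if "\<exists>f. is_eigenvector \<delta> f"
      using that by (elim exE) (rule subrep_if_eigenvector)
    show "\<exists>f. is_eigenvector \<delta> f" if "\<exists>z. cmod z = 1 \<and>
        contains_subrep_equivalent_to (G_carrier \<alpha>) (tilde_rep \<pi> \<delta>) (dl_carrier \<alpha>) (P_rep \<alpha> z)"
      using that by (elim exE conjE) (rule eigenvector_if_subrep)
  qed (rule core)
qed

end
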